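(* Let $K:\mathbb{R}\to\mathbb{R}$ be smooth and integrable over $\mathbb{R}$, symmetric (even), monotonically decreasing on $[0,\infty)$, and normalized by $K(0)=1$. Consider the Cauchy problem $$\partial_t u + u\,\partial_x u + \int_{\mathbb{R}} K(x-\xi)\,u_\xi(t,\xi)\,d\xi = 0,\quad t>0,\ x\in\mathbb{R},\qquad u(0,x)=u_0(x),\quad x\in\mathbb{R}.$$ Let $u_0\in H^\infty(\mathbb{R})$ be real-valued and set $m_1(0)=\inf_{x\in\mathbb{R}}u_0'(x)$ and $m_2(0)=\sup_{x\in\mathbb{R}}u_0'(x)$. If $(m_1(0),m_2(0))\in\Omega$, where $$\Omega=\{(m_1,m_2)\in\mathbb{R}^2 \mid m_1<-2 \text{ and } 0\le m_2<m_1^2+m_1\},$$ then the solution $u$ must develop wave breaking before time $T^*$, where $$T^*=\frac12\log\left(\frac{m_1(0)}{2+m_1(0)}\right)+\max\left\{0,\ \frac{m_1(0)+m_2(0)}{2m_1(0)(2+m_1(0))}\right\}.$$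
   Context: $H^\infty(\mathbb{R})=\bigcap_{s\ge 0}H^s(\mathbb{R})$. The solution $u$ is the smooth ($H^\infty$-valued) solution with initial datum $u_0$ on its maximal interval of existence. Wave breaking means that the solution stays bounded while its derivative becomes unbounded in finite time: "$u$ develops wave breaking before $T^*$" means that there is a time $T$ with $0<T<T^*$ such that $u$ is a smooth solution on $[0,T)$, $u$ remains bounded on $[0,T)\times\mathbb{R}$, and $u_x$ becomes unbounded as $t\uparrow T$. *)

theory Defs
  imports "HOL-Analysis.Analysis"
begin

definition smooth :: "(real \<Rightarrow> real) \<Rightarrow> bool" where
  "smooth f \<longleftrightarrow> (\<forall>n x. (deriv ^^ n) f field_differentiable at x)"

definition square_integrable :: "(real \<Rightarrow> 'b::{real_normed_vector, second_countable_topology}) \<Rightarrow> bool" where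
  "square_integrable f \<longleftrightarrow> f \<in> borel_measurable borel \<and> integrable lborel (\<lambda>x. (norm (f x))\<^sup>2)"

text \<open>The Fourier-Plancherel transform on \<open>L\<^sup>2\<close>: the mean-square limit of
  \<open>\<xi> \<mapsto> \<integral>\<^bsub>-R\<^esub>\<^bsup>R\<^esup> f(x) exp(-i x \<xi>) dx\<close> as \<open>R \<rightarrow> \<infinity>\<close>. It is determined up to null sets, and the
  definitions below do not depend on the representative that is chosen.\<close>

definition is_fourier_transform :: "(real \<Rightarrow> real) \<Rightarrow> (real \<Rightarrow> complex) \<Rightarrow> bool" where
  "is_fourier_transform f g \<longleftrightarrow> square_integrable g \<and>
     ((\<lambda>R. \<integral>\<^sup>+ \<xi>. ennreal ((cmod (g \<xi> - (LINT x:{-R..R}|lborel. of_real (f x) * cis (- (x * \<xi>)))))\<^sup>2) \<partial>lborel)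
        \<longlongrightarrow> 0) at_top"

definition fourier :: "(real \<Rightarrow> real) \<Rightarrow> real \<Rightarrow> complex" where
  "fourier f = (SOME g. is_fourier_transform f g)"

definition sobolev :: "real \<Rightarrow> (real \<Rightarrow> real) set" where
  "sobolev s = {f. square_integrable f \<and>
     integrable lborel (\<lambda>\<xi>. (1 + \<xi>\<^sup>2) powr s * (cmod (fourier f \<xi>))\<^sup>2)}"

definition sobolev_norm :: "real \<Rightarrow> (real \<Rightarrow> real) \<Rightarrow> real" where
  "sobolev_norm s f = sqrt (LINT \<xi>|lborel. (1 + \<xi>\<^sup>2) powr s * (cmod (fourier f \<xi>))\<^sup>2)"

text \<open>Elements of \<open>sobolev s\<close> matter only up to null sets; by Sobolev embedding every class in
  the intersection has exactly one smooth representative, and \<open>H_infty\<close> consists of these.\<close>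

definition H_infty :: "(real \<Rightarrow> real) set" where
  "H_infty = {f. smooth f} \<inter> (\<Inter>s\<in>{0..}. sobolev s)"

text \<open>\<open>C\<^sup>\<infinity>(I; H_infty)\<close>: \<open>v k\<close> is the \<open>k\<close>-th time derivative of \<open>u\<close>, where difference quotients
  converge in every \<open>H\<^sup>s\<close> (one-sidedly at end points belonging to \<open>I\<close>).\<close>

definition smooth_H_infty_curve :: "real set \<Rightarrow> (real \<Rightarrow> real \<Rightarrow> real) \<Rightarrow> bool" where
  "smooth_H_infty_curve I u \<longleftrightarrow> (\<exists>v :: nat \<Rightarrow> real \<Rightarrow> real \<Rightarrow> real.
     (\<forall>t\<in>I. v 0 t = u t) \<and>
     (\<forall>k. \<forall>t\<in>I. v k t \<in> H_infty \<and>
        (\<forall>s\<ge>0. ((\<lambda>\<tau>. sobolev_norm s (\<lambda>x. (v k \<tau> x - v k t x) / (\<tau> - t) - v (Suc k) t x))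
                   \<longlongrightarrow> 0) (at t within I))))"

text \<open>Solutions on \<open>[0, T)\<close> with \<open>0 < T \<le> \<infinity>\<close>; the values \<open>u t\<close> for other \<open>t\<close> are irrelevant.\<close>

definition smooth_solution ::
  "(real \<Rightarrow> real) \<Rightarrow> (real \<Rightarrow> real) \<Rightarrow> ereal \<Rightarrow> (real \<Rightarrow> real \<Rightarrow> real) \<Rightarrow> bool" where
  "smooth_solution K u0 T u \<longleftrightarrow> 0 < T \<and>
     smooth_H_infty_curve {t. 0 \<le> t \<and> ereal t < T} u \<and>
     (\<forall>t x. 0 < t \<and> ereal t < T \<longrightarrow>
        (\<lambda>\<tau>. u \<tau> x) field_differentiable at t \<and>
        deriv (\<lambda>\<tau>. u \<tau> x) t + u t x * deriv (u t) x
          + (LINT \<xi>|lborel. K (x - \<xi>) * deriv (u t) \<xi>) = 0) \<and>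
     (\<forall>x. u 0 x = u0 x)"

definition maximal_smooth_solution ::
  "(real \<Rightarrow> real) \<Rightarrow> (real \<Rightarrow> real) \<Rightarrow> ereal \<Rightarrow> (real \<Rightarrow> real \<Rightarrow> real) \<Rightarrow> bool" where
  "maximal_smooth_solution K u0 T u \<longleftrightarrow> smooth_solution K u0 T u \<and>
     \<not> (\<exists>T' w. T < T' \<and> smooth_solution K u0 T' w \<and>
          (\<forall>t x. 0 \<le> t \<and> ereal t < T \<longrightarrow> w t x = u t x))"

definition wave_breaking_before ::
  "(real \<Rightarrow> real) \<Rightarrow> (real \<Rightarrow> real) \<Rightarrow> (real \<Rightarrow> real \<Rightarrow> real) \<Rightarrow> real \<Rightarrow> bool" where
  "wave_breaking_before K u0 u Tstar \<longleftrightarrow> (\<exists>T. 0 < T \<and> T < Tstar \<and>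
     smooth_solution K u0 (ereal T) u \<and>
     (\<exists>C. \<forall>t x. 0 \<le> t \<and> t < T \<longrightarrow> \<bar>u t x\<bar> \<le> C) \<and>
     (\<forall>M. \<exists>\<^sub>F t in at_left T. \<exists>x. \<bar>deriv (u t) x\<bar> > M))"

definition Omega :: "(real \<times> real) set" where
  "Omega = {(m1, m2). m1 < -2 \<and> 0 \<le> m2 \<and> m2 < m1\<^sup>2 + m1}"

end

theory Submission
  imports Defs "HOL-Probability.Probability"
begin

text \<open>Integration by parts turns the nonlocal term into \<open>K' * u\<close>, convolution with an integrable odd function,
  which is bounded on every \<open>H\<^sup>s\<close>. For \<open>w = u\<^sub>x\<close> the equation reads \<open>w\<^sub>t + u w\<^sub>x = - w\<^sup>2 - K' * w\<close>, and
  \<open>\<bar>K' * w\<bar> \<le> m2 - m1\<close>, where \<open>m1 = inf w\<close> and \<open>m2 = sup w\<close>: the two halves of \<open>K'\<close> have mass \<open>K(0) = 1\<close>.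
  At extrema of \<open>w\<close> this gives the differential inequalities \<open>m1' \<le> - m1\<^sup>2 + m2 - m1\<close> and \<open>m2' \<le> - m2\<^sup>2 + m2 - m1\<close>
  for upper right Dini derivatives, which cannot persist up to \<open>T\<^sup>*\<close> when the initial values lie in \<open>Omega\<close>. Hence the
  maximal existence time \<open>T\<close> is smaller than \<open>T\<^sup>*\<close>. On \<open>[0, T)\<close> the sup norm of \<open>u\<close> grows at most exponentially, since
  \<open>u\<^sub>t\<close> is bounded by \<open>\<parallel>K'\<parallel>\<^sub>1 sup \<bar>u\<bar>\<close> at extrema of \<open>u\<close>. If \<open>u\<^sub>x\<close> were bounded near \<open>T\<close>, the solution could be
  continued beyond \<open>T\<close>: the Lax--Friedrichs scheme converges in \<open>H\<^sup>\<infinity>\<close> on a time interval whose length depends only on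
  \<open>sup \<bar>u\<^sub>x\<bar>\<close>.\<close>

subsection \<open>Plancherel's theorem and the Fourier transform of derivatives\<close>

text \<open>The notion of solution rests on a transform chosen by \<open>SOME\<close>, so its
  existence and Plancherel's identity have to come before everything else. They serve to identify
  \<open>H_infty\<close> with the smooth functions all of whose derivatives are square integrable;
  from then on the estimates concern L2 norms of derivatives. The obstacle to local existence is
  that \<open>u * dx u\<close> costs a derivative, so a Picard iteration does not close in any fixed
  H^s. The scheme works with translates instead of derivatives, and its stability sees only sup
  |u_x|. Convergence is proved in L2, where consistency may spend two derivatives, and is lifted to
  all orders by interpolation against uniform bounds. Two further points shape the last part. The
  infimum and supremum of u_x need not be differentiable in time, and a supremum equal to 0 need not
  be attained; hence one-sided Dini bounds, with near-maxima in place of maxima. Moreover T < T^* is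
  strict, whereas the controlling functional is merely nonincreasing, so one moment of strict
  decrease has to be found.\<close>

definition ft :: "(real \<Rightarrow> real) \<Rightarrow> real \<Rightarrow> complex" where
  "ft h \<xi> = (LINT x|lborel. of_real (h x) * cis (- (x * \<xi>)))"

lemma borel_measurable_cis [measurable (raw)]:
  "f \<in> borel_measurable M \<Longrightarrow> (\<lambda>x. cis (f x)) \<in> borel_measurable M"
  using borel_measurable_continuous_on[of cis f M]
  by (simp add: continuous_on_cis continuous_on_id)

lemma integral_cis_std_normal:
  "(LINT z|std_normal_distribution. cis (t * z)) = of_real (exp (- (t\<^sup>2) / 2))"
  using fun_cong[OF char_std_normal_distribution, of t]
  by (simp add: char_def cis_conv_exp)

text \<open>The squared modulus is a double integral over \<open>M\<close>, and averaging over
  \<open>z\<close> turns \<open>cis\<close> into the characteristic function of the normal law. As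
  \<open>M\<close> is finite and \<open>h\<close> bounded, all integrands are bounded and Fubini
  applies without further estimates.\<close>

lemma gaussian_average_ft:
  fixes h :: "real \<Rightarrow> real" and M :: "real measure"
  assumes fin: "finite_measure M" and [measurable_cong]: "sets M = sets borel"
    and [measurable]: "h \<in> borel_measurable borel" and B: "\<And>x. \<bar>h x\<bar> \<le> B"
  shows "(LINT z|std_normal_distribution. (cmod (LINT x|M. of_real (h x) * cis (- (x * (a * z)))))\<^sup>2)
       = (LINT x|M. LINT y|M. h x * h y * exp (- ((a * (x - y))\<^sup>2) / 2))"
proof -
  let ?N = "std_normal_distribution"
  interpret finite_measure M by fact
  interpret N: real_distribution ?N by (rule real_dist_normal_dist)
  interpret MM: pair_sigma_finite M M ..
  interpret F: finite_measure "M \<Otimes>\<^sub>M M"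
    by (intro finite_measure_pair_measure fin)
  interpret Q: pair_sigma_finite ?N "M \<Otimes>\<^sub>M M" ..
  interpret QF: finite_measure "?N \<Otimes>\<^sub>M (M \<Otimes>\<^sub>M M)"
    by (intro finite_measure_pair_measure F.finite_measure_axioms N.finite_measure_axioms)
  have B0: "0 \<le> B" using B[of 0] by linarith
  have [simp]: "space M = UNIV" using assms(2) sets_eq_imp_space_eq by force
  let ?g = "\<lambda>z x. of_real (h x) * cis (- (x * (a * z))) :: complex"
  let ?c = "\<lambda>z x. of_real (h x) * cis (x * (a * z)) :: complex"
  have ig: "integrable M (?g z)" for z
    by (rule integrable_const_bound[where B=B]) (auto simp: norm_mult B)
  have 1: "of_real ((cmod (LINT x|M. ?g z x))\<^sup>2)
      = (LINT p|(M \<Otimes>\<^sub>M M). of_real (h (fst p) * h (snd p)) * cis (- (a * (fst p - snd p)) * z))" for z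
  proof -
    have "of_real ((cmod (LINT x|M. ?g z x))\<^sup>2) = (LINT x|M. ?g z x) * cnj (LINT x|M. ?g z x)"
      by (metis complex_norm_square of_real_power)
    also have "cnj (LINT x|M. ?g z x) = (LINT x|M. cnj (?g z x))" by (rule Bochner_Integration.integral_cnj[symmetric])
    also have "\<dots> = (LINT x|M. ?c z x)" by (simp add: cis_cnj)
    also have "(LINT x|M. ?g z x) * \<dots> = (LINT x|M. LINT y|M. ?g z x * ?c z y)"
      by simp
    also have "\<dots> = (LINT p|(M \<Otimes>\<^sub>M M). ?g z (fst p) * ?c z (snd p))"
    proof -
      have "integrable (M \<Otimes>\<^sub>M M) (\<lambda>p. ?g z (fst p) * ?c z (snd p))"
        by (rule F.integrable_const_bound[where B="B*B"])
           (auto simp: norm_mult intro!: mult_mono B B0)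
      from MM.integral_fst'[OF this] show ?thesis by simp
    qed
    also have "\<dots> = (LINT p|(M \<Otimes>\<^sub>M M). of_real (h (fst p) * h (snd p)) * cis (- (a * (fst p - snd p)) * z))"
    proof (intro Bochner_Integration.integral_cong refl)
      fix p :: "real \<times> real"
      obtain x y where p: "p = (x, y)" by (cases p)
      have "cis (- (x * (a * z))) * cis (y * (a * z)) = cis (- (a * (x - y)) * z)"
        by (simp only: cis_mult) (simp add: algebra_simps)
      then show "?g z (fst p) * ?c z (snd p) = of_real (h (fst p) * h (snd p)) * cis (- (a * (fst p - snd p)) * z)"
        by (simp add: p mult_ac)
    qed
    finally show ?thesis .
  qed
  let ?G = "\<lambda>q. of_real (h (fst (snd q)) * h (snd (snd q))) * cis (- (a * (fst (snd q) - snd (snd q))) * fst q)"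
  have iG: "integrable (?N \<Otimes>\<^sub>M (M \<Otimes>\<^sub>M M)) ?G"
    by (rule QF.integrable_const_bound[where B="B*B"])
       (auto simp: norm_mult abs_mult intro!: mult_mono B B0)
  have "of_real (LINT z|?N. (cmod (LINT x|M. ?g z x))\<^sup>2)
      = (LINT z|?N. LINT p|(M \<Otimes>\<^sub>M M). ?G (z, p))"
    unfolding integral_complex_of_real[symmetric] 1 by simp
  also have "\<dots> = (LINT p|(M \<Otimes>\<^sub>M M). LINT z|?N. ?G (z, p))"
    using Q.Fubini_integral[of "\<lambda>z p. ?G (z, p)"] iG by (simp add: case_prod_unfold)
  also have "\<dots> = (LINT p|(M \<Otimes>\<^sub>M M). of_real (h (fst p) * h (snd p) * exp (- ((a * (fst p - snd p))\<^sup>2) / 2)))"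
  proof (intro Bochner_Integration.integral_cong refl)
    fix p :: "real \<times> real"
    have "(LINT z|?N. cis (- (a * (fst p - snd p)) * z)) = of_real (exp (- ((a * (fst p - snd p))\<^sup>2) / 2))"
      using integral_cis_std_normal[of "- (a * (fst p - snd p))"] by (simp del: of_real_exp)
    then show "(LINT z|?N. ?G (z, p)) = of_real (h (fst p) * h (snd p) * exp (- ((a * (fst p - snd p))\<^sup>2) / 2))"
      by (simp del: of_real_exp mult_minus_left)
  qed
  also have "\<dots> = of_real (LINT p|(M \<Otimes>\<^sub>M M). h (fst p) * h (snd p) * exp (- ((a * (fst p - snd p))\<^sup>2) / 2))"
    by (rule integral_complex_of_real)
  also have "(LINT p|(M \<Otimes>\<^sub>M M). h (fst p) * h (snd p) * exp (- ((a * (fst p - snd p))\<^sup>2) / 2))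
     = (LINT x|M. LINT y|M. h x * h y * exp (- ((a * (x - y))\<^sup>2) / 2))"
  proof -
    have "\<bar>h x * h y * exp (- ((a * (x - y))\<^sup>2) / 2)\<bar> \<le> B * B * 1" for x y
      unfolding abs_mult by (intro mult_mono B) (auto simp: B0)
    then have "integrable (M \<Otimes>\<^sub>M M) (\<lambda>p. h (fst p) * h (snd p) * exp (- ((a * (fst p - snd p))\<^sup>2) / 2))"
      by (intro F.integrable_const_bound[where B="B*B"]) auto
    from MM.integral_fst'[OF this] show ?thesis by simp
  qed
  finally show ?thesis by (simp only: of_real_eq_iff)
qed

text \<open>As \<open>a \<rightarrow> \<infinity>\<close> in the preceding identity, the Gaussian weight on the left becomes flat and the Gaussian on the right an
  approximate identity.\<close>

lemma plancherel_bounded: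
  fixes h :: "real \<Rightarrow> real"
  assumes [measurable]: "h \<in> borel_measurable borel" and B: "\<And>x. \<bar>h x\<bar> \<le> B"
    and supp: "\<And>x. \<bar>x\<bar> > A \<Longrightarrow> h x = 0"
    and cont: "AE x in lborel. isCont h x"
  shows "has_bochner_integral lborel (\<lambda>\<xi>. (cmod (ft h \<xi>))\<^sup>2) (2 * pi * (LINT x|lborel. (h x)\<^sup>2))"
proof -
  let ?N = "std_normal_distribution"
  interpret N: real_distribution ?N by (rule real_dist_normal_dist)
  define M where "M = density lborel (\<lambda>x. ennreal (indicator {-A..A} x))"
  have [measurable_cong]: "sets M = sets borel" unfolding M_def by simp
  have [simp]: "space M = UNIV" unfolding M_def by simp
  have [simp]: "indicator {-A..A} x * h x = h x" for x
    by (cases "x \<in> {-A..A}") (auto intro!: supp)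
  have fin: "finite_measure M"
    unfolding M_def by (rule finite_measureI) (auto simp: emeasure_density ennreal_indicator emeasure_lborel_Icc_eq)
  interpret finite_measure M by fact
  have Mint: "(LINT x|M. f x) = (LINT x|lborel. indicator {-A..A} x *\<^sub>R f x)"
    if "f \<in> borel_measurable borel" for f :: "real \<Rightarrow> 'b::{banach, second_countable_topology}"
    unfolding M_def using that by (subst integral_density) auto
  have B0: "0 \<le> B" using B[of 0] by linarith
  have ftM: "ft h \<xi> = (LINT x|M. of_real (h x) * cis (- (x * \<xi>)))" for \<xi>
    unfolding ft_def by (subst Mint) (auto intro!: Bochner_Integration.integral_cong simp: scaleR_conv_of_real mult.assoc[symmetric] simp flip: of_real_mult)
  have [measurable]: "ft h \<in> borel_measurable borel"
    unfolding ftM by measurable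
  have ftB: "cmod (ft h \<xi>) \<le> B * measure M UNIV" for \<xi>
  proof -
    have "cmod (ft h \<xi>) \<le> (LINT x|M. cmod (of_real (h x) * cis (- (x * \<xi>))))"
      unfolding ftM by (rule integral_norm_bound)
    also have "\<dots> \<le> (LINT x|M. B)"
      by (intro integral_mono integrable_const_bound[where B=B]) (auto simp: norm_mult B B0)
    finally show ?thesis by (simp add: mult.commute)
  qed
  define a where "a n = real (Suc n)" for n
  have a0: "a n > 0" for n by (simp add: a_def)
  define f where "f n \<xi> = (cmod (ft h \<xi>))\<^sup>2 * exp (- ((\<xi> / a n)\<^sup>2) / 2)" for n \<xi>
  have fN: "(LINT z|?N. (cmod (ft h (a n * z)))\<^sup>2) = (LINT z|lborel. std_normal_density z * (cmod (ft h (a n * z)))\<^sup>2)" for n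
    by (subst integral_density) (auto simp: normal_density_nonneg)
  have idom: "integrable lborel (\<lambda>z. std_normal_density z * (cmod (ft h (a n * z)))\<^sup>2)" for n
  proof (rule Bochner_Integration.integrable_bound[where f="\<lambda>z. (B * measure M UNIV)\<^sup>2 * std_normal_density z"])
    show "AE z in lborel. norm (std_normal_density z * (cmod (ft h (a n * z)))\<^sup>2) \<le> norm ((B * measure M UNIV)\<^sup>2 * std_normal_density z)"
      using ftB by (auto intro!: AE_I2 mult_mono power_mono simp: normal_density_nonneg abs_mult mult.commute)
  qed auto
  have fint: "integrable lborel (f n)" and fval: "(LINT \<xi>|lborel. f n \<xi>) = a n * sqrt (2 * pi) * (LINT z|?N. (cmod (ft h (a n * z)))\<^sup>2)" for n
  proof -
    have eq: "f n \<xi> = sqrt (2*pi) * (std_normal_density (0 + 1 / a n * \<xi>) * (cmod (ft h (a n * (0 + 1 / a n * \<xi>))))\<^sup>2)" for \<xi>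
      using a0[of n] by (simp add: f_def std_normal_density_def)
    show "integrable lborel (f n)"
      unfolding eq by (rule integrable_mult_right, rule lborel_integrable_real_affine[OF idom]) (use a0[of n] in auto)
    show "(LINT \<xi>|lborel. f n \<xi>) = a n * sqrt (2 * pi) * (LINT z|?N. (cmod (ft h (a n * z)))\<^sup>2)"
      unfolding fN
      by (subst lborel_integral_real_affine[where c="a n" and t=0])
         (use a0[of n] in \<open>auto simp: eq abs_of_pos\<close>)
  qed
  have conv: "(LINT \<xi>|lborel. f n \<xi>) = 2 * pi * (LINT x|M. h x * (LINT z|?N. h (x - z / a n)))" for n
  proof -
    have inner: "a n * (LINT y|M. h x * h y * exp (- ((a n * (x - y))\<^sup>2) / 2))
        = sqrt (2 * pi) * (h x * (LINT z|?N. h (x - z / a n)))" for x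
    proof -
      have ind: "indicator {-A..A} y *\<^sub>R (h x * h y * e) = h x * h y * e" for y e
      proof -
        have "indicator {-A..A} y * (h x * h y * e) = h x * (indicator {-A..A} y * h y) * e" by (simp only: mult_ac)
        then show ?thesis by simp
      qed
      have e1: "(LINT y|M. h x * h y * exp (- ((a n * (x - y))\<^sup>2) / 2)) = (LINT y|lborel. h x * h y * exp (- ((a n * (x - y))\<^sup>2) / 2))"
        by (subst Mint, measurable) (simp only: ind)
      have e2: "(LINT y|lborel. h x * h y * exp (- ((a n * (x - y))\<^sup>2) / 2)) = \<bar>- 1 / a n\<bar> *\<^sub>R (LINT z|lborel. h x * h (x + (- 1 / a n) * z) * exp (- ((a n * (x - (x + (- 1 / a n) * z)))\<^sup>2) / 2))"
        by (rule lborel_integral_real_affine) (use a0[of n] in auto)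
      have "a n * (LINT y|M. h x * h y * exp (- ((a n * (x - y))\<^sup>2) / 2)) = (LINT z|lborel. h x * h (x - z / a n) * exp (- (z\<^sup>2) / 2))"
        unfolding e1 e2 using a0[of n] by simp
      also have "\<dots> = (LINT z|lborel. sqrt (2 * pi) * h x * (std_normal_density z * h (x - z / a n)))"
        by (intro Bochner_Integration.integral_cong refl) (simp add: std_normal_density_def)
      also have "\<dots> = sqrt (2 * pi) * h x * (LINT z|lborel. std_normal_density z * h (x - z / a n))"
        by simp
      also have "(LINT z|lborel. std_normal_density z * h (x - z / a n)) = (LINT z|?N. h (x - z / a n))"
        by (subst integral_density) (auto simp: normal_density_nonneg)
      finally show ?thesis by simp
    qed
    have "(LINT z|?N. (cmod (ft h (a n * z)))\<^sup>2) = (LINT x|M. LINT y|M. h x * h y * exp (- ((a n * (x - y))\<^sup>2) / 2))"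
      unfolding ftM by (rule gaussian_average_ft[OF fin \<open>sets M = sets borel\<close> assms(1) B])
    then have "(LINT \<xi>|lborel. f n \<xi>) = sqrt (2 * pi) * (LINT x|M. a n * (LINT y|M. h x * h y * exp (- ((a n * (x - y))\<^sup>2) / 2)))"
      unfolding fval by simp
    also have "\<dots> = sqrt (2 * pi) * (sqrt (2 * pi) * (LINT x|M. h x * (LINT z|?N. h (x - z / a n))))"
      unfolding inner by simp
    finally show ?thesis by simp
  qed
  have lim: "(\<lambda>n. LINT \<xi>|lborel. f n \<xi>) \<longlonglongrightarrow> 2 * pi * (LINT x|M. h x * h x)"
    unfolding conv
  proof (intro tendsto_mult_left integral_dominated_convergence[where w="\<lambda>_. B * B"])
    have "AE x in M. isCont h x" unfolding M_def using cont by (auto simp: AE_density)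
    then show "AE x in M. (\<lambda>n. h x * (LINT z|?N. h (x - z / a n))) \<longlonglongrightarrow> h x * h x"
    proof eventually_elim
      case (elim x)
      have "(\<lambda>n. LINT z|?N. h (x - z / a n)) \<longlonglongrightarrow> (LINT z|?N. h x)"
      proof (rule integral_dominated_convergence[where w="\<lambda>_. B"])
        have "(\<lambda>n. x - z / a n) \<longlonglongrightarrow> x" for z unfolding a_def by real_asymp
        then show "AE z in ?N. (\<lambda>n. h (x - z / a n)) \<longlonglongrightarrow> h x"
          using isCont_tendsto_compose[OF elim] by auto
      qed (auto simp: B)
      then show ?case by (intro tendsto_mult_left) (use N.prob_space in simp)
    qed
    show "AE x in M. norm (h x * (LINT z|?N. h (x - z / a n))) \<le> B * B" for n
    proof (intro AE_I2)
      fix x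
      have "\<bar>LINT z|?N. h (x - z / a n)\<bar> \<le> (LINT z|?N. \<bar>h (x - z / a n)\<bar>)" by (rule integral_abs_bound)
      also have "\<dots> \<le> (LINT z|?N. B)" 
        by (intro integral_mono N.integrable_const_bound[where B=B]) (auto simp: B B0)
      also have "\<dots> = B" using N.prob_space by simp
      finally show "norm (h x * (LINT z|?N. h (x - z / a n))) \<le> B * B"
        unfolding real_norm_def abs_mult by (intro mult_mono B) (auto simp: B0)
    qed
  qed auto
  have M2: "(LINT x|M. h x * h x) = (LINT x|lborel. (h x)\<^sup>2)"
    by (subst Mint) (auto simp: power2_eq_square mult.assoc[symmetric])
  \<comment> \<open>Monotone convergence, because no integrable majorant of
    \<open>(cmod (ft h \<xi>))\<^sup>2\<close> is known: its integrability is part of the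
    claim.\<close>
  show ?thesis
  proof (rule has_bochner_integral_monotone_convergence[OF fint])
    show "AE x in lborel. mono (\<lambda>n. f n x)"
    proof (intro AE_I2 monoI)
      fix x m n assume "m \<le> (n::nat)"
      then have "\<bar>x / a n\<bar> \<le> \<bar>x / a m\<bar>" by (auto simp: a_def abs_divide intro!: divide_left_mono)
      then have "(x / a n)\<^sup>2 \<le> (x / a m)\<^sup>2" by (simp only: abs_le_square_iff)
      then show "f m x \<le> f n x" unfolding f_def by (intro mult_left_mono) auto
    qed
    have "(\<lambda>n. exp (- ((x / a n)\<^sup>2) / 2)) \<longlonglongrightarrow> 1" for x
    proof -
      have "(\<lambda>n. x / a n) \<longlonglongrightarrow> 0"
        using LIMSEQ_Suc[OF lim_const_over_n[of x]] unfolding a_def .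
      from tendsto_exp[OF tendsto_divide[OF tendsto_minus[OF tendsto_power[OF this, of 2]] tendsto_const[of 2]]]
      show ?thesis by simp
    qed
    from tendsto_mult_left[OF this]
    show "AE x in lborel. (\<lambda>n. f n x) \<longlonglongrightarrow> (cmod (ft h x))\<^sup>2" unfolding f_def by fastforce
    show "(\<lambda>n. LINT \<xi>|lborel. f n \<xi>) \<longlonglongrightarrow> 2 * pi * (LINT x|lborel. (h x)\<^sup>2)"
      using lim unfolding M2 .
  qed auto
qed

section \<open>Transforms of truncated functions and existence of the transform on L2\<close>

abbreviation window :: "real \<Rightarrow> real \<Rightarrow> (real \<Rightarrow> real) \<Rightarrow> real \<Rightarrow> complex" where
  "window a b f \<equiv> ft (\<lambda>x. indicator {a..b} x * f x)"

text \<open>Continuity is required because truncations of continuous functions are bounded and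
  continuous almost everywhere, which is what \<open>plancherel_bounded\<close> asks for. Elements
  of \<open>H_infty\<close> are smooth, so this class suffices.\<close>

definition cont_L2 :: "(real \<Rightarrow> real) \<Rightarrow> bool" where
  "cont_L2 f \<longleftrightarrow> (\<forall>x. isCont f x) \<and> integrable lborel (\<lambda>x. (f x)\<^sup>2)"

lemma cont_L2_measurable: "cont_L2 f \<Longrightarrow> f \<in> borel_measurable borel"
  unfolding cont_L2_def
  by (intro borel_measurable_continuous_onI) (simp add: continuous_at_imp_continuous_on)

lemma ft_measurable [measurable]:
  assumes [measurable]: "h \<in> borel_measurable borel"
  shows "ft h \<in> borel_measurable borel"
  unfolding ft_def by measurable

lemma isCont_indicator_Icc: "x \<noteq> a \<Longrightarrow> x \<noteq> b \<Longrightarrow> isCont (indicator {a..b} :: real \<Rightarrow> real) x" for x a b :: real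
  by (simp add: isCont_indicator frontier_def)

lemma window_integrable:
  fixes a b :: real
  assumes "\<And>x. isCont f x"
  shows "integrable lborel (\<lambda>x. indicator {a..b} x * (f x :: real))"
  using borel_integrable_atLeastAtMost'[of a b f] assms
  by (auto simp: set_integrable_def continuous_at_imp_continuous_on)

lemma window_diff:
  assumes "\<And>x. isCont f x"
  shows "ft (\<lambda>x. (indicator {a..b} x - indicator {c..d} x) * f x) \<xi> = window a b f \<xi> - window c d f \<xi>"
proof -
  have 1: "integrable lborel (\<lambda>x. of_real (indicator {a..b} x * f x) * cis (- (x * \<xi>)))" for a b
  proof (rule Bochner_Integration.integrable_bound[OF window_integrable[OF assms, of a b]])
    have [measurable]: "f \<in> borel_measurable borel"
      using assms by (intro borel_measurable_continuous_onI) (simp add: continuous_at_imp_continuous_on)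
    show "(\<lambda>x. of_real (indicator {a..b} x * f x) * cis (- (x * \<xi>))) \<in> borel_measurable lborel" by measurable
  qed (auto simp: norm_mult)
  show ?thesis unfolding ft_def
    by (subst Bochner_Integration.integral_diff[OF 1 1, symmetric]) (simp add: algebra_simps)
qed

text \<open>The difference of two truncations of \<open>f\<close> is bounded, compactly supported
  and continuous off the four end points. The choice \<open>c = 1\<close>, \<open>d = 0\<close>
  makes the second interval empty and yields the statement for a single window.\<close>

lemma window_plancherel:
  assumes "\<And>x. isCont f x"
  shows "has_bochner_integral lborel (\<lambda>\<xi>. (cmod (window a b f \<xi> - window c d f \<xi>))\<^sup>2)
    (2 * pi * (LINT x|lborel. (indicator {a..b} x - indicator {c..d} x)\<^sup>2 * (f x)\<^sup>2))"
proof -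
  let ?h = "\<lambda>x. (indicator {a..b} x - indicator {c..d} x) * f x"
  have [measurable]: "f \<in> borel_measurable borel"
    using assms by (intro borel_measurable_continuous_onI) (simp add: continuous_at_imp_continuous_on)
  define A where "A = \<bar>a\<bar> + \<bar>b\<bar> + \<bar>c\<bar> + \<bar>d\<bar>"
  have A: "\<bar>a\<bar> \<le> A" "\<bar>b\<bar> \<le> A" "\<bar>c\<bar> \<le> A" "\<bar>d\<bar> \<le> A" unfolding A_def by auto
  have "compact (f ` {-A..A})"
    using assms by (intro compact_continuous_image) (auto simp: continuous_at_imp_continuous_on)
  then obtain B where B: "\<forall>x\<in>{-A..A}. \<bar>f x\<bar> \<le> B"
    by (auto dest!: compact_imp_bounded simp: bounded_iff)
  have out: "?h x = 0" if "\<bar>x\<bar> > A" for x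
    using A that by (auto simp: indicator_def abs_if split: if_splits)
  have "\<bar>?h x\<bar> \<le> max B 0" for x
  proof (cases "\<bar>x\<bar> > A")
    case False
    then have "\<bar>f x\<bar> \<le> B" using B by (meson abs_le_D1 abs_le_D2 atLeastAtMost_iff minus_le_iff not_less)
    moreover have "\<bar>indicator {a..b} x - indicator {c..d} x :: real\<bar> \<le> 1" by (auto simp: indicator_def)
    ultimately show ?thesis
      unfolding abs_mult using mult_mono[of "\<bar>indicator {a..b} x - indicator {c..d} x\<bar>" 1 "\<bar>f x\<bar>" B] by auto
  qed (simp add: out)
  moreover have "AE x in lborel. isCont ?h x"
  proof -
    have "AE x in lborel. x \<notin> {a,b,c,d}"
      by (intro AE_not_in) (auto intro!: finite_imp_null_set_lborel)
    then show ?thesis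
    proof eventually_elim
      case (elim x)
      then show ?case by (intro continuous_intros isCont_indicator_Icc assms) auto
    qed
  qed
  ultimately show ?thesis
    using plancherel_bounded[of ?h "max B 0" A] out
    by (simp add: window_diff[OF assms] power_mult_distrib)
qed

definition tail_L2 :: "(real \<Rightarrow> real) \<Rightarrow> real \<Rightarrow> real" where
  "tail_L2 f R = (LINT x|lborel. indicator {x. R < \<bar>x\<bar>} x * (f x)\<^sup>2)"

lemma tail_L2_tendsto:
  assumes "integrable lborel (\<lambda>x. (f x)\<^sup>2)"
  shows "(tail_L2 f \<longlongrightarrow> 0) at_top"
proof -
  note [measurable] = borel_measurable_integrable[OF assms]
  have "((\<lambda>R. LINT x|lborel. indicator {x. R < \<bar>x\<bar>} x * (f x)\<^sup>2) \<longlongrightarrow> (LINT x::real|lborel. 0 :: real)) at_top"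
  proof (rule tendsto_at_topI_sequentially)
    fix X :: "nat \<Rightarrow> real" assume X: "filterlim X at_top sequentially"
    show "(\<lambda>n. LINT x|lborel. indicator {x. X n < \<bar>x\<bar>} x * (f x)\<^sup>2) \<longlonglongrightarrow> (LINT x::real|lborel. 0 :: real)"
    proof (rule integral_dominated_convergence[where w="\<lambda>x. (f x)\<^sup>2"])
      show "AE x in lborel. (\<lambda>n. indicator {x. X n < \<bar>x\<bar>} x * (f x)\<^sup>2) \<longlonglongrightarrow> 0"
      proof (intro AE_I2 tendsto_eventually)
        fix x show "eventually (\<lambda>n. indicator {x. X n < \<bar>x\<bar>} x * (f x)\<^sup>2 = 0) sequentially"
          using filterlim_at_top[THEN iffD1, OF X, rule_format, of "\<bar>x\<bar>"] by eventually_elim auto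
      qed
    qed (use assms in \<open>auto simp: indicator_def\<close>)
  qed
  then show ?thesis unfolding tail_L2_def[abs_def] by simp
qed

lemma tail_L2_nonneg: "0 \<le> tail_L2 f R"
  unfolding tail_L2_def by (intro integral_nonneg_AE) auto

text \<open>A point with \<bar>x\<bar> \<le> R lies in both intervals, so the truncations differ
  only on the tail. This is the Cauchy estimate behind the existence of the transform.\<close>

lemma window_tail:
  assumes "cont_L2 f" "a \<le> -R" "R \<le> b" "c \<le> -R" "R \<le> d"
  shows "(\<integral>\<^sup>+ \<xi>. ennreal ((cmod (window a b f \<xi> - window c d f \<xi>))\<^sup>2) \<partial>lborel) \<le> ennreal (2 * pi * tail_L2 f R)"
proof -
  have c: "\<And>x. isCont f x" and i: "integrable lborel (\<lambda>x. (f x)\<^sup>2)" using assms(1) by (auto simp: cont_L2_def)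
  note [measurable] = cont_L2_measurable[OF assms(1)]
  have i2: "integrable lborel (\<lambda>x. (indicator {a..b} x - indicator {c..d} x)\<^sup>2 * (f x)\<^sup>2)"
    by (rule Bochner_Integration.integrable_bound[OF i]) (auto simp: indicator_def)
  have i3: "integrable lborel (\<lambda>x. indicator {x. R < \<bar>x\<bar>} x * (f x)\<^sup>2)"
    by (rule Bochner_Integration.integrable_bound[OF i]) (auto simp: indicator_def)
  have "(LINT x|lborel. (indicator {a..b} x - indicator {c..d} x)\<^sup>2 * (f x)\<^sup>2) \<le> tail_L2 f R"
    unfolding tail_L2_def
    by (rule integral_mono[OF i2 i3]) (use assms in \<open>auto simp: indicator_def\<close>)
  then have "2 * pi * (LINT x|lborel. (indicator {a..b} x - indicator {c..d} x)\<^sup>2 * (f x)\<^sup>2) \<le> 2 * pi * tail_L2 f R"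
    by simp
  moreover have "(\<integral>\<^sup>+ \<xi>. ennreal ((cmod (window a b f \<xi> - window c d f \<xi>))\<^sup>2) \<partial>lborel)
     = ennreal (2 * pi * (LINT x|lborel. (indicator {a..b} x - indicator {c..d} x)\<^sup>2 * (f x)\<^sup>2))"
    using window_plancherel[OF c, of a b c d]
    by (subst nn_integral_eq_integral) (auto simp: has_bochner_integral_iff)
  ultimately show ?thesis by (simp add: ennreal_leI)
qed

lemma is_fourier_transform_window:
  "is_fourier_transform f g \<longleftrightarrow> square_integrable g \<and>
     ((\<lambda>R. \<integral>\<^sup>+ \<xi>. ennreal ((cmod (g \<xi> - window (-R) R f \<xi>))\<^sup>2) \<partial>lborel) \<longlongrightarrow> 0) at_top"
proof -
  have "(LINT x:{-R..R}|lborel. of_real (f x) * cis (- (x * \<xi>))) = window (-R) R f \<xi>" for R \<xi>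
    unfolding ft_def set_lebesgue_integral_def
    by (intro Bochner_Integration.integral_cong) (auto simp: indicator_def)
  then show ?thesis unfolding is_fourier_transform_def by simp
qed

lemma cmod_sq_triangle: "(cmod (a - c))\<^sup>2 \<le> 2 * (cmod (a - b))\<^sup>2 + 2 * (cmod (b - c))\<^sup>2"
proof -
  have "cmod (a - c) \<le> cmod (a - b) + cmod (b - c)"
    using norm_triangle_ineq[of "a - b" "b - c"] by simp
  then have "(cmod (a - c))\<^sup>2 \<le> (cmod (a - b) + cmod (b - c))\<^sup>2" by (intro power_mono) auto
  also have "\<dots> \<le> 2 * (cmod (a - b))\<^sup>2 + 2 * (cmod (b - c))\<^sup>2"
    using zero_le_power2[of "cmod (a - b) - cmod (b - c)"] by (simp add: power2_eq_square algebra_simps)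
  finally show ?thesis .
qed

lemma nn_integral_sq_triangle:
  assumes [measurable]: "a \<in> borel_measurable borel" "b \<in> borel_measurable borel" "c \<in> borel_measurable borel"
  shows "(\<integral>\<^sup>+ \<xi>. ennreal ((cmod (a \<xi> - c \<xi>))\<^sup>2) \<partial>lborel)
     \<le> 2 * (\<integral>\<^sup>+ \<xi>. ennreal ((cmod (a \<xi> - b \<xi>))\<^sup>2) \<partial>lborel) + 2 * (\<integral>\<^sup>+ \<xi>. ennreal ((cmod (b \<xi> - c \<xi>))\<^sup>2) \<partial>lborel)"
proof -
  have "(\<integral>\<^sup>+ \<xi>. ennreal ((cmod (a \<xi> - c \<xi>))\<^sup>2) \<partial>lborel)
    \<le> (\<integral>\<^sup>+ \<xi>. 2 * ennreal ((cmod (a \<xi> - b \<xi>))\<^sup>2) + 2 * ennreal ((cmod (b \<xi> - c \<xi>))\<^sup>2) \<partial>lborel)"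
  proof (intro nn_integral_mono)
    fix \<xi>
    have "ennreal ((cmod (a \<xi> - c \<xi>))\<^sup>2) \<le> ennreal (2 * (cmod (a \<xi> - b \<xi>))\<^sup>2 + 2 * (cmod (b \<xi> - c \<xi>))\<^sup>2)"
      by (intro ennreal_leI cmod_sq_triangle)
    also have "\<dots> = 2 * ennreal ((cmod (a \<xi> - b \<xi>))\<^sup>2) + 2 * ennreal ((cmod (b \<xi> - c \<xi>))\<^sup>2)"
      by (simp add: ennreal_plus ennreal_mult)
    finally show "ennreal ((cmod (a \<xi> - c \<xi>))\<^sup>2) \<le> 2 * ennreal ((cmod (a \<xi> - b \<xi>))\<^sup>2) + 2 * ennreal ((cmod (b \<xi> - c \<xi>))\<^sup>2)" .
  qed
  also have "\<dots> = 2 * (\<integral>\<^sup>+ \<xi>. ennreal ((cmod (a \<xi> - b \<xi>))\<^sup>2) \<partial>lborel) + 2 * (\<integral>\<^sup>+ \<xi>. ennreal ((cmod (b \<xi> - c \<xi>))\<^sup>2) \<partial>lborel)"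
    by (subst nn_integral_add) (auto simp: nn_integral_cmult)
  finally show ?thesis .
qed

text \<open>Almost everywhere convergent subsequences are extracted below by an L1 criterion, while
  the windows are controlled in L2. The standard normal law bridges the two: it is a probability
  measure, so nonnegativity of the variance bounds L1 by L2; its density is at most 1, so its L2
  norm is below that of Lebesgue measure; and it has the same null sets.\<close>

lemma window_L1_std_normal:
  assumes "cont_L2 f"
  shows "integrable std_normal_distribution (window a b f)"
    and "(LINT x|std_normal_distribution. norm (window a b f x - window c d f x))
       \<le> sqrt (LINT x|lborel. (cmod (window a b f x - window c d f x))\<^sup>2)"
proof -
  let ?N = "std_normal_distribution"
  interpret N: real_distribution ?N by (rule real_dist_normal_dist)
  note [measurable] = cont_L2_measurable[OF assms]
  have c: "\<And>x. isCont f x" using assms by (auto simp: cont_L2_def)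
  have dens: "std_normal_density x \<le> 1" for x
  proof -
    have "1 \<le> sqrt (2 * pi)" using pi_gt3 by (simp add: real_le_rsqrt)
    then have "std_normal_density x \<le> 1 * exp (- x\<^sup>2 / 2)"
      unfolding std_normal_density_def by (intro mult_right_mono) (auto simp: divide_simps)
    also have "\<dots> \<le> 1" by simp
    finally show ?thesis .
  qed
  have sq: "integrable lborel (\<lambda>x. (cmod (window a b f x - window c d f x))\<^sup>2)" for a b c d
    using window_plancherel[OF c] by (auto simp: has_bochner_integral_iff)
  have sqN: "integrable lborel (\<lambda>x. std_normal_density x * (cmod (window a b f x - window c d f x))\<^sup>2)" for a b c d
    by (rule Bochner_Integration.integrable_bound[OF sq[of a b c d]])
       (auto intro!: AE_I2 mult_left_le_one_le simp: abs_mult normal_density_nonneg dens)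
  have sqN': "integrable ?N (\<lambda>x. (cmod (window a b f x - window c d f x))\<^sup>2)" for a b c d
    using sqN[of a b c d] by (subst integrable_density) (auto simp: normal_density_nonneg)
  have ab: "y \<le> 1 + y\<^sup>2" for y :: real
  proof -
    have "0 \<le> (y - 1)\<^sup>2 + (y\<^sup>2 + 1)" by simp
    then show ?thesis by (simp add: power2_eq_square algebra_simps)
  qed
  have ii: "integrable ?N (\<lambda>x. window a b f x - window c d f x)" for a b c d
    by (rule Bochner_Integration.integrable_bound[where f="\<lambda>x. 1 + (cmod (window a b f x - window c d f x))\<^sup>2"])
       (auto intro!: AE_I2 sqN' ab simp: abs_of_nonneg)
  have z: "ft (\<lambda>x. 0) = (\<lambda>_. 0)" unfolding ft_def by simp
  from ii[of a b 1 0] show "integrable ?N (window a b f)" by (simp add: z)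
  let ?X = "\<lambda>x. cmod (window a b f x - window c d f x)"
  have "(N.expectation ?X)\<^sup>2 \<le> N.expectation (\<lambda>x. (?X x)\<^sup>2)"
  proof -
    have "0 \<le> N.variance ?X" by (intro integral_nonneg_AE) auto
    then show ?thesis using N.variance_eq[of ?X] ii sqN' by auto
  qed
  also have "\<dots> = (LINT x|lborel. std_normal_density x * (?X x)\<^sup>2)"
    by (subst integral_density) (auto simp: normal_density_nonneg)
  also have "\<dots> \<le> (LINT x|lborel. (?X x)\<^sup>2)"
    by (intro integral_mono sq sqN mult_left_le_one_le) (auto simp: normal_density_nonneg dens)
  finally show "(LINT x|?N. norm (window a b f x - window c d f x)) \<le> sqrt (LINT x|lborel. (?X x)\<^sup>2)"
    by (intro real_le_rsqrt)
qed

text \<open>Riesz-Fischer for the windows: a subsequence converges almost everywhere, and Fatou's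
  lemma carries the Cauchy estimate over to the limit.\<close>

lemma fourier_transform_exists:
  assumes "cont_L2 f"
  shows "\<exists>g. is_fourier_transform f g"
proof -
  let ?N = "std_normal_distribution"
  interpret N: real_distribution ?N by (rule real_dist_normal_dist)
  note [measurable] = cont_L2_measurable[OF assms]
  have c: "\<And>x. isCont f x" and i: "integrable lborel (\<lambda>x. (f x)\<^sup>2)" using assms by (auto simp: cont_L2_def)
  let ?F = "\<lambda>n::nat. window (- real n) (real n) f"
  have "\<exists>r::nat\<Rightarrow>nat. strict_mono r \<and> (AE x in ?N. Cauchy (\<lambda>n. ?F (r n) x))"
  proof -
    have "\<exists>n0. \<forall>n\<ge>n0. \<forall>m\<ge>n0. (LINT x|?N. norm (?F n x - ?F m x)) < e" if "e > 0" for e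
    proof -
      have "eventually (\<lambda>R. tail_L2 f R < e\<^sup>2 / (2 * pi)) at_top"
        by (intro order_tendstoD[OF tail_L2_tendsto[OF i]]) (use that in auto)
      then obtain R where R: "\<And>r. r \<ge> R \<Longrightarrow> tail_L2 f r < e\<^sup>2 / (2 * pi)"
        by (auto simp: eventually_at_top_linorder)
      obtain n0 :: nat where n0: "R \<le> real n0" using real_arch_simple by blast
      have "(LINT x|?N. norm (?F n x - ?F m x)) < e" if "n \<ge> n0" "m \<ge> n0" for n m
      proof -
        have sq: "integrable lborel (\<lambda>x. (cmod (?F n x - ?F m x))\<^sup>2)"
          using window_plancherel[OF c] by (auto simp: has_bochner_integral_iff)
        have "ennreal (LINT x|lborel. (cmod (?F n x - ?F m x))\<^sup>2) \<le> ennreal (2 * pi * tail_L2 f (real n0))"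
          using window_tail[OF assms, of "- real n" "real n0" "real n" "- real m" "real m"] that
          by (subst nn_integral_eq_integral[symmetric]) (use sq in auto)
        then have "(LINT x|lborel. (cmod (?F n x - ?F m x))\<^sup>2) \<le> 2 * pi * tail_L2 f (real n0)"
          by (subst (asm) ennreal_le_iff) (auto intro!: mult_nonneg_nonneg tail_L2_nonneg)
        also have "\<dots> < e\<^sup>2" using R[OF n0] by (simp add: field_simps)
        finally have "sqrt (LINT x|lborel. (cmod (?F n x - ?F m x))\<^sup>2) < e"
          using \<open>e > 0\<close> by (simp add: real_less_lsqrt)
        with window_L1_std_normal(2)[OF assms, of "- real n" "real n" "- real m" "real m"] show ?thesis by linarith
      qed
      then show ?thesis by blast
    qed
    then show ?thesis
      by (rule cauchy_L1_AE_cauchy_subseq[of ?N ?F, rotated]) (auto intro: window_L1_std_normal(1)[OF assms])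
  qed
  then obtain r where r: "strict_mono r" and rC: "AE x in ?N. Cauchy (\<lambda>n. ?F (r n) x)" by auto
  have rC': "AE x in lborel. Cauchy (\<lambda>n. ?F (r n) x)"
    using rC by (subst (asm) AE_density) (auto simp: normal_density_pos)
  define g where "g x = lim (\<lambda>n. ?F (r n) x)" for x
  have [measurable]: "g \<in> borel_measurable borel"
    unfolding g_def by (rule borel_measurable_lim_metric) simp
  have g: "AE x in lborel. (\<lambda>n. ?F (r n) x) \<longlonglongrightarrow> g x"
    using rC' by eventually_elim (simp add: g_def convergent_LIMSEQ_iff[symmetric] Cauchy_convergent_iff)
  \<comment> \<open>Fatou along the subsequence \<open>r\<close>; the other window
    \<open>{-R..R}\<close> stays fixed, so the bound holds for every real \<open>R\<close> and the
    limit over all of \<open>at_top\<close> follows.\<close>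
  have bound: "(\<integral>\<^sup>+ \<xi>. ennreal ((cmod (g \<xi> - window (-R) R f \<xi>))\<^sup>2) \<partial>lborel) \<le> ennreal (2 * pi * tail_L2 f R)" for R
  proof -
    have "(\<integral>\<^sup>+ \<xi>. ennreal ((cmod (g \<xi> - window (-R) R f \<xi>))\<^sup>2) \<partial>lborel)
       = (\<integral>\<^sup>+ \<xi>. liminf (\<lambda>n. ennreal ((cmod (?F (r n) \<xi> - window (-R) R f \<xi>))\<^sup>2)) \<partial>lborel)"
    proof (rule nn_integral_cong_AE)
      show "AE \<xi> in lborel. ennreal ((cmod (g \<xi> - window (-R) R f \<xi>))\<^sup>2)
         = liminf (\<lambda>n. ennreal ((cmod (?F (r n) \<xi> - window (-R) R f \<xi>))\<^sup>2))"
        using g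
      proof eventually_elim
        case (elim \<xi>)
        have "(\<lambda>n. ennreal ((cmod (?F (r n) \<xi> - window (-R) R f \<xi>))\<^sup>2)) \<longlonglongrightarrow> ennreal ((cmod (g \<xi> - window (-R) R f \<xi>))\<^sup>2)"
          by (intro tendsto_intros elim)
        then show ?case by (intro lim_imp_Liminf[symmetric]) auto
      qed
    qed
    also have "\<dots> \<le> liminf (\<lambda>n. \<integral>\<^sup>+ \<xi>. ennreal ((cmod (?F (r n) \<xi> - window (-R) R f \<xi>))\<^sup>2) \<partial>lborel)"
      by (intro nn_integral_liminf) auto
    also have "\<dots> \<le> ennreal (2 * pi * tail_L2 f R)"
    proof (rule Liminf_le)
      obtain n0 :: nat where n0: "R \<le> real n0" using real_arch_simple by blast
      show "eventually (\<lambda>n. (\<integral>\<^sup>+ \<xi>. ennreal ((cmod (?F (r n) \<xi> - window (-R) R f \<xi>))\<^sup>2) \<partial>lborel) \<le> ennreal (2 * pi * tail_L2 f R)) sequentially"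
        using eventually_ge_at_top[of n0]
      proof eventually_elim
        case (elim n)
        have "real n \<le> real (r n)" using seq_suble[OF r, of n] by simp
        with elim n0 have "R \<le> real (r n)" by linarith
        then show ?case by (intro window_tail[OF assms]) auto
      qed
    qed simp
    finally show ?thesis .
  qed
  have lim: "((\<lambda>R. \<integral>\<^sup>+ \<xi>. ennreal ((cmod (g \<xi> - window (-R) R f \<xi>))\<^sup>2) \<partial>lborel) \<longlongrightarrow> 0) at_top"
  proof (rule tendsto_sandwich[of "\<lambda>_. 0"])
    have "((\<lambda>R. ennreal (2 * pi * tail_L2 f R)) \<longlongrightarrow> ennreal (2 * pi * 0)) at_top"
      by (intro tendsto_intros tail_L2_tendsto i)
    then show "((\<lambda>R. ennreal (2 * pi * tail_L2 f R)) \<longlongrightarrow> 0) at_top" by simp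
  qed (auto intro!: always_eventually bound)
  have "(\<integral>\<^sup>+ \<xi>. ennreal ((cmod (g \<xi> - 0))\<^sup>2) \<partial>lborel)
      \<le> 2 * (\<integral>\<^sup>+ \<xi>. ennreal ((cmod (g \<xi> - window (-1) 1 f \<xi>))\<^sup>2) \<partial>lborel)
        + 2 * (\<integral>\<^sup>+ \<xi>. ennreal ((cmod (window (-1) 1 f \<xi> - 0))\<^sup>2) \<partial>lborel)"
    by (rule nn_integral_sq_triangle) auto
  also have "\<dots> < \<infinity>"
  proof -
    have z: "window 1 0 f x = 0" for x unfolding ft_def by simp
    have "(\<integral>\<^sup>+ \<xi>. ennreal ((cmod (window (-1) 1 f \<xi> - 0))\<^sup>2) \<partial>lborel) < \<infinity>"
      using window_plancherel[OF c, of "-1" 1 1 0] unfolding z has_bochner_integral_iff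
      by (subst nn_integral_eq_integral) auto
    moreover have "(\<integral>\<^sup>+ \<xi>. ennreal ((cmod (g \<xi> - window (-1) 1 f \<xi>))\<^sup>2) \<partial>lborel) < \<infinity>"
      using bound[of 1] by (rule le_less_trans) simp
    ultimately show ?thesis by (auto simp: ennreal_mult_less_top)
  qed
  finally have "square_integrable g"
    unfolding square_integrable_def integrable_iff_bounded by simp
  with lim show ?thesis unfolding is_fourier_transform_window by blast
qed

text \<open>For each \<open>y\<close> in the unit window the fundamental theorem bounds
  \<open>\<bar>F x\<bar>\<close> by \<open>\<bar>F y\<bar>\<close> plus the variation over the
  window; average over \<open>y\<close>. Applied to squares, this gives both decay at infinity and
  the Sobolev embedding.\<close>

lemma pointwise_le_unit_window:
  fixes F F' :: "real \<Rightarrow> real"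
  assumes D: "\<And>x. (F has_real_derivative F' x) (at x)" and C: "\<And>x. isCont F' x"
  shows "\<bar>F x\<bar> \<le> (LINT y|lborel. indicator {x..x+1} y * (\<bar>F y\<bar> + \<bar>F' y\<bar>))"
proof -
  have cF: "isCont F x" for x using D DERIV_isCont by blast
  have i1: "integrable lborel (\<lambda>y. indicator {x..x+1} y * \<bar>F y\<bar>)" and i2: "integrable lborel (\<lambda>y. indicator {x..x+1} y * \<bar>F' y\<bar>)"
    using window_integrable[of "\<lambda>y. \<bar>F y\<bar>" x "x+1"] window_integrable[of "\<lambda>y. \<bar>F' y\<bar>" x "x+1"] cF C by auto
  let ?V = "LINT y|lborel. indicator {x..x+1} y * \<bar>F' y\<bar>"
  have 1: "\<bar>F x\<bar> \<le> \<bar>F y\<bar> + ?V" if y: "y \<in> {x..x+1}" for y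
  proof -
    have "(LINT z|lborel. indicator {x..y} z *\<^sub>R F' z) = F y - F x"
      by (rule integral_FTC_Icc)
         (use y D C in \<open>auto intro!: continuous_at_imp_continuous_on simp: has_real_derivative_iff_has_vector_derivative[symmetric]
            intro: has_field_derivative_at_within\<close>)
    then have "\<bar>F y - F x\<bar> \<le> (LINT z|lborel. \<bar>indicator {x..y} z *\<^sub>R F' z\<bar>)"
      by (metis integral_abs_bound)
    also have "\<dots> = (LINT z|lborel. indicator {x..y} z * \<bar>F' z\<bar>)"
      by (intro Bochner_Integration.integral_cong) (auto simp: indicator_def)
    also have "\<dots> \<le> ?V"
      using y by (intro integral_mono window_integrable i2) (auto simp: C indicator_def)
    finally show ?thesis by linarith
  qed
  have "\<bar>F x\<bar> = (LINT y|lborel. indicator {x..x+1} y * \<bar>F x\<bar>)" by simp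
  also have "\<dots> \<le> (LINT y|lborel. indicator {x..x+1} y * \<bar>F y\<bar> + indicator {x..x+1} y * ?V)"
  proof (intro integral_mono)
    show "integrable lborel (\<lambda>y. indicator {x..x+1} y * \<bar>F y\<bar> + indicator {x..x+1} y * ?V)"
      using window_integrable[of "\<lambda>_. ?V" x "x+1"] i1 by (intro Bochner_Integration.integrable_add) auto
    show "integrable lborel (\<lambda>y. indicator {x..x+1} y * \<bar>F x\<bar>)"
      by (rule window_integrable) auto
  qed (use 1 in \<open>auto simp: indicator_def\<close>)
  also have "\<dots> = (LINT y|lborel. indicator {x..x+1} y * \<bar>F y\<bar>) + (LINT y|lborel. indicator {x..x+1} y * ?V)"
    using window_integrable[of "\<lambda>_. ?V" x "x+1"] i1 by (intro Bochner_Integration.integral_add) auto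
  also have "(LINT y|lborel. indicator {x..x+1} y * ?V) = ?V" by simp
  finally show ?thesis by (simp add: distrib_left i1 i2)
qed

lemma integral_moving_window_tendsto_0:
  fixes w :: "real \<Rightarrow> real"
  assumes w: "integrable lborel w" and X: "filterlim (\<lambda>n. \<bar>X n\<bar>) at_top sequentially"
  shows "(\<lambda>n::nat. LINT y|lborel. indicator {X n..X n + 1} y * w y) \<longlonglongrightarrow> 0"
proof -
  note [measurable] = borel_measurable_integrable[OF w]
  have "(\<lambda>n. LINT y|lborel. indicator {X n..X n + 1} y * w y) \<longlonglongrightarrow> (LINT y::real|lborel. 0 :: real)"
  proof (rule integral_dominated_convergence[where w="\<lambda>y. \<bar>w y\<bar>"])
    show "AE y in lborel. (\<lambda>n. indicator {X n..X n + 1} y * w y) \<longlonglongrightarrow> 0"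
    proof (intro AE_I2 tendsto_eventually)
      fix y show "eventually (\<lambda>n. indicator {X n..X n + 1} y * w y = 0) sequentially"
        using filterlim_at_top[THEN iffD1, OF X, rule_format, of "\<bar>y\<bar> + 2"]
        by eventually_elim (auto simp: indicator_def)
    qed
  qed (use w in \<open>auto simp: indicator_def\<close>)
  then show ?thesis by simp
qed

lemma mult_integrable_sq:
  assumes "integrable lborel (\<lambda>x. (f x)\<^sup>2)" "integrable lborel (\<lambda>x. (g x)\<^sup>2)"
    and [measurable]: "f \<in> borel_measurable borel" "g \<in> borel_measurable borel"
  shows "integrable lborel (\<lambda>x. f x * g x :: real)"
proof (rule Bochner_Integration.integrable_bound)
  show "integrable lborel (\<lambda>x. (f x)\<^sup>2 + (g x)\<^sup>2)" using assms by simp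
  have "\<bar>a * b\<bar> \<le> a\<^sup>2 + b\<^sup>2" for a b :: real
  proof -
    have "0 \<le> (\<bar>a\<bar> - \<bar>b\<bar>)\<^sup>2 + (a\<^sup>2 + b\<^sup>2)" by simp
    then show ?thesis by (simp add: power2_eq_square algebra_simps abs_mult)
  qed
  then show "AE x in lborel. norm (f x * g x) \<le> norm ((f x)\<^sup>2 + (g x)\<^sup>2)" by auto
qed simp

text \<open>The square of \<open>f\<close> has the integrable derivative \<open>2 * f * f'\<close>,
  so it is dominated by the integral of one fixed integrable function over a unit window that moves
  to infinity.\<close>

lemma cont_L2_decay:
  assumes f: "cont_L2 f" and f': "cont_L2 f'" and D: "\<And>x. (f has_real_derivative f' x) (at x)"
    and X: "filterlim (\<lambda>n. \<bar>X n\<bar>) at_top sequentially"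
  shows "(\<lambda>n::nat. f (X n)) \<longlonglongrightarrow> 0"
proof -
  note [measurable] = cont_L2_measurable[OF f] cont_L2_measurable[OF f']
  have i: "integrable lborel (\<lambda>y. \<bar>(f y)\<^sup>2\<bar> + \<bar>2 * (f y * f' y)\<bar>)"
    using f f' by (intro Bochner_Integration.integrable_add integrable_abs integrable_mult_right mult_integrable_sq) (auto simp: cont_L2_def)
  have "(\<lambda>n. (f (X n))\<^sup>2) \<longlonglongrightarrow> 0"
  proof (rule tendsto_sandwich[OF _ _ tendsto_const integral_moving_window_tendsto_0[OF i X]])
    have "((\<lambda>x. (f x)\<^sup>2) has_real_derivative 2 * (f x * f' x)) (at x)" for x
      using DERIV_power[OF D, of 2 x] by (simp add: mult_ac)
    moreover have "isCont (\<lambda>x. 2 * (f x * f' x)) x" for x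
      using f f' by (auto simp: cont_L2_def)
    ultimately have "\<bar>(f x)\<^sup>2\<bar> \<le> (LINT y|lborel. indicator {x..x + 1} y * (\<bar>(f y)\<^sup>2\<bar> + \<bar>2 * (f y * f' y)\<bar>))" for x
      by (rule pointwise_le_unit_window)
    then show "eventually (\<lambda>n. (f (X n))\<^sup>2 \<le> (LINT y|lborel. indicator {X n..X n + 1} y * (\<bar>(f y)\<^sup>2\<bar> + \<bar>2 * (f y * f' y)\<bar>))) sequentially"
      by (auto intro!: always_eventually)
  qed auto
  from tendsto_real_sqrt[OF this] have "(\<lambda>n. \<bar>f (X n)\<bar>) \<longlonglongrightarrow> 0" by simp
  then show ?thesis by (rule tendsto_rabs_zero_cancel)
qed

section \<open>Plancherel's identity\<close>

lemma is_fourier_transform_sq_integrable: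
  assumes "is_fourier_transform f g"
  shows "g \<in> borel_measurable borel" "integrable lborel (\<lambda>\<xi>. (cmod (g \<xi>))\<^sup>2)"
  using assms by (auto simp: is_fourier_transform_def square_integrable_def)

text \<open>\<open>cmod_sq_triangle\<close> loses a factor 2. With a free weight \<open>d\<close>,
  sent to 0 at the end by \<open>le_of_le_factor\<close>, the leading constant tends to 1 and the
  identity comes out sharp.\<close>

lemma young_sq: "0 < d \<Longrightarrow> (cmod a)\<^sup>2 \<le> (1 + d) * (cmod b)\<^sup>2 + (1 + 1 / d) * (cmod (a - b))\<^sup>2"
proof -
  assume d: "0 < d"
  have "cmod a \<le> cmod b + cmod (a - b)" using norm_triangle_ineq[of b "a - b"] by simp
  then have "(cmod a)\<^sup>2 \<le> (cmod b + cmod (a - b))\<^sup>2" by (intro power_mono) auto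
  also have "\<dots> = (cmod b)\<^sup>2 + (cmod (a - b))\<^sup>2 + 2 * (cmod b * cmod (a - b))"
    by (simp add: power2_eq_square algebra_simps)
  also have "2 * (cmod b * cmod (a - b)) \<le> d * (cmod b)\<^sup>2 + 1 / d * (cmod (a - b))\<^sup>2"
  proof -
    have "0 \<le> (sqrt d * cmod b - cmod (a - b) / sqrt d)\<^sup>2" by simp
    also have "\<dots> = d * (cmod b)\<^sup>2 + 1 / d * (cmod (a - b))\<^sup>2 - 2 * (cmod b * cmod (a - b))"
      using d by (simp add: power2_diff power_mult_distrib power_divide)
    finally show ?thesis by simp
  qed
  finally show ?thesis by (simp add: algebra_simps)
qed

lemma le_of_le_factor:
  fixes x y :: real
  assumes "\<And>d. 0 < d \<Longrightarrow> x \<le> (1 + d) * y" "0 \<le> y"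
  shows "x \<le> y"
proof (rule field_le_epsilon)
  fix e :: real assume "0 < e"
  then have "x \<le> (1 + e / (y + 1)) * y" using assms by (intro assms(1)) auto
  also have "\<dots> = y + e * (y / (y + 1))" by (simp add: algebra_simps)
  also have "\<dots> \<le> y + e * 1"
    using \<open>0 < e\<close> \<open>0 \<le> y\<close> by (intro add_left_mono mult_left_mono) auto
  finally show "x \<le> y + e" by simp
qed

lemma fourier_window_converges:
  assumes f: "cont_L2 f" and g: "is_fourier_transform f g"
  shows "integrable lborel (\<lambda>\<xi>. (cmod (g \<xi> - window (-R) R f \<xi>))\<^sup>2)"
    and "((\<lambda>R. LINT \<xi>|lborel. (cmod (g \<xi> - window (-R) R f \<xi>))\<^sup>2) \<longlongrightarrow> 0) at_top"
proof -
  note [measurable] = cont_L2_measurable[OF f] is_fourier_transform_sq_integrable(1)[OF g]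
  have z: "ft (\<lambda>x. 0) = (\<lambda>_. 0)" unfolding ft_def by simp
  have c: "\<And>x. isCont f x" using f by (auto simp: cont_L2_def)
  have iw: "integrable lborel (\<lambda>\<xi>. (cmod (window (-R) R f \<xi>))\<^sup>2)" for R
    using window_plancherel[OF c, of "-R" R 1 0] by (simp add: z has_bochner_integral_iff)
  show i: "integrable lborel (\<lambda>\<xi>. (cmod (g \<xi> - window (-R) R f \<xi>))\<^sup>2)" for R
  proof (rule Bochner_Integration.integrable_bound[where f="\<lambda>\<xi>. 2 * (cmod (g \<xi>))\<^sup>2 + 2 * (cmod (window (-R) R f \<xi>))\<^sup>2"])
    show "AE \<xi> in lborel. norm ((cmod (g \<xi> - window (-R) R f \<xi>))\<^sup>2) \<le> norm (2 * (cmod (g \<xi>))\<^sup>2 + 2 * (cmod (window (-R) R f \<xi>))\<^sup>2)"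
      using cmod_sq_triangle[where b=0] by (intro AE_I2) auto
  qed (use is_fourier_transform_sq_integrable(2)[OF g] iw in auto)
  have "((\<lambda>R. ennreal (LINT \<xi>|lborel. (cmod (g \<xi> - window (-R) R f \<xi>))\<^sup>2)) \<longlongrightarrow> ennreal 0) at_top"
    using g by (simp add: is_fourier_transform_window nn_integral_eq_integral[OF i])
  then show "((\<lambda>R. LINT \<xi>|lborel. (cmod (g \<xi> - window (-R) R f \<xi>))\<^sup>2) \<longlongrightarrow> 0) at_top"
    by (subst (asm) tendsto_ennreal_iff) auto
qed

lemma window_norm:
  assumes f: "cont_L2 f"
  shows "integrable lborel (\<lambda>\<xi>. (cmod (window (-R) R f \<xi>))\<^sup>2)"
    "(LINT \<xi>|lborel. (cmod (window (-R) R f \<xi>))\<^sup>2) = 2 * pi * ((LINT x|lborel. (f x)\<^sup>2) - tail_L2 f R)"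
proof -
  note [measurable] = cont_L2_measurable[OF f]
  have z: "ft (\<lambda>x. 0) = (\<lambda>_. 0)" unfolding ft_def by simp
  have c: "\<And>x. isCont f x" and i: "integrable lborel (\<lambda>x. (f x)\<^sup>2)" using f by (auto simp: cont_L2_def)
  have hb: "has_bochner_integral lborel (\<lambda>\<xi>. (cmod (window (-R) R f \<xi>))\<^sup>2) (2 * pi * (LINT x|lborel. (indicator {-R..R} x)\<^sup>2 * (f x)\<^sup>2))"
    using window_plancherel[OF c, of "-R" R 1 0] by (simp add: z)
  have "integrable lborel (\<lambda>x. indicator {x. R < \<bar>x\<bar>} x * (f x)\<^sup>2)"
    by (rule Bochner_Integration.integrable_bound[OF i]) (auto simp: indicator_def)
  then have "(LINT x|lborel. (f x)\<^sup>2) - tail_L2 f R = (LINT x|lborel. (f x)\<^sup>2 - indicator {x. R < \<bar>x\<bar>} x * (f x)\<^sup>2)"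
    unfolding tail_L2_def using i by simp
  also have "\<dots> = (LINT x|lborel. (indicator {-R..R} x)\<^sup>2 * (f x)\<^sup>2)"
    by (intro Bochner_Integration.integral_cong) (auto simp: indicator_def)
  finally show "integrable lborel (\<lambda>\<xi>. (cmod (window (-R) R f \<xi>))\<^sup>2)"
    "(LINT \<xi>|lborel. (cmod (window (-R) R f \<xi>))\<^sup>2) = 2 * pi * ((LINT x|lborel. (f x)\<^sup>2) - tail_L2 f R)"
    using hb by (auto simp: has_bochner_integral_iff)
qed

theorem plancherel:
  assumes f: "cont_L2 f" and g: "is_fourier_transform f g"
  shows "(LINT \<xi>|lborel. (cmod (g \<xi>))\<^sup>2) = 2 * pi * (LINT x|lborel. (f x)\<^sup>2)"
proof -
  let ?G = "LINT \<xi>|lborel. (cmod (g \<xi>))\<^sup>2" and ?I = "LINT x|lborel. (f x)\<^sup>2"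
  let ?D = "\<lambda>R. LINT \<xi>|lborel. (cmod (g \<xi> - window (-R) R f \<xi>))\<^sup>2"
  let ?W = "\<lambda>R. LINT \<xi>|lborel. (cmod (window (-R) R f \<xi>))\<^sup>2"
  note ig = is_fourier_transform_sq_integrable(2)[OF g] and iD = fourier_window_converges(1)[OF f g]
    and iW = window_norm(1)[OF f] and D0 = fourier_window_converges(2)[OF f g]
  have W: "(?W \<longlongrightarrow> 2 * pi * (?I - 0)) at_top"
    unfolding window_norm(2)[OF f] by (intro tendsto_intros tail_L2_tendsto) (use f in \<open>auto simp: cont_L2_def\<close>)
  have iD': "integrable lborel (\<lambda>\<xi>. (cmod (window (-R) R f \<xi> - g \<xi>))\<^sup>2)"
    and D': "(LINT \<xi>|lborel. (cmod (window (-R) R f \<xi> - g \<xi>))\<^sup>2) = ?D R" for R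
    using iD[of R] by (simp_all add: norm_minus_commute)
  have "?G \<le> 2 * pi * ?I"
  proof (rule le_of_le_factor)
    fix d :: real assume d: "0 < d"
    have "?G \<le> (1 + d) * ?W R + (1 + 1 / d) * ?D R" for R
    proof -
      have "?G \<le> (LINT \<xi>|lborel. (1 + d) * (cmod (window (-R) R f \<xi>))\<^sup>2 + (1 + 1 / d) * (cmod (g \<xi> - window (-R) R f \<xi>))\<^sup>2)"
        using d by (intro integral_mono young_sq Bochner_Integration.integrable_add integrable_mult_right ig iD iW)
      then show ?thesis using iD iW by simp
    qed
    moreover have "((\<lambda>R. (1 + d) * ?W R + (1 + 1 / d) * ?D R) \<longlongrightarrow> (1 + d) * (2 * pi * (?I - 0)) + (1 + 1 / d) * 0) at_top"
      by (intro tendsto_intros W D0)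
    ultimately have "?G \<le> (1 + d) * (2 * pi * (?I - 0)) + (1 + 1 / d) * 0"
      by (intro tendsto_lowerbound) (auto intro!: always_eventually)
    then show "?G \<le> (1 + d) * (2 * pi * ?I)" by simp
  qed auto
  moreover have "2 * pi * ?I \<le> ?G"
  proof (rule le_of_le_factor)
    fix d :: real assume d: "0 < d"
    have "?W R \<le> (1 + d) * ?G + (1 + 1 / d) * ?D R" for R
    proof -
      have "?W R \<le> (LINT \<xi>|lborel. (1 + d) * (cmod (g \<xi>))\<^sup>2 + (1 + 1 / d) * (cmod (window (-R) R f \<xi> - g \<xi>))\<^sup>2)"
        using d by (intro integral_mono young_sq Bochner_Integration.integrable_add integrable_mult_right ig iD' iW)
      then show ?thesis using iD'[of R] ig D'[of R] by simp
    qed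
    moreover have "((\<lambda>R. (1 + d) * ?G + (1 + 1 / d) * ?D R) \<longlongrightarrow> (1 + d) * ?G + (1 + 1 / d) * 0) at_top"
      by (intro tendsto_intros D0)
    ultimately have "2 * pi * (?I - 0) \<le> (1 + d) * ?G + (1 + 1 / d) * 0"
      by (intro tendsto_le[OF _ _ W]) (auto intro!: always_eventually)
    then show "2 * pi * ?I \<le> (1 + d) * ?G" by simp
  qed auto
  ultimately show ?thesis by simp
qed

text \<open>Mean-square convergence yields pointwise convergence on a subsequence only. The radii
  \<open>X\<close> are arbitrary so that the extraction can be repeated: a function and its
  derivative need a common subsequence.\<close>

lemma fourier_window_AE:
  assumes f: "cont_L2 f" and g: "is_fourier_transform f g" and X: "filterlim X at_top sequentially"
  shows "\<exists>r::nat\<Rightarrow>nat. strict_mono r \<and> (AE \<xi> in lborel. (\<lambda>n. window (- X (r n)) (X (r n)) f \<xi>) \<longlonglongrightarrow> g \<xi>)"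
proof -
  have "(\<lambda>n. LINT \<xi>|lborel. norm ((cmod (g \<xi> - window (- X n) (X n) f \<xi>))\<^sup>2)) \<longlonglongrightarrow> 0"
    using filterlim_compose[OF fourier_window_converges(2)[OF f g] X] by simp
  from tendsto_L1_AE_subseq[OF fourier_window_converges(1)[OF f g] this]
  obtain r where r: "strict_mono r" "AE \<xi> in lborel. (\<lambda>n. (cmod (g \<xi> - window (- X (r n)) (X (r n)) f \<xi>))\<^sup>2) \<longlonglongrightarrow> 0"
    by auto
  from r(2) have "AE \<xi> in lborel. (\<lambda>n. window (- X (r n)) (X (r n)) f \<xi>) \<longlonglongrightarrow> g \<xi>"
  proof eventually_elim
    case (elim \<xi>)
    from tendsto_real_sqrt[OF elim] have "(\<lambda>n. cmod (window (- X (r n)) (X (r n)) f \<xi> - g \<xi>)) \<longlonglongrightarrow> 0"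
      by (simp add: norm_minus_commute)
    then show ?case by (rule Lim_null[THEN iffD2, OF tendsto_norm_zero_cancel])
  qed
  with r(1) show ?thesis by blast
qed

section \<open>Fourier transforms of derivatives and of difference quotients\<close>

lemma cis_has_vector_derivative: "((\<lambda>x. cis (c * x)) has_vector_derivative \<i> * of_real c * cis (c * x)) (at x within S)"
proof -
  have 1: "cis (c * x) = exp (x *\<^sub>R (\<i> * of_real c))" for x
    by (simp add: cis_conv_exp scaleR_conv_of_real mult_ac)
  show ?thesis unfolding 1
    using exp_scaleR_has_vector_derivative_right[of "\<i> * of_real c" x S] by (simp add: mult_ac)
qed

lemma window_deriv:
  assumes D: "\<And>x. (f has_real_derivative f' x) (at x)" and C: "\<And>x. isCont f' x" and R: "0 \<le> R"
  shows "window (-R) R f' \<xi> = of_real (f R) * cis (- (R * \<xi>)) - of_real (f (-R)) * cis (R * \<xi>) + \<i> * of_real \<xi> * window (-R) R f \<xi>"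
proof -
  have cf: "isCont f x" for x using D DERIV_isCont by blast
  let ?F = "\<lambda>x. of_real (f x) * cis (- \<xi> * x)"
  let ?F' = "\<lambda>x. of_real (f' x) * cis (- \<xi> * x) - \<i> * of_real \<xi> * (of_real (f x) * cis (- \<xi> * x))"
  have "(LINT x|lborel. indicator {-R..R} x *\<^sub>R ?F' x) = ?F R - ?F (-R)"
  proof (rule integral_FTC_Icc)
    show "- R \<le> R" using R by simp
    show "(?F has_vector_derivative ?F' x) (at x within {-R..R})" for x
    proof -
      have 1: "((\<lambda>x. complex_of_real (f x)) has_vector_derivative of_real (f' x)) (at x within {-R..R})"
        using D[of x] by (intro has_vector_derivative_of_real)
          (auto simp: has_real_derivative_iff_has_vector_derivative[symmetric] intro: has_field_derivative_at_within)
      show ?thesis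
        using has_vector_derivative_mult[OF 1 cis_has_vector_derivative[of "-\<xi>" x "{-R..R}"]] by (simp add: algebra_simps)
    qed
    show "continuous_on {-R..R} ?F'"
      using C cf by (intro continuous_intros) (auto intro!: continuous_at_imp_continuous_on)
  qed
  moreover have i: "integrable lborel (\<lambda>x. of_real (indicator {-R..R} x * f x) * cis (- (x * \<xi>)))"
    if "\<And>x. isCont f x" for f
  proof (rule Bochner_Integration.integrable_bound[OF window_integrable[OF that, of "-R" R]])
    have [measurable]: "f \<in> borel_measurable borel"
      using that by (intro borel_measurable_continuous_onI) (simp add: continuous_at_imp_continuous_on)
    show "(\<lambda>x. of_real (indicator {-R..R} x * f x) * cis (- (x * \<xi>))) \<in> borel_measurable lborel" by measurable
  qed (auto simp: norm_mult)
  have "(LINT x|lborel. indicator {-R..R} x *\<^sub>R ?F' x)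
     = (LINT x|lborel. of_real (indicator {-R..R} x * f' x) * cis (- (x * \<xi>)) - \<i> * of_real \<xi> * (of_real (indicator {-R..R} x * f x) * cis (- (x * \<xi>))))"
    by (intro Bochner_Integration.integral_cong) (auto simp: indicator_def mult_ac)
  also have "\<dots> = window (-R) R f' \<xi> - \<i> * of_real \<xi> * window (-R) R f \<xi>"
    unfolding ft_def using i[OF C] i[OF cf] by simp
  ultimately show ?thesis by (simp add: mult_ac)
qed

text \<open>Pass to the limit in \<open>window_deriv\<close> along radii for which both transforms
  converge almost everywhere; the boundary terms vanish by \<open>cont_L2_decay\<close>.\<close>

theorem fourier_transform_deriv:
  assumes f: "cont_L2 f" and f': "cont_L2 f'" and D: "\<And>x. (f has_real_derivative f' x) (at x)"
    and g: "is_fourier_transform f g" and g': "is_fourier_transform f' g'"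
  shows "AE \<xi> in lborel. g' \<xi> = \<i> * of_real \<xi> * g \<xi>"
proof -
  obtain r where r: "strict_mono r" "AE \<xi> in lborel. (\<lambda>n. window (- real (r n)) (real (r n)) f \<xi>) \<longlonglongrightarrow> g \<xi>"
    using fourier_window_AE[OF f g filterlim_real_sequentially] by auto
  have Xr: "filterlim (\<lambda>n. real (r n)) at_top sequentially"
    using filterlim_compose[OF filterlim_real_sequentially filterlim_subseq[OF r(1)]] .
  obtain q where q: "strict_mono q" "AE \<xi> in lborel. (\<lambda>n. window (- real (r (q n))) (real (r (q n))) f' \<xi>) \<longlonglongrightarrow> g' \<xi>"
    using fourier_window_AE[OF f' g' Xr] by auto
  define X where "X n = real (r (q n))" for n
  have X: "filterlim X at_top sequentially"
    unfolding X_def using filterlim_compose[OF Xr filterlim_subseq[OF q(1)]] .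
  have aX: "filterlim (\<lambda>n. \<bar>X n\<bar>) at_top sequentially" "filterlim (\<lambda>n. \<bar>- X n\<bar>) at_top sequentially"
  proof -
    have "\<bar>X n\<bar> = X n" for n by (simp add: X_def)
    with X show "filterlim (\<lambda>n. \<bar>X n\<bar>) at_top sequentially" "filterlim (\<lambda>n. \<bar>- X n\<bar>) at_top sequentially"
      by simp_all
  qed
  have fX: "(\<lambda>n. f (X n)) \<longlonglongrightarrow> 0" "(\<lambda>n. f (- X n)) \<longlonglongrightarrow> 0"
    using cont_L2_decay[OF f f' D] aX by auto
  from r(2) q(2) show ?thesis
  proof eventually_elim
    case (elim \<xi>)
    have 0: "(\<lambda>n. of_real (f (X n)) * cis (- (X n * \<xi>))) \<longlonglongrightarrow> 0" "(\<lambda>n. of_real (f (- X n)) * cis (X n * \<xi>)) \<longlonglongrightarrow> 0"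
      by (rule tendsto_norm_zero_cancel, use tendsto_rabs_zero[OF fX(1)] tendsto_rabs_zero[OF fX(2)] in \<open>simp add: norm_mult\<close>)+
    have "(\<lambda>n. window (- X n) (X n) f \<xi>) \<longlonglongrightarrow> g \<xi>"
      using LIMSEQ_subseq_LIMSEQ[OF elim(1) q(1)] by (simp add: X_def o_def)
    then have "(\<lambda>n. of_real (f (X n)) * cis (- (X n * \<xi>)) - of_real (f (- X n)) * cis (X n * \<xi>) + \<i> * of_real \<xi> * window (- X n) (X n) f \<xi>)
       \<longlonglongrightarrow> 0 - 0 + \<i> * of_real \<xi> * g \<xi>"
      by (intro tendsto_intros 0)
    moreover have "window (- X n) (X n) f' \<xi> = of_real (f (X n)) * cis (- (X n * \<xi>)) - of_real (f (- X n)) * cis (X n * \<xi>) + \<i> * of_real \<xi> * window (- X n) (X n) f \<xi>" for n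
      by (rule window_deriv[OF D]) (use f' in \<open>auto simp: cont_L2_def X_def\<close>)
    ultimately show ?case using elim(2) by (simp add: X_def LIMSEQ_unique)
  qed
qed

lemma window_translate: "window (-R) R (\<lambda>x. f (x + h)) \<xi> = cis (h * \<xi>) * window (-R + h) (R + h) f \<xi>"
proof -
  have 1: "window (-R + h) (R + h) f \<xi> = (LINT x|lborel. of_real (indicator {-R + h..R + h} (h + 1 * x) * f (h + 1 * x)) * cis (- ((h + 1 * x) * \<xi>)))"
    unfolding ft_def by (subst lborel_integral_real_affine[where c=1 and t=h]) auto
  have 2: "window (-R) R (\<lambda>x. f (x + h)) \<xi> = (LINT x|lborel. cis (h * \<xi>) *
      (of_real (indicator {-R + h..R + h} (h + 1 * x) * f (h + 1 * x)) * cis (- ((h + 1 * x) * \<xi>))))"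
    unfolding ft_def
  proof (intro Bochner_Integration.integral_cong refl)
    fix x :: real
    have "cis (h * \<xi>) * cis (- ((h + 1 * x) * \<xi>)) = cis (- (x * \<xi>))"
      by (simp only: cis_mult) (simp add: algebra_simps)
    then show "of_real (indicator {-R..R} x * f (x + h)) * cis (- (x * \<xi>))
      = cis (h * \<xi>) * (of_real (indicator {-R + h..R + h} (h + 1 * x) * f (h + 1 * x)) * cis (- ((h + 1 * x) * \<xi>)))"
      by (auto simp: indicator_def add.commute mult.left_commute)
  qed
  show ?thesis unfolding 2 1 by (rule integral_mult_right_zero)
qed

text \<open>Translation multiplies the transform by \<open>cis (h * \<xi>)\<close> but also moves
  the window to \<open>{-R + h..R + h}\<close>. Both windows contain all points with modulus at most
  \<open>R - \<bar>h\<bar>\<close>, so the mismatch is a tail of \<open>f\<close> and disappears in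
  the limit.\<close>

lemma fourier_transform_difference_quotient:
  assumes f: "cont_L2 f" and g: "is_fourier_transform f g" and h: "h \<noteq> 0"
  shows "cont_L2 (\<lambda>x. (f (x + h) - f x) / h)"
    and "is_fourier_transform (\<lambda>x. (f (x + h) - f x) / h) (\<lambda>\<xi>. (cis (h * \<xi>) - 1) / of_real h * g \<xi>)"
proof -
  let ?q = "\<lambda>x. (f (x + h) - f x) / h" and ?G = "\<lambda>\<xi>. (cis (h * \<xi>) - 1) / of_real h * g \<xi>"
  note [measurable] = cont_L2_measurable[OF f] is_fourier_transform_sq_integrable(1)[OF g]
  note ig = is_fourier_transform_sq_integrable(2)[OF g]
  have c: "\<And>x. isCont f x" and i: "integrable lborel (\<lambda>x. (f x)\<^sup>2)" using f by (auto simp: cont_L2_def)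
  have ch: "isCont (\<lambda>x. f (x + h)) x" for x by (rule isCont_o2[OF _ c]) simp
  have ih: "integrable lborel (\<lambda>x. (f (x + h))\<^sup>2)"
    using lborel_integrable_real_affine[OF i, of 1 h] by (simp add: add.commute)
  show cq: "cont_L2 ?q" unfolding cont_L2_def
  proof
    show "\<forall>x. isCont ?q x" using c ch h by (auto intro!: continuous_intros)
    have "integrable lborel (\<lambda>x. ((f (x + h))\<^sup>2 + (f x)\<^sup>2 - 2 * (f (x + h) * f x)) / h\<^sup>2)"
      by (intro integrable_divide Bochner_Integration.integrable_diff Bochner_Integration.integrable_add integrable_mult_right mult_integrable_sq i ih) auto
    then show "integrable lborel (\<lambda>x. (?q x)\<^sup>2)"
      by (simp add: power_divide power2_diff mult.assoc)
  qed
  have wq: "window (-R) R ?q \<xi> = (cis (h * \<xi>) * window (-R + h) (R + h) f \<xi> - window (-R) R f \<xi>) / of_real h" for R \<xi>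
  proof -
    have i1: "integrable lborel (\<lambda>x. of_real (indicator {-R..R} x * f x) * cis (- (x * \<xi>)))" if "\<And>x. isCont f x" for f
    proof (rule Bochner_Integration.integrable_bound[OF window_integrable[OF that, of "-R" R]])
      have [measurable]: "f \<in> borel_measurable borel"
        using that by (intro borel_measurable_continuous_onI) (simp add: continuous_at_imp_continuous_on)
      show "(\<lambda>x. of_real (indicator {-R..R} x * f x) * cis (- (x * \<xi>))) \<in> borel_measurable lborel" by measurable
    qed (auto simp: norm_mult)
    have "window (-R) R ?q \<xi> = (window (-R) R (\<lambda>x. f (x + h)) \<xi> - window (-R) R f \<xi>) / of_real h"
      unfolding ft_def Bochner_Integration.integral_diff[OF i1[OF ch] i1[OF c], symmetric] integral_divide_zero[symmetric]
      by (intro Bochner_Integration.integral_cong) (auto simp: field_simps)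
    then show ?thesis by (simp add: window_translate)
  qed
  have norm_le: "cmod (cis (h * \<xi>) - 1) \<le> 2" for \<xi>
    using norm_triangle_ineq4[of "cis (h * \<xi>)" 1] by simp
  have "square_integrable ?G"
    unfolding square_integrable_def
  proof
    show "integrable lborel (\<lambda>\<xi>. (norm (?G \<xi>))\<^sup>2)"
    proof (rule Bochner_Integration.integrable_bound[where f="\<lambda>\<xi>. (2 / h)\<^sup>2 * (cmod (g \<xi>))\<^sup>2"])
      have "(norm (?G \<xi>))\<^sup>2 \<le> (2 / h)\<^sup>2 * (cmod (g \<xi>))\<^sup>2" for \<xi>
        using power_mono[OF norm_le[of \<xi>], of 2]
        by (auto simp: norm_mult norm_divide power_mult_distrib power_divide intro!: mult_right_mono divide_right_mono)
      then show "AE \<xi> in lborel. norm ((norm (?G \<xi>))\<^sup>2) \<le> norm ((2 / h)\<^sup>2 * (cmod (g \<xi>))\<^sup>2)" by auto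
    qed (use ig in auto)
  qed measurable
  moreover have "((\<lambda>R. \<integral>\<^sup>+ \<xi>. ennreal ((cmod (?G \<xi> - window (-R) R ?q \<xi>))\<^sup>2) \<partial>lborel) \<longlongrightarrow> 0) at_top"
  proof (rule tendsto_sandwich[of "\<lambda>_. 0"])
    let ?e = "\<lambda>R. \<integral>\<^sup>+ \<xi>. ennreal ((cmod (g \<xi> - window (-R) R f \<xi>))\<^sup>2) \<partial>lborel"
    let ?t = "\<lambda>R. ennreal (2 * pi * tail_L2 f (R - \<bar>h\<bar>))"
    let ?c = "ennreal (2 / h\<^sup>2)"
    show "eventually (\<lambda>R. (\<integral>\<^sup>+ \<xi>. ennreal ((cmod (?G \<xi> - window (-R) R ?q \<xi>))\<^sup>2) \<partial>lborel) \<le> ?c * ((2 * ?e R + 2 * ?t R) + ?e R)) at_top"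
    proof (intro always_eventually allI)
      fix R
      let ?W = "\<lambda>\<xi>. window (-R + h) (R + h) f \<xi>"
      have pt: "(cmod (?G \<xi> - window (-R) R ?q \<xi>))\<^sup>2 \<le> 2 / h\<^sup>2 * ((cmod (g \<xi> - ?W \<xi>))\<^sup>2 + (cmod (g \<xi> - window (-R) R f \<xi>))\<^sup>2)" for \<xi>
      proof -
        have "?G \<xi> - window (-R) R ?q \<xi> = (cis (h * \<xi>) * (g \<xi> - ?W \<xi>) - (g \<xi> - window (-R) R f \<xi>)) / of_real h"
        proof -
          have "(c - 1) / k * g' - (c * W - F) / k = (c * (g' - W) - (g' - F)) / k" for c k g' W F :: complex
            by (simp add: diff_divide_distrib add_divide_distrib algebra_simps)
          then show ?thesis unfolding wq .
        qed
        then have "(cmod (?G \<xi> - window (-R) R ?q \<xi>))\<^sup>2 = (cmod (cis (h * \<xi>) * (g \<xi> - ?W \<xi>) - (g \<xi> - window (-R) R f \<xi>)))\<^sup>2 / h\<^sup>2"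
          by (simp add: norm_divide power_divide)
        also have "\<dots> \<le> (2 * (cmod (cis (h * \<xi>) * (g \<xi> - ?W \<xi>) - 0))\<^sup>2 + 2 * (cmod (0 - (g \<xi> - window (-R) R f \<xi>)))\<^sup>2) / h\<^sup>2"
          by (intro divide_right_mono cmod_sq_triangle) simp
        finally show ?thesis by (simp add: norm_mult norm_minus_commute add_divide_distrib distrib_left)
      qed
      have "(\<integral>\<^sup>+ \<xi>. ennreal ((cmod (?G \<xi> - window (-R) R ?q \<xi>))\<^sup>2) \<partial>lborel)
         \<le> (\<integral>\<^sup>+ \<xi>. ?c * (ennreal ((cmod (g \<xi> - ?W \<xi>))\<^sup>2) + ennreal ((cmod (g \<xi> - window (-R) R f \<xi>))\<^sup>2)) \<partial>lborel)"
      proof (rule nn_integral_mono)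
        fix \<xi>
        show "ennreal ((cmod (?G \<xi> - window (-R) R ?q \<xi>))\<^sup>2) \<le> ?c * (ennreal ((cmod (g \<xi> - ?W \<xi>))\<^sup>2) + ennreal ((cmod (g \<xi> - window (-R) R f \<xi>))\<^sup>2))"
          using ennreal_leI[OF pt[of \<xi>]] by (subst (asm) ennreal_mult) (auto simp: ennreal_plus)
      qed
      also have "\<dots> = ?c * ((\<integral>\<^sup>+ \<xi>. ennreal ((cmod (g \<xi> - ?W \<xi>))\<^sup>2) \<partial>lborel) + ?e R)"
        by (simp add: nn_integral_cmult nn_integral_add)
      also have "(\<integral>\<^sup>+ \<xi>. ennreal ((cmod (g \<xi> - ?W \<xi>))\<^sup>2) \<partial>lborel) \<le> 2 * ?e R + 2 * (\<integral>\<^sup>+ \<xi>. ennreal ((cmod (window (-R) R f \<xi> - ?W \<xi>))\<^sup>2) \<partial>lborel)"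
        by (rule nn_integral_sq_triangle) auto
      also have "(\<integral>\<^sup>+ \<xi>. ennreal ((cmod (window (-R) R f \<xi> - ?W \<xi>))\<^sup>2) \<partial>lborel) \<le> ?t R"
        by (rule window_tail[OF f]) auto
      finally show "(\<integral>\<^sup>+ \<xi>. ennreal ((cmod (?G \<xi> - window (-R) R ?q \<xi>))\<^sup>2) \<partial>lborel) \<le> ?c * ((2 * ?e R + 2 * ?t R) + ?e R)"
        by (auto simp: add_mono mult_left_mono)
    qed
    have e0: "(?e \<longlongrightarrow> 0) at_top" using g by (simp add: is_fourier_transform_window)
    have s: "filterlim (\<lambda>R. R - \<bar>h\<bar>) at_top at_top"
      using filterlim_tendsto_add_at_top[OF tendsto_const[of "-\<bar>h\<bar>"] filterlim_ident] by (simp add: add.commute)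
    have t0: "(?t \<longlongrightarrow> 0) at_top"
      using tendsto_ennrealI[OF tendsto_mult_left[OF filterlim_compose[OF tail_L2_tendsto[OF i] s], of "2 * pi"]] by simp
    have "((\<lambda>R. ?c * ((2 * ?e R + 2 * ?t R) + ?e R)) \<longlongrightarrow> ?c * ((2 * 0 + 2 * 0) + 0)) at_top"
      by (intro tendsto_add ennreal_tendsto_cmult e0 t0) auto
    then show "((\<lambda>R. ?c * ((2 * ?e R + 2 * ?t R) + ?e R)) \<longlongrightarrow> 0) at_top" by simp
  qed auto
  ultimately show "is_fourier_transform ?q ?G" by (simp add: is_fourier_transform_window)
qed

lemma norm_cis_quotient: "0 < h \<Longrightarrow> cmod ((cis (h * \<xi>) - 1) / of_real h) \<le> \<bar>\<xi>\<bar>"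
  using iexp_approx1[of "h * \<xi>" 0] by (simp add: cis_conv_exp norm_divide abs_mult field_simps)

theorem deriv_L2_of_fourier:
  assumes f: "cont_L2 f" and g: "is_fourier_transform f g" and D: "\<And>x. (f has_real_derivative f' x) (at x)"
    and C: "\<And>x. isCont f' x" and I: "integrable lborel (\<lambda>\<xi>. \<xi>\<^sup>2 * (cmod (g \<xi>))\<^sup>2)"
  shows "cont_L2 f'"
proof -
  note [measurable] = cont_L2_measurable[OF f] is_fourier_transform_sq_integrable(1)[OF g]
  have [measurable]: "f' \<in> borel_measurable borel"
    using C by (intro borel_measurable_continuous_onI) (simp add: continuous_at_imp_continuous_on)
  let ?J = "LINT \<xi>|lborel. \<xi>\<^sup>2 * (cmod (g \<xi>))\<^sup>2"
  let ?h = "\<lambda>n. inverse (real (Suc n))"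
  let ?q = "\<lambda>n x. (f (x + ?h n) - f x) / ?h n"
  have q: "(\<integral>\<^sup>+ x. ennreal ((?q n x)\<^sup>2) \<partial>lborel) \<le> ennreal (?J / (2 * pi))" for n
  proof -
    have h: "?h n \<noteq> 0" "0 < ?h n" by auto
    let ?G = "\<lambda>\<xi>. (cis (?h n * \<xi>) - 1) / of_real (?h n) * g \<xi>"
    note dq = fourier_transform_difference_quotient[OF f g h(1)]
    have "2 * pi * (LINT x|lborel. (?q n x)\<^sup>2) = (LINT \<xi>|lborel. (cmod (?G \<xi>))\<^sup>2)"
      using plancherel[OF dq] by simp
    also have "\<dots> \<le> ?J"
    proof (rule integral_mono[OF is_fourier_transform_sq_integrable(2)[OF dq(2)] I])
      fix \<xi>
      from power_mono[OF norm_cis_quotient[OF h(2), of \<xi>], of 2]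
      show "(cmod (?G \<xi>))\<^sup>2 \<le> \<xi>\<^sup>2 * (cmod (g \<xi>))\<^sup>2"
        unfolding norm_mult power_mult_distrib by (intro mult_right_mono) auto
    qed
    finally have "(LINT x|lborel. (?q n x)\<^sup>2) \<le> ?J / (2 * pi)" by (simp add: field_simps)
    then show ?thesis
      using dq(1) by (subst nn_integral_eq_integral) (auto simp: cont_L2_def intro!: ennreal_leI)
  qed
  have "(\<integral>\<^sup>+ x. ennreal ((f' x)\<^sup>2) \<partial>lborel) = (\<integral>\<^sup>+ x. liminf (\<lambda>n. ennreal ((?q n x)\<^sup>2)) \<partial>lborel)"
  proof (intro nn_integral_cong)
    fix x
    have "((\<lambda>h. (f (x + h) - f x) / h) \<longlongrightarrow> f' x) (at 0)" using D[of x] by (simp add: DERIV_def)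
    moreover have "filterlim ?h (at 0) sequentially"
      by (intro filterlim_atI LIMSEQ_inverse_real_of_nat) auto
    ultimately have "(\<lambda>n. ?q n x) \<longlonglongrightarrow> f' x" by (rule filterlim_compose)
    then have "(\<lambda>n. ennreal ((?q n x)\<^sup>2)) \<longlonglongrightarrow> ennreal ((f' x)\<^sup>2)" by (intro tendsto_intros)
    then show "ennreal ((f' x)\<^sup>2) = liminf (\<lambda>n. ennreal ((?q n x)\<^sup>2))"
      by (intro lim_imp_Liminf[symmetric]) auto
  qed
  also have "\<dots> \<le> liminf (\<lambda>n. \<integral>\<^sup>+ x. ennreal ((?q n x)\<^sup>2) \<partial>lborel)"
    by (intro nn_integral_liminf) auto
  also have "\<dots> \<le> ennreal (?J / (2 * pi))"
    by (rule Liminf_le) (use q in auto)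
  also have "\<dots> < \<infinity>" by simp
  finally have "integrable lborel (\<lambda>x. (f' x)\<^sup>2)"
    unfolding integrable_iff_bounded by simp
  with C show ?thesis by (simp add: cont_L2_def)
qed

subsection \<open>\<open>H\<^sup>\<infinity>\<close> as an algebra with inner product\<close>

definition sq_smooth :: "(real \<Rightarrow> real) \<Rightarrow> bool" where
  "sq_smooth f \<longleftrightarrow> smooth f \<and> (\<forall>n. integrable lborel (\<lambda>x. ((deriv ^^ n) f x)\<^sup>2))"

lemma smooth_DERIV: "smooth f \<Longrightarrow> ((deriv ^^ n) f has_real_derivative (deriv ^^ Suc n) f x) (at x)"
  unfolding smooth_def by (simp add: DERIV_deriv_iff_field_differentiable)

lemma smooth_isCont: "smooth f \<Longrightarrow> isCont ((deriv ^^ n) f) x"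
  using smooth_DERIV DERIV_isCont by blast

text \<open>A chain of functions, each the derivative of the one before, exhibits all iterated
  derivatives at once. Membership in \<open>sq_smooth\<close> is then verified by naming the chain
  instead of by inductions over \<open>deriv\<close>.\<close>

lemma smooth_sequence:
  assumes "\<And>n x. (F n has_real_derivative F (Suc n) x) (at x)"
  shows "(deriv ^^ n) (F 0) = F n" "smooth (F 0)"
proof -
  show *: "(deriv ^^ n) (F 0) = F n" for n
  proof (induction n)
    case (Suc n)
    then show ?case using assms DERIV_imp_deriv by fastforce
  qed simp
  show "smooth (F 0)"
    unfolding smooth_def * using assms field_differentiable_def by blast
qed

lemma sq_smoothI:
  assumes "\<And>n x. (F n has_real_derivative F (Suc n) x) (at x)" "\<And>n. integrable lborel (\<lambda>x. (F n x)\<^sup>2)" "f = F 0"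
  shows "sq_smooth f"
  using smooth_sequence[of F, OF assms(1)] assms(2,3) by (simp add: sq_smooth_def)

lemma sq_smooth_cont_L2: "sq_smooth f \<Longrightarrow> cont_L2 ((deriv ^^ n) f)"
  by (auto simp: sq_smooth_def cont_L2_def intro: smooth_isCont)

lemma fourier_is_transform: "cont_L2 f \<Longrightarrow> is_fourier_transform f (fourier f)"
  unfolding fourier_def by (rule someI_ex[OF fourier_transform_exists])

text \<open>Square integrability is assumed up to order \<open>n\<close> only, because the lemma is
  used inside an induction in which the next derivative is not yet known to be in L2.\<close>

lemma fourier_transform_derivs:
  assumes "smooth f" "\<And>k. k \<le> n \<Longrightarrow> integrable lborel (\<lambda>x. ((deriv ^^ k) f x)\<^sup>2)" "is_fourier_transform f g"
  shows "\<exists>gn. is_fourier_transform ((deriv ^^ n) f) gn \<and> (AE \<xi> in lborel. gn \<xi> = (\<i> * of_real \<xi>) ^ n * g \<xi>)"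
  using assms(2)
proof (induction n)
  case 0
  then show ?case using assms(3) by auto
next
  case (Suc n)
  then obtain gn where gn: "is_fourier_transform ((deriv ^^ n) f) gn" "AE \<xi> in lborel. gn \<xi> = (\<i> * of_real \<xi>) ^ n * g \<xi>"
    by auto
  have c: "cont_L2 ((deriv ^^ k) f)" if "k \<le> Suc n" for k
    using Suc.prems that smooth_isCont[OF assms(1)] by (auto simp: cont_L2_def)
  obtain g' where g': "is_fourier_transform ((deriv ^^ Suc n) f) g'"
    using fourier_transform_exists[OF c[of "Suc n"]] by auto
  have "AE \<xi> in lborel. g' \<xi> = \<i> * of_real \<xi> * gn \<xi>"
    by (rule fourier_transform_deriv[OF c[of n] c[of "Suc n"] smooth_DERIV[OF assms(1)] gn(1) g']) auto
  with gn(2) have "AE \<xi> in lborel. g' \<xi> = (\<i> * of_real \<xi>) ^ Suc n * g \<xi>"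
    by eventually_elim (simp add: mult_ac)
  with g' show ?case by blast
qed

lemma fourier_moment:
  assumes "smooth f" "\<And>k. k \<le> n \<Longrightarrow> integrable lborel (\<lambda>x. ((deriv ^^ k) f x)\<^sup>2)" "is_fourier_transform f g"
  shows "has_bochner_integral lborel (\<lambda>\<xi>. \<xi> ^ (2 * n) * (cmod (g \<xi>))\<^sup>2) (2 * pi * (LINT x|lborel. ((deriv ^^ n) f x)\<^sup>2))"
proof -
  note [measurable] = is_fourier_transform_sq_integrable(1)[OF assms(3)]
  obtain gn where gn: "is_fourier_transform ((deriv ^^ n) f) gn" "AE \<xi> in lborel. gn \<xi> = (\<i> * of_real \<xi>) ^ n * g \<xi>"
    using fourier_transform_derivs[OF assms] by auto
  note [measurable] = is_fourier_transform_sq_integrable(1)[OF gn(1)]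
  have c: "cont_L2 ((deriv ^^ n) f)"
    using assms(2)[of n] smooth_isCont[OF assms(1)] by (auto simp: cont_L2_def)
  have "has_bochner_integral lborel (\<lambda>\<xi>. (cmod (gn \<xi>))\<^sup>2) (2 * pi * (LINT x|lborel. ((deriv ^^ n) f x)\<^sup>2))"
    using plancherel[OF c gn(1)] is_fourier_transform_sq_integrable(2)[OF gn(1)] by (simp add: has_bochner_integral_iff)
  moreover have "AE \<xi> in lborel. (cmod (gn \<xi>))\<^sup>2 = \<xi> ^ (2 * n) * (cmod (g \<xi>))\<^sup>2"
    using gn(2)
  proof eventually_elim
    case (elim \<xi>)
    then have "cmod (gn \<xi>) = \<bar>\<xi>\<bar> ^ n * cmod (g \<xi>)" by (simp add: norm_mult norm_power)
    then have "(cmod (gn \<xi>))\<^sup>2 = \<bar>\<xi>\<bar> ^ (2 * n) * (cmod (g \<xi>))\<^sup>2"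
      by (simp add: power_mult_distrib flip: power_mult) (simp add: mult.commute)
    also have "\<bar>\<xi>\<bar> ^ (2 * n) = \<xi> ^ (2 * n)" by (simp add: power_mult)
    finally show ?case .
  qed
  ultimately show ?thesis
    by (subst has_bochner_integral_cong_AE[where g="\<lambda>\<xi>. (cmod (gn \<xi>))\<^sup>2"]) auto
qed

lemma powr_weight: "(1 + \<xi>\<^sup>2) powr real n = (1 + \<xi>\<^sup>2) ^ n" for \<xi> :: real
  by (rule powr_realpow) (simp add: add_pos_nonneg)

lemma weight_lower: "\<xi> ^ (2 * n) \<le> (1 + \<xi>\<^sup>2) ^ n" for \<xi> :: real
  unfolding power_mult by (rule power_mono) auto

lemma weight_upper: 
  fixes \<xi> :: real assumes "s \<le> real n"
  shows "(1 + \<xi>\<^sup>2) powr s \<le> 2 ^ n * (1 + \<xi> ^ (2 * n))"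
proof -
  have "(1 + \<xi>\<^sup>2) powr s \<le> (1 + \<xi>\<^sup>2) powr real n" by (rule powr_mono) (use assms in auto)
  also have "\<dots> = (1 + \<xi>\<^sup>2) ^ n" by (rule powr_weight)
  also have "\<dots> \<le> (2 * max 1 (\<xi>\<^sup>2)) ^ n" by (rule power_mono) auto
  also have "\<dots> = 2 ^ n * max 1 (\<xi>\<^sup>2) ^ n" by (simp add: power_mult_distrib)
  also have "max 1 (\<xi>\<^sup>2) ^ n \<le> 1 + \<xi> ^ (2 * n)" by (auto simp: max_def power_mult)
  finally show ?thesis by simp
qed

text \<open>The weights in \<open>sobolev\<close> give all moments of the transform. If the
  derivatives up to order \<open>n\<close> are in L2, the n-th one has transform
  \<open>(\<i> * of_real \<xi>) ^ n * g \<xi>\<close>, and the moment of order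
  \<open>2 * Suc n\<close> puts the next derivative into L2 by
  \<open>deriv_L2_of_fourier\<close>.\<close>

theorem H_infty_imp_sq_smooth:
  assumes "f \<in> H_infty"
  shows "sq_smooth f"
proof -
  have sm: "smooth f" and sob: "\<And>s. s \<ge> 0 \<Longrightarrow> f \<in> sobolev s" using assms by (auto simp: H_infty_def)
  have "integrable lborel (\<lambda>x. (f x)\<^sup>2)" using sob[of 0] by (simp add: sobolev_def square_integrable_def)
  then have cf: "cont_L2 f" using smooth_isCont[OF sm, where n=0] by (simp add: cont_L2_def)
  define g where "g = fourier f"
  have g: "is_fourier_transform f g" unfolding g_def by (rule fourier_is_transform[OF cf])
  note [measurable] = is_fourier_transform_sq_integrable(1)[OF g]
  have mom: "integrable lborel (\<lambda>\<xi>. \<xi> ^ (2 * n) * (cmod (g \<xi>))\<^sup>2)" for n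
  proof (rule Bochner_Integration.integrable_bound)
    show "integrable lborel (\<lambda>\<xi>. (1 + \<xi>\<^sup>2) ^ n * (cmod (g \<xi>))\<^sup>2)"
      using sob[of "real n"] by (simp add: sobolev_def g_def powr_weight)
    show "AE \<xi> in lborel. norm (\<xi> ^ (2 * n) * (cmod (g \<xi>))\<^sup>2) \<le> norm ((1 + \<xi>\<^sup>2) ^ n * (cmod (g \<xi>))\<^sup>2)"
      using weight_lower[of _ n] by (auto intro!: AE_I2 mult_right_mono simp: abs_mult power_abs[symmetric] power_mult)
  qed measurable
  have "\<forall>k\<le>n. integrable lborel (\<lambda>x. ((deriv ^^ k) f x)\<^sup>2)" for n
  proof (induction n)
    case 0
    then show ?case using cf by (auto simp: cont_L2_def)
  next
    case (Suc n)
    obtain gn where gn: "is_fourier_transform ((deriv ^^ n) f) gn" "AE \<xi> in lborel. gn \<xi> = (\<i> * of_real \<xi>) ^ n * g \<xi>"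
      using fourier_transform_derivs[OF sm _ g, of n] Suc.IH by auto
    note [measurable] = is_fourier_transform_sq_integrable(1)[OF gn(1)]
    have c: "cont_L2 ((deriv ^^ n) f)"
      using Suc.IH smooth_isCont[OF sm] by (auto simp: cont_L2_def)
    have "AE \<xi> in lborel. \<xi> ^ (2 * Suc n) * (cmod (g \<xi>))\<^sup>2 = \<xi>\<^sup>2 * (cmod (gn \<xi>))\<^sup>2"
      using gn(2)
    proof eventually_elim
      case (elim \<xi>)
      then have "cmod (gn \<xi>) = \<bar>\<xi>\<bar> ^ n * cmod (g \<xi>)" by (simp add: norm_mult norm_power)
      then have "(cmod (gn \<xi>))\<^sup>2 = \<bar>\<xi>\<bar> ^ (2 * n) * (cmod (g \<xi>))\<^sup>2"
        by (simp add: power_mult_distrib flip: power_mult) (simp add: mult.commute)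
      also have "\<bar>\<xi>\<bar> ^ (2 * n) = \<xi> ^ (2 * n)" by (simp add: power_mult)
      finally show ?case by (simp add: power2_eq_square)
    qed
    then have "integrable lborel (\<lambda>\<xi>. \<xi>\<^sup>2 * (cmod (gn \<xi>))\<^sup>2)"
      by (subst (asm) eq_commute) (rule integrable_cong_AE_imp[OF mom[of "Suc n"]], auto)
    from deriv_L2_of_fourier[OF c gn(1) smooth_DERIV[OF sm] smooth_isCont[OF sm] this]
    have "cont_L2 ((deriv ^^ Suc n) f)" .
    then show ?case using Suc.IH by (auto simp: cont_L2_def le_Suc_eq)
  qed
  then show ?thesis using sm by (auto simp: sq_smooth_def)
qed

text \<open>Under the integral, the weight is compared with the monomials of degree 0 and
  \<open>2 * n\<close>, whose integrals are squared L2 norms of derivatives by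
  \<open>fourier_moment\<close>. Real exponents \<open>s\<close> are treated by rounding up to an
  integer.\<close>

lemma sobolev_norm_sq_smooth:
  assumes f: "sq_smooth f"
  shows "f \<in> H_infty"
    and "sqrt (2 * pi * (LINT x|lborel. ((deriv ^^ n) f x)\<^sup>2)) \<le> sobolev_norm (real n) f"
    and "s \<le> real n \<Longrightarrow> sobolev_norm s f \<le> sqrt (2 ^ n * (2 * pi * (LINT x|lborel. (f x)\<^sup>2) + 2 * pi * (LINT x|lborel. ((deriv ^^ n) f x)\<^sup>2)))"
proof -
  have sm: "smooth f" and sq: "\<And>n. integrable lborel (\<lambda>x. ((deriv ^^ n) f x)\<^sup>2)" using f by (auto simp: sq_smooth_def)
  define g where "g = fourier f"
  have cf: "cont_L2 f" using sq_smooth_cont_L2[OF f, of 0] by simp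
  have g: "is_fourier_transform f g" unfolding g_def by (rule fourier_is_transform[OF cf])
  note [measurable] = is_fourier_transform_sq_integrable(1)[OF g]
  note mom = fourier_moment[OF sm sq g]
  have i0: "integrable lborel (\<lambda>\<xi>. (cmod (g \<xi>))\<^sup>2)" and v0: "(LINT \<xi>|lborel. (cmod (g \<xi>))\<^sup>2) = 2 * pi * (LINT x|lborel. (f x)\<^sup>2)"
    using mom[of 0] by (auto simp: has_bochner_integral_iff)
  have imn: "integrable lborel (\<lambda>\<xi>. \<xi> ^ (2 * n) * (cmod (g \<xi>))\<^sup>2)"
    and vn: "(LINT \<xi>|lborel. \<xi> ^ (2 * n) * (cmod (g \<xi>))\<^sup>2) = 2 * pi * (LINT x|lborel. ((deriv ^^ n) f x)\<^sup>2)" for n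
    using mom[of n] by (auto simp: has_bochner_integral_iff)
  have idom: "integrable lborel (\<lambda>\<xi>. 2 ^ n * ((cmod (g \<xi>))\<^sup>2 + \<xi> ^ (2 * n) * (cmod (g \<xi>))\<^sup>2))" for n
    by (intro integrable_mult_right Bochner_Integration.integrable_add i0 imn)
  have up: "(1 + \<xi>\<^sup>2) powr s * (cmod (g \<xi>))\<^sup>2 \<le> 2 ^ n * ((cmod (g \<xi>))\<^sup>2 + \<xi> ^ (2 * n) * (cmod (g \<xi>))\<^sup>2)"
    if "s \<le> real n" for s n \<xi>
    using mult_right_mono[OF weight_upper[OF that, of \<xi>], of "(cmod (g \<xi>))\<^sup>2"] by (simp add: algebra_simps)
  have iw: "integrable lborel (\<lambda>\<xi>. (1 + \<xi>\<^sup>2) powr s * (cmod (g \<xi>))\<^sup>2)" for s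
  proof -
    obtain n :: nat where n: "s \<le> real n" using real_arch_simple by blast
    show ?thesis
    proof (rule Bochner_Integration.integrable_bound[OF idom[of n]])
      show "AE \<xi> in lborel. norm ((1 + \<xi>\<^sup>2) powr s * (cmod (g \<xi>))\<^sup>2) \<le> norm (2 ^ n * ((cmod (g \<xi>))\<^sup>2 + \<xi> ^ (2 * n) * (cmod (g \<xi>))\<^sup>2))"
      proof (intro AE_I2)
        fix \<xi>
        have "0 \<le> (1 + \<xi>\<^sup>2) powr s * (cmod (g \<xi>))\<^sup>2" by simp
        with up[OF n, of \<xi>] show "norm ((1 + \<xi>\<^sup>2) powr s * (cmod (g \<xi>))\<^sup>2) \<le> norm (2 ^ n * ((cmod (g \<xi>))\<^sup>2 + \<xi> ^ (2 * n) * (cmod (g \<xi>))\<^sup>2))"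
          by (metis abs_ge_self abs_of_nonneg order_trans real_norm_def)
      qed
    qed measurable
  qed
  show "f \<in> H_infty"
    using sm cf iw cont_L2_measurable[OF cf]
    by (auto simp: H_infty_def sobolev_def square_integrable_def cont_L2_def g_def)
  show "sqrt (2 * pi * (LINT x|lborel. ((deriv ^^ n) f x)\<^sup>2)) \<le> sobolev_norm (real n) f"
    unfolding sobolev_norm_def vn[symmetric] g_def[symmetric]
    by (intro real_sqrt_le_mono integral_mono imn iw mult_right_mono) (auto simp: powr_weight weight_lower)
  show "sobolev_norm s f \<le> sqrt (2 ^ n * (2 * pi * (LINT x|lborel. (f x)\<^sup>2) + 2 * pi * (LINT x|lborel. ((deriv ^^ n) f x)\<^sup>2)))"
    if "s \<le> real n"
  proof -
    have "(LINT \<xi>|lborel. (1 + \<xi>\<^sup>2) powr s * (cmod (g \<xi>))\<^sup>2) \<le> (LINT \<xi>|lborel. 2 ^ n * ((cmod (g \<xi>))\<^sup>2 + \<xi> ^ (2 * n) * (cmod (g \<xi>))\<^sup>2))"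
      by (intro integral_mono iw idom up that)
    also have "\<dots> = 2 ^ n * (2 * pi * (LINT x|lborel. (f x)\<^sup>2) + 2 * pi * (LINT x|lborel. ((deriv ^^ n) f x)\<^sup>2))"
      using i0 imn by (simp add: v0 vn)
    finally show ?thesis unfolding sobolev_norm_def g_def[symmetric] by (rule real_sqrt_le_mono)
  qed
qed

text \<open>Pascal's rule, for an arbitrary \<open>h\<close> because it is needed for products of
  functions, for \<open>dx\<close> on the ring \<open>hinf\<close>, and for time derivatives of the
  equation.\<close>

lemma leibniz_sum:
  fixes h :: "nat \<Rightarrow> nat \<Rightarrow> 'a::real_vector"
  shows "(\<Sum>i\<le>n. real (n choose i) *\<^sub>R (h (Suc i) (n - i) + h i (Suc (n - i))))
    = (\<Sum>i\<le>Suc n. real (Suc n choose i) *\<^sub>R h i (Suc n - i))"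
proof -
  have "(\<Sum>i\<le>Suc n. real (Suc n choose i) *\<^sub>R h i (Suc n - i))
      = h 0 (Suc n) + (\<Sum>i\<le>n. real (Suc n choose Suc i) *\<^sub>R h (Suc i) (n - i))"
    by (subst sum.atMost_Suc_shift) simp
  also have "(\<Sum>i\<le>n. real (Suc n choose Suc i) *\<^sub>R h (Suc i) (n - i))
      = (\<Sum>i\<le>n. real (n choose i) *\<^sub>R h (Suc i) (n - i)) + (\<Sum>i\<le>n. real (n choose Suc i) *\<^sub>R h (Suc i) (n - i))"
    by (simp add: scaleR_add_left sum.distrib)
  also have "h 0 (Suc n) + (A + (\<Sum>i\<le>n. real (n choose Suc i) *\<^sub>R h (Suc i) (n - i)))
      = A + (\<Sum>i\<le>n. real (n choose i) *\<^sub>R h i (Suc n - i))" for A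
  proof -
    have "(\<Sum>i\<le>n. real (n choose i) *\<^sub>R h i (Suc n - i)) = (\<Sum>i\<le>Suc n. real (n choose i) *\<^sub>R h i (Suc n - i))"
      by simp
    also have "\<dots> = h 0 (Suc n) + (\<Sum>i\<le>n. real (n choose Suc i) *\<^sub>R h (Suc i) (n - i))"
      by (subst sum.atMost_Suc_shift) simp
    finally show ?thesis by simp
  qed
  also have "(\<Sum>i\<le>n. real (n choose i) *\<^sub>R h i (Suc n - i)) = (\<Sum>i\<le>n. real (n choose i) *\<^sub>R h i (Suc (n - i)))"
    by (intro sum.cong) (auto simp: Suc_diff_le)
  finally show ?thesis
    by (simp add: scaleR_add_right sum.distrib del: sum.atMost_Suc)
qed

text \<open>The Sobolev embedding of H^1 into bounded functions:
  \<open>pointwise_le_unit_window\<close> applied to a square.\<close>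

lemma sq_smooth_bounded:
  assumes f: "sq_smooth f"
  shows "((deriv ^^ n) f x)\<^sup>2 \<le> (LINT y|lborel. ((deriv ^^ n) f y)\<^sup>2) + 2 * (LINT y|lborel. \<bar>(deriv ^^ n) f y * (deriv ^^ Suc n) f y\<bar>)"
proof -
  let ?f = "(deriv ^^ n) f" and ?f' = "(deriv ^^ Suc n) f"
  note c = sq_smooth_cont_L2[OF f, of n] sq_smooth_cont_L2[OF f, of "Suc n"]
  note [measurable] = cont_L2_measurable[OF c(1)] cont_L2_measurable[OF c(2)]
  have D: "(?f has_real_derivative ?f' x) (at x)" for x using f smooth_DERIV by (auto simp: sq_smooth_def)
  have i: "integrable lborel (\<lambda>y. (?f y)\<^sup>2)" "integrable lborel (\<lambda>y. ?f y * ?f' y)"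
    using c by (auto simp: cont_L2_def simp del: funpow.simps intro!: mult_integrable_sq)
  have "((\<lambda>x. (?f x)\<^sup>2) has_real_derivative 2 * (?f x * ?f' x)) (at x)" for x
    using DERIV_power[OF D, of 2 x] by (simp add: mult_ac)
  moreover have "isCont (\<lambda>x. 2 * (?f x * ?f' x)) x" for x
    using c by (auto simp: cont_L2_def simp del: funpow.simps)
  ultimately have "\<bar>(?f x)\<^sup>2\<bar> \<le> (LINT y|lborel. indicator {x..x + 1} y * (\<bar>(?f y)\<^sup>2\<bar> + \<bar>2 * (?f y * ?f' y)\<bar>))"
    by (rule pointwise_le_unit_window)
  also have "\<dots> \<le> (LINT y|lborel. \<bar>(?f y)\<^sup>2\<bar> + \<bar>2 * (?f y * ?f' y)\<bar>)"
  proof (rule integral_mono)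
    show 1: "integrable lborel (\<lambda>y. \<bar>(?f y)\<^sup>2\<bar> + \<bar>2 * (?f y * ?f' y)\<bar>)"
      using i by (intro Bochner_Integration.integrable_add integrable_abs integrable_mult_right)
    show "integrable lborel (\<lambda>y. indicator {x..x + 1} y * (\<bar>(?f y)\<^sup>2\<bar> + \<bar>2 * (?f y * ?f' y)\<bar>))"
      by (rule Bochner_Integration.integrable_bound[OF 1]) (auto simp: indicator_def simp del: funpow.simps)
  qed (auto simp: indicator_def)
  also have "\<dots> = (LINT y|lborel. (?f y)\<^sup>2) + 2 * (LINT y|lborel. \<bar>?f y * ?f' y\<bar>)"
    using i by (simp add: abs_mult[of 2] del: funpow.simps)
  finally show ?thesis by simp
qed

lemma sq_smooth_bounded': 
  assumes "sq_smooth f" obtains B where "\<And>x. \<bar>(deriv ^^ n) f x\<bar> \<le> B"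
proof -
  have "\<bar>(deriv ^^ n) f x\<bar> \<le> sqrt ((LINT y|lborel. ((deriv ^^ n) f y)\<^sup>2) + 2 * (LINT y|lborel. \<bar>(deriv ^^ n) f y * (deriv ^^ Suc n) f y\<bar>))" for x
    using real_sqrt_le_mono[OF sq_smooth_bounded[OF assms, of n x]] by simp
  then show ?thesis by (rule that)
qed

text \<open>Minkowski's integral inequality in squared form: Cauchy-Schwarz with respect to the
  weight \<open>\<bar>k z\<bar>\<close>, then Tonelli. A family \<open>G z\<close> instead of
  translates of one function covers Taylor remainders as well as convolutions; the bound is asked
  only where \<open>k z\<close> is nonzero, so that an indicator can serve as kernel.\<close>

lemma minkowski_kernel:
  fixes k :: "real \<Rightarrow> real" and G :: "real \<Rightarrow> real \<Rightarrow> real"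
  assumes k: "integrable lborel k" and [measurable]: "case_prod G \<in> borel_measurable (borel \<Otimes>\<^sub>M borel)"
    and G: "\<And>z. k z \<noteq> 0 \<Longrightarrow> integrable lborel (\<lambda>x. (G z x)\<^sup>2) \<and> (LINT x|lborel. (G z x)\<^sup>2) \<le> B"
    and B: "0 \<le> B"
  shows "integrable lborel (\<lambda>x. (LINT z|lborel. k z * G z x)\<^sup>2)"
    and "(LINT x|lborel. (LINT z|lborel. k z * G z x)\<^sup>2) \<le> (LINT z|lborel. \<bar>k z\<bar>)\<^sup>2 * B"
proof -
  note [measurable] = borel_measurable_integrable[OF k]
  let ?K = "LINT z|lborel. \<bar>k z\<bar>"
  have K0: "0 \<le> ?K" by (intro integral_nonneg_AE) auto
  have Kn: "(\<integral>\<^sup>+ z. ennreal \<bar>k z\<bar> \<partial>lborel) = ennreal ?K"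
    using k by (intro nn_integral_eq_integral) auto
  have pt: "ennreal ((LINT z|lborel. k z * G z x)\<^sup>2) \<le> ennreal ?K * (\<integral>\<^sup>+ z. ennreal (\<bar>k z\<bar> * (G z x)\<^sup>2) \<partial>lborel)" for x
  proof -
    have "ennreal \<bar>LINT z|lborel. k z * G z x\<bar> \<le> (\<integral>\<^sup>+ z. ennreal \<bar>k z * G z x\<bar> \<partial>lborel)"
    proof (cases "integrable lborel (\<lambda>z. k z * G z x)")
      case True
      then show ?thesis using integral_norm_bound_ennreal[OF True] by simp
    next
      \<comment> \<open>A function that is not integrable has integral 0 by convention, so the
        left-hand side vanishes.\<close>
      case False
      then show ?thesis by (simp add: not_integrable_integral_eq)
    qed
    also have "\<dots> = (\<integral>\<^sup>+ z. ennreal (sqrt \<bar>k z\<bar>) * ennreal (sqrt \<bar>k z\<bar> * \<bar>G z x\<bar>) \<partial>lborel)"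
      by (intro nn_integral_cong) (simp add: ennreal_mult[symmetric] abs_mult)
    finally have "(ennreal \<bar>LINT z|lborel. k z * G z x\<bar>)\<^sup>2 \<le> (\<integral>\<^sup>+ z. ennreal (sqrt \<bar>k z\<bar>) * ennreal (sqrt \<bar>k z\<bar> * \<bar>G z x\<bar>) \<partial>lborel)\<^sup>2"
      by (rule power_mono) simp
    also have "\<dots> \<le> (\<integral>\<^sup>+ z. (ennreal (sqrt \<bar>k z\<bar>))\<^sup>2 \<partial>lborel) * (\<integral>\<^sup>+ z. (ennreal (sqrt \<bar>k z\<bar> * \<bar>G z x\<bar>))\<^sup>2 \<partial>lborel)"
      by (rule Cauchy_Schwarz_nn_integral) measurable
    also have "\<dots> = ennreal ?K * (\<integral>\<^sup>+ z. ennreal (\<bar>k z\<bar> * (G z x)\<^sup>2) \<partial>lborel)"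
      by (simp add: ennreal_power power_mult_distrib Kn)
    also have "(ennreal \<bar>LINT z|lborel. k z * G z x\<bar>)\<^sup>2 = ennreal ((LINT z|lborel. k z * G z x)\<^sup>2)"
      by (simp add: ennreal_power)
    finally show ?thesis .
  qed
  have "(\<integral>\<^sup>+ x. ennreal ((LINT z|lborel. k z * G z x)\<^sup>2) \<partial>lborel)
      \<le> (\<integral>\<^sup>+ x. ennreal ?K * (\<integral>\<^sup>+ z. ennreal (\<bar>k z\<bar> * (G z x)\<^sup>2) \<partial>lborel) \<partial>lborel)"
    by (intro nn_integral_mono pt)
  also have "\<dots> = ennreal ?K * (\<integral>\<^sup>+ x. (\<integral>\<^sup>+ z. ennreal (\<bar>k z\<bar> * (G z x)\<^sup>2) \<partial>lborel) \<partial>lborel)"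
    by (intro nn_integral_cmult) measurable
  also have "(\<integral>\<^sup>+ x. (\<integral>\<^sup>+ z. ennreal (\<bar>k z\<bar> * (G z x)\<^sup>2) \<partial>lborel) \<partial>lborel) = (\<integral>\<^sup>+ z. (\<integral>\<^sup>+ x. ennreal (\<bar>k z\<bar> * (G z x)\<^sup>2) \<partial>lborel) \<partial>lborel)"
    by (rule lborel_pair.Fubini') measurable
  also have "\<dots> \<le> (\<integral>\<^sup>+ z. ennreal \<bar>k z\<bar> * ennreal B \<partial>lborel)"
  proof (intro nn_integral_mono)
    fix z
    show "(\<integral>\<^sup>+ x. ennreal (\<bar>k z\<bar> * (G z x)\<^sup>2) \<partial>lborel) \<le> ennreal \<bar>k z\<bar> * ennreal B"
    proof (cases "k z = 0")
      case False
      have "(\<integral>\<^sup>+ x. ennreal (\<bar>k z\<bar> * (G z x)\<^sup>2) \<partial>lborel) = ennreal \<bar>k z\<bar> * (\<integral>\<^sup>+ x. ennreal ((G z x)\<^sup>2) \<partial>lborel)"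
        by (simp add: ennreal_mult nn_integral_cmult)
      also have "(\<integral>\<^sup>+ x. ennreal ((G z x)\<^sup>2) \<partial>lborel) \<le> ennreal B"
        using G[OF False] by (subst nn_integral_eq_integral) (auto intro: ennreal_leI)
      finally show ?thesis by (simp add: mult_left_mono)
    qed simp
  qed
  also have "\<dots> = ennreal ?K * ennreal B"
    by (subst nn_integral_multc) (auto simp: Kn)
  also have "ennreal ?K * (ennreal ?K * ennreal B) = ennreal (?K\<^sup>2 * B)"
    using K0 B by (simp add: ennreal_mult power2_eq_square mult.assoc)
  finally have le: "(\<integral>\<^sup>+ x. ennreal ((LINT z|lborel. k z * G z x)\<^sup>2) \<partial>lborel) \<le> ennreal (?K\<^sup>2 * B)"
    by (simp add: mult_left_mono)
  have [measurable]: "(\<lambda>x. LINT z|lborel. k z * G z x) \<in> borel_measurable borel"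
    by measurable
  show I: "integrable lborel (\<lambda>x. (LINT z|lborel. k z * G z x)\<^sup>2)"
    unfolding integrable_iff_bounded using le by (auto simp: le_less_trans)
  show "(LINT x|lborel. (LINT z|lborel. k z * G z x)\<^sup>2) \<le> ?K\<^sup>2 * B"
    using le K0 B by (subst (asm) nn_integral_eq_integral[OF I]) (auto simp: ennreal_le_iff)
qed

text \<open>The elements are exactly those of \<open>H_infty\<close>, by \<open>H_infty_imp_sq_smooth\<close> and \<open>H_infty_ev\<close>.\<close>

typedef hinf = "{f. sq_smooth f}" morphisms ev Hinf
proof
  show "(\<lambda>_. 0) \<in> {f. sq_smooth f}"
    by (auto intro!: sq_smoothI[where F="\<lambda>_ _. 0"])
qed

setup_lifting type_definition_hinf

lemma sq_smooth_ev: "sq_smooth (ev f)" using ev by simp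

lemma sq_smooth_deriv: "sq_smooth f \<Longrightarrow> sq_smooth (deriv f)"
  unfolding sq_smooth_def smooth_def using funpow_swap1[of deriv _ f] funpow.simps(2)[of _ deriv]
  by (metis comp_apply)

lift_definition dx :: "hinf \<Rightarrow> hinf" is deriv by (rule sq_smooth_deriv)

lemma ev_dx_funpow: "ev ((dx ^^ n) f) = (deriv ^^ n) (ev f)"
  by (induction n) (auto simp: dx.rep_eq)

lemma ev_DERIV: "(ev f has_real_derivative ev (dx f) x) (at x)"
  using smooth_DERIV[of "ev f" 0 x] sq_smooth_ev[of f] by (simp add: dx.rep_eq sq_smooth_def)

lemma ev_isCont: "isCont (ev f) x" using ev_DERIV DERIV_isCont by blast

lemma ev_cont_L2: "cont_L2 (ev f)" using sq_smooth_cont_L2[OF sq_smooth_ev, of 0] by simp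

lemma ev_measurable [measurable]: "ev f \<in> borel_measurable borel"
  by (rule cont_L2_measurable[OF ev_cont_L2])

lemma ev_sq_integrable: "integrable lborel (\<lambda>x. (ev f x)\<^sup>2)"
  using ev_cont_L2 by (auto simp: cont_L2_def)

lemma ev_mult_integrable: "integrable lborel (\<lambda>x. ev f x * ev g x)"
  by (intro mult_integrable_sq ev_sq_integrable) auto

lemma ev_bounded: obtains B where "\<And>x. \<bar>ev f x\<bar> \<le> B" "0 \<le> B"
proof -
  obtain B where "\<And>x. \<bar>(deriv ^^ 0) (ev f) x\<bar> \<le> B" using sq_smooth_bounded'[OF sq_smooth_ev, of 0 f] by auto
  moreover from this[of 0] have "0 \<le> B" by linarith
  ultimately show ?thesis using that by auto
qed

lemma Hinf_by_derivs:
  assumes "\<And>n x. (F n has_real_derivative F (Suc n) x) (at x)" "\<And>n. integrable lborel (\<lambda>x. (F n x)\<^sup>2)"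
  shows "sq_smooth (F 0)" "ev ((dx ^^ n) (Hinf (F 0))) = F n"
proof -
  show 1: "sq_smooth (F 0)" by (rule sq_smoothI[where F=F, OF assms refl])
  have "ev (Hinf (F 0)) = F 0" using 1 by (simp add: Hinf_inverse)
  then show "ev ((dx ^^ n) (Hinf (F 0))) = F n"
    by (simp add: ev_dx_funpow smooth_sequence(1)[where F=F, OF assms(1)])
qed

abbreviation evd :: "nat \<Rightarrow> hinf \<Rightarrow> real \<Rightarrow> real" where "evd n f \<equiv> ev ((dx ^^ n) f)"

lemma evd_DERIV: "(evd n f has_real_derivative evd (Suc n) f x) (at x)"
  using ev_DERIV by simp

lemma sq_add_integrable:
  assumes "integrable lborel (\<lambda>x. (f x)\<^sup>2)" "integrable lborel (\<lambda>x. (g x :: real)\<^sup>2)"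
    and [measurable]: "f \<in> borel_measurable borel" "g \<in> borel_measurable borel"
  shows "integrable lborel (\<lambda>x. (f x + g x)\<^sup>2)"
proof -
  have "integrable lborel (\<lambda>x. (f x)\<^sup>2 + (g x)\<^sup>2 + 2 * (f x * g x))"
    by (intro Bochner_Integration.integrable_add integrable_mult_right mult_integrable_sq assms)
  then show ?thesis by (simp add: power2_sum mult.assoc)
qed

lemma bounded_mult_sq_integrable:
  assumes "integrable lborel (\<lambda>x. (g x :: real)\<^sup>2)" "\<And>x. \<bar>f x\<bar> \<le> B"
    and [measurable]: "f \<in> borel_measurable borel" "g \<in> borel_measurable borel"
  shows "integrable lborel (\<lambda>x. (f x * g x)\<^sup>2)"
proof (rule Bochner_Integration.integrable_bound)
  show "integrable lborel (\<lambda>x. B\<^sup>2 * (g x)\<^sup>2)" using assms by simp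
  have "(f x)\<^sup>2 \<le> B\<^sup>2" for x using assms(2)[of x] by (metis abs_ge_zero power2_abs power_mono)
  then show "AE x in lborel. norm ((f x * g x)\<^sup>2) \<le> norm (B\<^sup>2 * (g x)\<^sup>2)"
    by (auto simp: power_mult_distrib intro!: mult_right_mono)
qed simp

section \<open>Vector space, ring and inner product on \<open>hinf\<close>\<close>

instantiation hinf :: real_vector
begin
lift_definition zero_hinf :: hinf is "\<lambda>_. 0"
  by (auto intro!: sq_smoothI[where F="\<lambda>_ _. 0"])
lift_definition plus_hinf :: "hinf \<Rightarrow> hinf \<Rightarrow> hinf" is "\<lambda>f g x. f x + g x"
proof -
  fix f g assume "sq_smooth f" "sq_smooth g"
  then obtain f' g' where [simp]: "f = ev f'" "g = ev g'" by (metis Hinf_inverse mem_Collect_eq)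
  show "sq_smooth (\<lambda>x. f x + g x)"
    by (rule sq_smoothI[where F="\<lambda>n x. evd n f' x + evd n g' x"])
       (auto intro!: DERIV_add ev_DERIV sq_add_integrable ev_sq_integrable)
qed
lift_definition scaleR_hinf :: "real \<Rightarrow> hinf \<Rightarrow> hinf" is "\<lambda>c f x. c * f x"
proof -
  fix c f assume "sq_smooth f"
  then obtain f' where [simp]: "f = ev f'" by (metis Hinf_inverse mem_Collect_eq)
  show "sq_smooth (\<lambda>x. c * f x)"
    by (rule sq_smoothI[where F="\<lambda>n x. c * evd n f' x"])
       (auto intro!: DERIV_cmult ev_DERIV simp: power_mult_distrib ev_sq_integrable)
qed
lift_definition uminus_hinf :: "hinf \<Rightarrow> hinf" is "\<lambda>f x. - f x"
proof -
  fix f assume "sq_smooth f"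
  then obtain f' where [simp]: "f = ev f'" by (metis Hinf_inverse mem_Collect_eq)
  show "sq_smooth (\<lambda>x. - f x)"
    by (rule sq_smoothI[where F="\<lambda>n x. - evd n f' x"]) (auto intro!: DERIV_minus ev_DERIV ev_sq_integrable)
qed
definition minus_hinf :: "hinf \<Rightarrow> hinf \<Rightarrow> hinf" where "minus_hinf f g = f + - g"
instance
  by standard (simp_all add: minus_hinf_def, (transfer, simp add: fun_eq_iff algebra_simps)+)
end

lemma hinf_eqI: "(\<And>x. ev f x = ev g x) \<Longrightarrow> f = g" by (simp add: ev_inject[symmetric] ext)

lemma ev_zero [simp]: "ev 0 x = 0" by transfer simp
lemma ev_add [simp]: "ev (f + g) x = ev f x + ev g x" by transfer simp
lemma ev_scaleR [simp]: "ev (c *\<^sub>R f) x = c * ev f x" by transfer simp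
lemma ev_minus [simp]: "ev (- f) x = - ev f x" by transfer simp
lemma ev_diff [simp]: "ev (f - g) x = ev f x - ev g x" unfolding minus_hinf_def ev_add ev_minus by simp

text \<open>A ring without unit, since nonzero constants are not square integrable.\<close>

instantiation hinf :: comm_ring
begin
lift_definition times_hinf :: "hinf \<Rightarrow> hinf \<Rightarrow> hinf" is "\<lambda>f g x. f x * g x"
proof -
  fix f g assume "sq_smooth f" "sq_smooth g"
  then obtain f' g' where [simp]: "f = ev f'" "g = ev g'" by (metis Hinf_inverse mem_Collect_eq)
  let ?t = "\<lambda>x i j. evd i f' x * evd j g' x"
  let ?F = "\<lambda>n x. \<Sum>i\<le>n. real (n choose i) *\<^sub>R ?t x i (n - i)"
  show "sq_smooth (\<lambda>x. f x * g x)"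
  proof (rule sq_smoothI[where F="?F"])
    fix n x
    have "(?F n has_real_derivative (\<Sum>i\<le>n. real (n choose i) *\<^sub>R (?t x (Suc i) (n - i) + ?t x i (Suc (n - i))))) (at x)"
      unfolding real_scaleR_def
      by (intro DERIV_sum DERIV_cmult DERIV_cong[OF DERIV_mult[OF evd_DERIV evd_DERIV]]) (simp add: mult_ac add_ac)
    then show "(?F n has_real_derivative ?F (Suc n) x) (at x)"
      unfolding leibniz_sum[where h="\<lambda>i j. evd i f' x * evd j g' x"] .
    have I: "integrable lborel (\<lambda>x. (c * ?t x i j)\<^sup>2)" for c i j
    proof -
      obtain B where B: "\<And>x. \<bar>evd i f' x\<bar> \<le> B" using ev_bounded by blast
      have "integrable lborel (\<lambda>x. (?t x i j)\<^sup>2)"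
        by (rule bounded_mult_sq_integrable[OF ev_sq_integrable B]) auto
      then show ?thesis unfolding power_mult_distrib[of c] by (rule integrable_mult_right)
    qed
    have "integrable lborel (\<lambda>x. (\<Sum>i\<in>A. real (n choose i) * ?t x i (n - i))\<^sup>2)" if "finite A" for A
      using that
    proof induction
      case (insert i A)
      then show ?case
        by (subst sum.insert, simp, simp) (intro sq_add_integrable I, auto)
    qed simp
    then show "integrable lborel (\<lambda>x. (?F n x)\<^sup>2)" by simp
  qed auto
qed
instance by standard (transfer; auto simp: algebra_simps)+
end

lemma ev_mult [simp]: "ev (f * g) x = ev f x * ev g x" by transfer simp

instance hinf :: real_algebra
  by standard (rule hinf_eqI; simp)+

text \<open>Norm and topology of the type are those of L2, in which the space is not complete and
  \<open>dx\<close> is not continuous. Convergence in all H^s is expressed separately, by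
  convergence of every \<open>(dx ^^ k)\<close>.\<close>

instantiation hinf :: real_inner
begin
definition inner_hinf :: "hinf \<Rightarrow> hinf \<Rightarrow> real" where "inner_hinf f g = (LINT x|lborel. ev f x * ev g x)"
definition norm_hinf :: "hinf \<Rightarrow> real" where "norm_hinf f = sqrt (inner f f)"
definition dist_hinf :: "hinf \<Rightarrow> hinf \<Rightarrow> real" where "dist_hinf f g = norm (f - g)"
definition sgn_hinf :: "hinf \<Rightarrow> hinf" where "sgn_hinf f = f /\<^sub>R norm f"
definition uniformity_hinf :: "(hinf \<times> hinf) filter" where "uniformity_hinf = (INF e\<in>{0 <..}. principal {(x, y). dist x y < e})"
definition open_hinf :: "hinf set \<Rightarrow> bool" where "open_hinf U = (\<forall>x\<in>U. eventually (\<lambda>(x', y). x' = x \<longrightarrow> y \<in> U) uniformity)"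
instance
proof
  fix f g h :: hinf and r :: real
  show "inner f g = inner g f" by (simp add: inner_hinf_def mult.commute)
  show "inner (f + g) h = inner f h + inner g h"
    by (simp add: inner_hinf_def distrib_right ev_mult_integrable)
  show "inner (r *\<^sub>R f) g = r * inner f g" by (simp add: inner_hinf_def mult.assoc)
  show "0 \<le> inner f f" unfolding inner_hinf_def by (intro integral_nonneg_AE) auto
  show "(inner f f = 0) = (f = 0)"
  proof
    assume "inner f f = 0"
    then have "AE x in lborel. ev f x * ev f x = 0"
      unfolding inner_hinf_def by (subst (asm) integral_nonneg_eq_0_iff_AE) (auto simp: ev_mult_integrable)
    then have "AE x in lborel. ev f x = 0" by simp
    then have n: "{x. ev f x \<noteq> 0} \<in> null_sets lborel"
      by (subst AE_iff_null_sets) auto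
    have "open {x. ev f x \<noteq> 0}"
      by (intro open_Collect_neq continuous_at_imp_continuous_on) (auto simp: ev_isCont)
    moreover have "negligible {x. ev f x \<noteq> 0}"
      unfolding negligible_iff_null_sets using n null_sets_completionI by blast
    ultimately have "{x. ev f x \<noteq> 0} = {}" using open_not_negligible by blast
    then show "f = 0" by (intro hinf_eqI) auto
  qed (simp add: inner_hinf_def)
qed (simp_all add: norm_hinf_def dist_hinf_def sgn_hinf_def uniformity_hinf_def open_hinf_def)
end

lemma norm_hinf_sq: "(norm f)\<^sup>2 = (LINT x|lborel. (ev f x)\<^sup>2)" for f :: hinf
  unfolding power2_norm_eq_inner inner_hinf_def by (simp add: power2_eq_square)

lemma norm_le_of_sq_integral:
  fixes f :: hinf
  assumes "(LINT x|lborel. (ev f x)\<^sup>2) \<le> B\<^sup>2" "0 \<le> B"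
  shows "norm f \<le> B"
  using assms by (simp add: norm_hinf_sq[symmetric] power2_le_iff_abs_le)

lemma ev_dx_eqI: "(\<And>x. (ev f has_real_derivative ev g x) (at x)) \<Longrightarrow> dx f = g"
  using ev_DERIV DERIV_unique by (intro hinf_eqI) blast

lemma dx_add [simp]: "dx (f + g) = dx f + dx g" by (rule ev_dx_eqI) (auto intro!: DERIV_add ev_DERIV simp: ev_add[abs_def])

lemma dx_scaleR [simp]: "dx (c *\<^sub>R f) = c *\<^sub>R dx f"
  by (rule ev_dx_eqI) (auto intro!: DERIV_cmult ev_DERIV simp: ev_scaleR[abs_def])

lemma dx_minus [simp]: "dx (- f) = - dx f"
  by (rule ev_dx_eqI) (auto intro!: DERIV_minus ev_DERIV simp: ev_minus[abs_def])

lemma dx_diff [simp]: "dx (f - g) = dx f - dx g"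
  by (rule ev_dx_eqI) (auto intro!: DERIV_diff ev_DERIV simp: ev_diff[abs_def])

lemma dx_zero [simp]: "dx 0 = 0" using dx_scaleR[of 0 0] by simp

lemma dx_mult: "dx (f * g) = dx f * g + f * dx g"
  by (rule ev_dx_eqI) (auto intro!: DERIV_cong[OF DERIV_mult[OF ev_DERIV ev_DERIV]] simp: ev_mult[abs_def])

lemma dx_sum: "dx (sum f A) = (\<Sum>i\<in>A. dx (f i))" by (induction A rule: infinite_finite_induct) auto

lemma dxn_add: "(dx ^^ n) (f + g) = (dx ^^ n) f + (dx ^^ n) g" by (induction n) auto
lemma dxn_diff: "(dx ^^ n) (f - g) = (dx ^^ n) f - (dx ^^ n) g" by (induction n) auto
lemma dxn_scaleR: "(dx ^^ n) (c *\<^sub>R f) = c *\<^sub>R (dx ^^ n) f" by (induction n) auto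
lemma dxn_minus: "(dx ^^ n) (- f) = - (dx ^^ n) f" by (induction n) auto
lemma dxn_sum: "(dx ^^ n) (sum f A) = (\<Sum>i\<in>A. (dx ^^ n) (f i))" by (induction n) (auto simp: dx_sum)
lemma dxn_zero [simp]: "(dx ^^ n) 0 = 0" by (induction n) auto
lemma dxn_dx: "(dx ^^ n) (dx f) = (dx ^^ Suc n) f" by (simp add: funpow_swap1)

lemma dxn_mult: "(dx ^^ n) (f * g) = (\<Sum>i\<le>n. real (n choose i) *\<^sub>R ((dx ^^ i) f * (dx ^^ (n - i)) g))"
proof (induction n)
  case (Suc n)
  have "(dx ^^ Suc n) (f * g) = (\<Sum>i\<le>n. real (n choose i) *\<^sub>R ((dx ^^ Suc i) f * (dx ^^ (n - i)) g + (dx ^^ i) f * (dx ^^ Suc (n - i)) g))"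
    by (simp add: Suc.IH dx_sum dx_mult)
  also have "\<dots> = (\<Sum>i\<le>Suc n. real (Suc n choose i) *\<^sub>R ((dx ^^ i) f * (dx ^^ (Suc n - i)) g))"
    by (rule leibniz_sum)
  finally show ?case .
qed simp

section \<open>Integration by parts, interpolation and product bounds\<close>

lemma inner_hinf_eq: "inner f g = (LINT x|lborel. ev f x * ev g x)" for f g :: hinf
  by (rule inner_hinf_def)

lemma inner_mult_left: "inner (f * g) h = inner g (f * h)" for f g h :: hinf
  by (simp add: inner_hinf_eq mult_ac)

lemma ev_decay: "filterlim (\<lambda>n. \<bar>X n\<bar>) at_top sequentially \<Longrightarrow> (\<lambda>n. ev f (X n)) \<longlonglongrightarrow> 0"
  by (rule cont_L2_decay[OF ev_cont_L2 ev_cont_L2 ev_DERIV])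

text \<open>For a product the derivative is integrable and the boundary values decay; a single
  element of \<open>hinf\<close> has a derivative that is merely square integrable.\<close>

lemma integral_dx_mult: "(LINT x|lborel. ev (dx (f * g)) x) = 0"
proof (rule LIMSEQ_unique)
  let ?p = "ev (dx (f * g))"
  have i: "integrable lborel ?p"
    using Bochner_Integration.integrable_add[OF ev_mult_integrable[of "dx f" g] ev_mult_integrable[of f "dx g"]]
    by (simp add: dx_mult ev_add[abs_def] ev_mult[abs_def])
  show "(\<lambda>n. LINT x|lborel. indicator {- real n..real n} x * ?p x) \<longlonglongrightarrow> (LINT x|lborel. ?p x)"
  proof (rule integral_dominated_convergence[where w="\<lambda>x. \<bar>?p x\<bar>"])
    show "AE x in lborel. (\<lambda>n. indicator {- real n..real n} x * ?p x) \<longlonglongrightarrow> ?p x"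
    proof (intro AE_I2 tendsto_eventually)
      fix x
      obtain n0 :: nat where "\<bar>x\<bar> \<le> real n0" using real_arch_simple by blast
      then show "eventually (\<lambda>n. indicator {- real n..real n} x * ?p x = ?p x) sequentially"
        by (intro eventually_sequentiallyI[of n0]) (auto simp: indicator_def)
    qed
  qed (use i in \<open>auto simp: indicator_def\<close>)
  have "(LINT x|lborel. indicator {- real n..real n} x *\<^sub>R ?p x) = ev (f * g) (real n) - ev (f * g) (- real n)" for n
    by (rule integral_FTC_Icc)
       (auto intro!: continuous_at_imp_continuous_on ev_isCont has_field_derivative_at_within ev_DERIV
         simp: has_real_derivative_iff_has_vector_derivative[symmetric] simp del: ev_mult)
  moreover have "(\<lambda>n. ev (f * g) (real n) - ev (f * g) (- real n)) \<longlonglongrightarrow> 0 - 0"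
    by (intro tendsto_diff ev_decay) (simp_all add: filterlim_real_sequentially)
  ultimately show "(\<lambda>n. LINT x|lborel. indicator {- real n..real n} x * ?p x) \<longlonglongrightarrow> 0" by simp
qed

lemma inner_dx: "inner f (dx g) = - inner (dx f) g"
proof -
  have "(LINT x|lborel. ev (dx f) x * ev g x + ev f x * ev (dx g) x) = 0"
    using integral_dx_mult[of f g] by (simp add: dx_mult)
  then show ?thesis by (simp add: inner_hinf_eq ev_mult_integrable)
qed

text \<open>Integrate by parts once and use Cauchy-Schwarz. This inequality turns smallness in L2
  plus bounds on higher derivatives into smallness of every derivative, and carries all limits from
  L2 to H^s.\<close>

lemma norm_dx_interpolation: "(norm (dx f))\<^sup>2 \<le> norm f * norm (dx (dx f))"
proof -
  have "(norm (dx f))\<^sup>2 = - inner f (dx (dx f))"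
    by (simp add: power2_norm_eq_inner inner_dx[of f])
  also have "\<dots> \<le> norm f * norm (dx (dx f))"
    using norm_cauchy_schwarz[of f "- dx (dx f)"] by simp
  finally show ?thesis .
qed

lemma ev_le_norm: "\<bar>ev f x\<bar> \<le> 2 * (norm f + norm (dx f))"
proof -
  have i: "integrable lborel (\<lambda>y. ((ev f y)\<^sup>2 + (ev (dx f) y)\<^sup>2) / 2)" by (simp add: ev_sq_integrable)
  have "(ev f x)\<^sup>2 \<le> (LINT y|lborel. (ev f y)\<^sup>2) + 2 * (LINT y|lborel. \<bar>ev f y * ev (dx f) y\<bar>)"
    using sq_smooth_bounded[OF sq_smooth_ev, of 0 f x] by (simp add: dx.rep_eq)
  also have "(LINT y|lborel. \<bar>ev f y * ev (dx f) y\<bar>) \<le> (LINT y|lborel. ((ev f y)\<^sup>2 + (ev (dx f) y)\<^sup>2) / 2)"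
  proof (intro integral_mono i integrable_abs ev_mult_integrable)
    fix y
    have "0 \<le> (\<bar>ev f y\<bar> - \<bar>ev (dx f) y\<bar>)\<^sup>2" by simp
    then show "\<bar>ev f y * ev (dx f) y\<bar> \<le> ((ev f y)\<^sup>2 + (ev (dx f) y)\<^sup>2) / 2"
      by (simp add: power2_diff abs_mult)
  qed
  also have "\<dots> = ((norm f)\<^sup>2 + (norm (dx f))\<^sup>2) / 2" by (simp add: norm_hinf_sq ev_sq_integrable)
  also have "(LINT y|lborel. (ev f y)\<^sup>2) = (norm f)\<^sup>2" by (simp add: norm_hinf_sq)
  finally have "(ev f x)\<^sup>2 \<le> 2 * (norm f)\<^sup>2 + (norm (dx f))\<^sup>2" by (simp add: field_simps)
  also have "\<dots> \<le> (2 * (norm f + norm (dx f)))\<^sup>2"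
    by (simp add: power2_eq_square algebra_simps)
  finally show ?thesis by (simp add: abs_le_square_iff[symmetric])
qed

lemma norm_mult_bounded:
  assumes "\<And>x. \<bar>ev f x\<bar> \<le> B"
  shows "norm (f * g) \<le> B * norm g"
proof (rule norm_le_of_sq_integral)
  show B: "0 \<le> B * norm g" using assms[of 0] by (intro mult_nonneg_nonneg) auto
  have "(LINT x|lborel. (ev (f * g) x)\<^sup>2) \<le> (LINT x|lborel. B\<^sup>2 * (ev g x)\<^sup>2)"
  proof (intro integral_mono ev_sq_integrable integrable_mult_right)
    fix x
    have "(ev f x)\<^sup>2 \<le> B\<^sup>2" using assms[of x] by (metis abs_ge_zero power2_abs power_mono)
    then show "(ev (f * g) x)\<^sup>2 \<le> B\<^sup>2 * (ev g x)\<^sup>2" by (simp add: power_mult_distrib mult_right_mono)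
  qed
  then show "(LINT x|lborel. (ev (f * g) x)\<^sup>2) \<le> (B * norm g)\<^sup>2"
    by (simp add: power_mult_distrib norm_hinf_sq)
qed

lemma norm_mult_le: "norm (f * g) \<le> 2 * (norm f + norm (dx f)) * norm g" for f g :: hinf
  by (rule norm_mult_bounded[OF ev_le_norm])

section \<open>Translations and convolutions\<close>

lift_definition tr :: "real \<Rightarrow> hinf \<Rightarrow> hinf" is "\<lambda>h f x. f (x + h)"
proof -
  fix h f assume "sq_smooth f"
  then obtain f' where [simp]: "f = ev f'" by (metis Hinf_inverse mem_Collect_eq)
  show "sq_smooth (\<lambda>x. f (x + h))"
  proof (rule sq_smoothI[where F="\<lambda>n x. evd n f' (x + h)"])
    fix n x
    show "((\<lambda>x. evd n f' (x + h)) has_real_derivative evd (Suc n) f' (x + h)) (at x)"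
      using DERIV_shift[of "evd n f'" "evd (Suc n) f' (x + h)" x h] evd_DERIV[of n f' "x + h"] by blast
    show "integrable lborel (\<lambda>x. (evd n f' (x + h))\<^sup>2)"
      using lborel_integrable_real_affine[OF ev_sq_integrable, of 1 "(dx ^^ n) f'" h] by (simp add: add.commute)
  qed simp
qed

lemma ev_tr [simp]: "ev (tr h f) x = ev f (x + h)" by transfer simp

lemma dx_tr [simp]: "dx (tr h f) = tr h (dx f)"
proof (rule ev_dx_eqI)
  show "(ev (tr h f) has_real_derivative ev (tr h (dx f)) x) (at x)" for x
    using ev_DERIV[of f "x + h"] unfolding DERIV_shift by (simp add: ev_tr[abs_def])
qed

lemma dxn_tr [simp]: "(dx ^^ n) (tr h f) = tr h ((dx ^^ n) f)" by (induction n) auto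

lemma tr_diff [simp]: "tr h (f - g) = tr h f - tr h g" by (rule hinf_eqI) simp
lemma tr_tr [simp]: "tr h (tr k f) = tr (h + k) f" by (rule hinf_eqI) (simp add: add_ac)
lemma tr_0 [simp]: "tr 0 f = f" by (rule hinf_eqI) simp

lemma norm_tr [simp]: "norm (tr h f) = norm f"
proof -
  have "(norm (tr h f))\<^sup>2 = (norm f)\<^sup>2"
    unfolding norm_hinf_sq by (subst (2) lborel_integral_real_affine[where c=1 and t=h]) (auto simp: add.commute)
  then show ?thesis by simp
qed

definition L1 :: "(real \<Rightarrow> real) \<Rightarrow> real" where "L1 k = (LINT z|lborel. \<bar>k z\<bar>)"

lemma L1_nonneg: "0 \<le> L1 k" unfolding L1_def by (intro integral_nonneg_AE) auto

lemma conv_integrable: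
  assumes k: "integrable lborel k" and [measurable]: "f \<in> borel_measurable borel" and B: "\<And>x. \<bar>f x :: real\<bar> \<le> B"
  shows "integrable lborel (\<lambda>z. k z * f (x - z))"
proof (rule Bochner_Integration.integrable_bound)
  show "integrable lborel (\<lambda>z. B * k z)" using k by simp
  note [measurable] = borel_measurable_integrable[OF k]
  show "(\<lambda>z. k z * f (x - z)) \<in> borel_measurable lborel" by measurable
  have "\<bar>k z\<bar> * \<bar>f (x - z)\<bar> \<le> \<bar>k z\<bar> * \<bar>B\<bar>" for z using B[of "x - z"] by (intro mult_left_mono) auto
  then show "AE z in lborel. norm (k z * f (x - z)) \<le> norm (B * k z)" by (auto simp: abs_mult mult.commute)
qed

lemma conv_DERIV:
  assumes k: "integrable lborel k"
  shows "((\<lambda>x. LINT z|lborel. k z * ev f (x - z)) has_real_derivative (LINT z|lborel. k z * ev (dx f) (x - z))) (at x)"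
proof -
  note [measurable] = borel_measurable_integrable[OF k]
  obtain B where B: "\<And>x. \<bar>ev f x\<bar> \<le> B" using ev_bounded by blast
  obtain B' where B': "\<And>x. \<bar>ev (dx f) x\<bar> \<le> B'" using ev_bounded by blast
  have "((\<lambda>h. ((LINT z|lborel. k z * ev f (x + h - z)) - (LINT z|lborel. k z * ev f (x - z))) / h)
      \<longlongrightarrow> (LINT z|lborel. k z * ev (dx f) (x - z))) (at 0)"
    unfolding tendsto_at_iff_sequentially
  proof (intro allI impI)
    fix X :: "nat \<Rightarrow> real" assume X0: "\<forall>i. X i \<in> UNIV - {0}" and X: "X \<longlonglongrightarrow> 0"
    have q: "((LINT z|lborel. k z * ev f (x + X n - z)) - (LINT z|lborel. k z * ev f (x - z))) / X n
        = (LINT z|lborel. k z * ((ev f (x - z + X n) - ev f (x - z)) / X n))" for n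
    proof -
      have "(LINT z|lborel. k z * ev f (x + X n - z)) - (LINT z|lborel. k z * ev f (x - z))
         = (LINT z|lborel. k z * ev f (x + X n - z) - k z * ev f (x - z))"
        by (intro Bochner_Integration.integral_diff[symmetric] conv_integrable[OF k _ B]) auto
      then show ?thesis
        by (simp add: integral_divide_zero[symmetric] algebra_simps diff_divide_distrib)
    qed
    have "(\<lambda>n. LINT z|lborel. k z * ((ev f (x - z + X n) - ev f (x - z)) / X n)) \<longlonglongrightarrow> (LINT z|lborel. k z * ev (dx f) (x - z))"
    proof (rule integral_dominated_convergence[where w="\<lambda>z. B' * \<bar>k z\<bar>"])
      show "AE z in lborel. (\<lambda>n. k z * ((ev f (x - z + X n) - ev f (x - z)) / X n)) \<longlonglongrightarrow> k z * ev (dx f) (x - z)"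
      proof (intro AE_I2 tendsto_mult_left)
        fix z
        have "((\<lambda>h. (ev f (x - z + h) - ev f (x - z)) / h) \<longlongrightarrow> ev (dx f) (x - z)) (at 0)"
          using ev_DERIV[of f "x - z"] by (simp add: DERIV_def)
        then show "(\<lambda>n. (ev f (x - z + X n) - ev f (x - z)) / X n) \<longlonglongrightarrow> ev (dx f) (x - z)"
          by (rule filterlim_compose) (use X X0 in \<open>auto intro!: filterlim_atI always_eventually\<close>)
      qed
      show "AE z in lborel. norm (k z * ((ev f (x - z + X n) - ev f (x - z)) / X n)) \<le> B' * \<bar>k z\<bar>" for n
      proof (intro AE_I2)
        fix z
        have "\<bar>ev f (x - z + X n) - ev f (x - z)\<bar> \<le> B' * \<bar>x - z + X n - (x - z)\<bar>"
          using field_differentiable_bound[of UNIV "ev f" "ev (dx f)" B' "x - z + X n" "x - z"] ev_DERIV B' by auto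
        then have "\<bar>(ev f (x - z + X n) - ev f (x - z)) / X n\<bar> \<le> B'"
          using X0[rule_format, of n] by (simp add: abs_divide field_simps)
        then show "norm (k z * ((ev f (x - z + X n) - ev f (x - z)) / X n)) \<le> B' * \<bar>k z\<bar>"
          by (simp only: real_norm_def abs_mult) (subst mult.commute, intro mult_right_mono, auto)
      qed
    qed (use k in auto)
    then show "((\<lambda>h. ((LINT z|lborel. k z * ev f (x + h - z)) - (LINT z|lborel. k z * ev f (x - z))) / h) \<circ> X)
       \<longlonglongrightarrow> (LINT z|lborel. k z * ev (dx f) (x - z))"
      by (simp add: o_def q)
  qed
  then show ?thesis by (simp add: DERIV_def)
qed

lemma conv_L2:
  assumes k: "integrable lborel k"
  shows "integrable lborel (\<lambda>x. (LINT z|lborel. k z * ev f (x - z))\<^sup>2)"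
    and "(LINT x|lborel. (LINT z|lborel. k z * ev f (x - z))\<^sup>2) \<le> (L1 k * norm f)\<^sup>2"
proof -
  have "integrable lborel (\<lambda>x. (ev f (x - z))\<^sup>2) \<and> (LINT x|lborel. (ev f (x - z))\<^sup>2) \<le> (norm f)\<^sup>2" for z
    using ev_sq_integrable[of "tr (- z) f"] norm_hinf_sq[of "tr (- z) f"] by simp
  note * = minkowski_kernel[OF k, of "\<lambda>z x. ev f (x - z)", OF _ this]
  show "integrable lborel (\<lambda>x. (LINT z|lborel. k z * ev f (x - z))\<^sup>2)" by (rule *) auto
  have "(LINT x|lborel. (LINT z|lborel. k z * ev f (x - z))\<^sup>2) \<le> (LINT z|lborel. \<bar>k z\<bar>)\<^sup>2 * (norm f)\<^sup>2"
    by (rule *) auto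
  then show "(LINT x|lborel. (LINT z|lborel. k z * ev f (x - z))\<^sup>2) \<le> (L1 k * norm f)\<^sup>2"
    by (simp add: L1_def power_mult_distrib)
qed

definition conv :: "(real \<Rightarrow> real) \<Rightarrow> hinf \<Rightarrow> hinf" where
  "conv k f = Hinf (\<lambda>x. LINT z|lborel. k z * ev f (x - z))"

context
  fixes k :: "real \<Rightarrow> real"
  assumes k: "integrable lborel k"
begin

lemma ev_conv: "ev (conv k f) x = (LINT z|lborel. k z * ev f (x - z))"
proof -
  have "sq_smooth (\<lambda>x. LINT z|lborel. k z * ev f (x - z))"
    by (rule sq_smoothI[where F="\<lambda>n x. LINT z|lborel. k z * evd n f (x - z)"])
       (use conv_DERIV[OF k] conv_L2(1)[OF k] in auto)
  then show ?thesis by (simp add: conv_def Hinf_inverse)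
qed

lemma norm_conv: "norm (conv k f) \<le> L1 k * norm f"
  by (rule norm_le_of_sq_integral) (auto simp: ev_conv conv_L2(2)[OF k] L1_nonneg)

lemma dx_conv: "dx (conv k f) = conv k (dx f)"
  using conv_DERIV[OF k] by (intro ev_dx_eqI) (simp add: ev_conv ev_conv[abs_def])

lemma dxn_conv: "(dx ^^ n) (conv k f) = conv k ((dx ^^ n) f)"
  by (induction n) (auto simp: dx_conv)

lemma ev_conv_integrable: "integrable lborel (\<lambda>z. k z * ev f (x - z))"
  using ev_bounded[of f] conv_integrable[OF k ev_measurable] by metis

lemma conv_scaleR: "conv k (c *\<^sub>R f) = c *\<^sub>R conv k f"
  by (rule hinf_eqI) (simp add: ev_conv mult.left_commute)

lemma conv_diff: "conv k (f - g) = conv k f - conv k g"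
  by (rule hinf_eqI) (simp add: ev_conv right_diff_distrib ev_conv_integrable)

lemma ev_conv_bound:
  assumes B: "\<And>x. \<bar>ev f x\<bar> \<le> B"
  shows "\<bar>ev (conv k f) x\<bar> \<le> L1 k * B"
proof -
  have "\<bar>ev (conv k f) x\<bar> \<le> (LINT z|lborel. \<bar>k z * ev f (x - z)\<bar>)"
    unfolding ev_conv by (rule integral_abs_bound)
  also have "\<dots> \<le> (LINT z|lborel. \<bar>k z\<bar> * B)"
    by (intro integral_mono integrable_abs ev_conv_integrable integrable_mult_left k)
       (auto simp: abs_mult B intro!: mult_left_mono)
  finally show ?thesis by (simp add: L1_def)
qed

end

text \<open>For \<open>h \<ge> 0\<close> the difference is the convolution of the derivative with
  the indicator of \<open>{-h..0}\<close>, whose mass is \<open>h\<close>. Negative \<open>h\<close>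
  reduces to this because translation is an isometry.\<close>

lemma norm_tr_diff: "norm (tr h f - f) \<le> \<bar>h\<bar> * norm (dx f)"
proof -
  have pos: "norm (tr h f - f) \<le> h * norm (dx f)" if "0 \<le> h" for h
  proof -
    have k: "integrable lborel (indicator {-h..0} :: real \<Rightarrow> real)" by (rule integrable_real_indicator) (auto simp: emeasure_lborel_Icc_eq)
    have "tr h f - f = conv (indicator {-h..0}) (dx f)"
    proof (rule hinf_eqI)
      fix x
      have "(LINT s|lborel. indicator {0..h} s *\<^sub>R ev (dx f) (x + s)) = ev f (x + h) - ev f (x + 0)"
      proof (rule integral_FTC_Icc[OF that])
        fix s
        have "((\<lambda>s. ev f (x + s)) has_real_derivative ev (dx f) (x + s) * (0 + 1)) (at s)"
          by (rule DERIV_chain2[OF ev_DERIV DERIV_add[OF DERIV_const DERIV_ident]])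
        then show "((\<lambda>s. ev f (x + s)) has_vector_derivative ev (dx f) (x + s)) (at s within {0..h})"
          by (simp add: has_real_derivative_iff_has_vector_derivative[symmetric] has_field_derivative_at_within)
      next
        show "continuous_on {0..h} (\<lambda>s. ev (dx f) (x + s))"
          by (intro continuous_at_imp_continuous_on ballI continuous_intros isCont_o2[OF _ ev_isCont])
      qed
      moreover have "(LINT s|lborel. indicator {0..h} s *\<^sub>R ev (dx f) (x + s)) = (LINT z|lborel. indicator {-h..0} z * ev (dx f) (x - z))"
        by (subst lborel_integral_real_affine[where c="-1" and t=0])
           (auto intro!: Bochner_Integration.integral_cong simp: indicator_def)
      ultimately show "ev (tr h f - f) x = ev (conv (indicator {-h..0}) (dx f)) x"
        by (simp add: ev_conv[OF k])
    qed
    moreover have "L1 (indicator {-h..0}) = h" using that by (simp add: L1_def)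
    ultimately show ?thesis using norm_conv[OF k, of "dx f"] by simp
  qed
  show ?thesis
  proof (cases "0 \<le> h")
    case False
    have "norm (tr h f - f) = norm (tr h (f - tr (-h) f))" by simp
    also have "\<dots> = norm (tr (-h) f - f)" unfolding norm_tr by (rule norm_minus_commute)
    finally show ?thesis using pos[of "-h"] False by simp
  qed (use pos in auto)
qed

text \<open>The Taylor remainder is the integral over \<open>{0..h}\<close> of first differences of
  the derivative, each bounded by \<open>norm_tr_diff\<close>; \<open>minkowski_kernel\<close> moves
  the norm inside. The sign \<open>\<sigma>\<close> handles forward and backward translations
  together.\<close>

lemma norm_tr_diff2:
  assumes h: "0 \<le> h" and s: "\<bar>\<sigma>\<bar> = 1"
  shows "norm (tr (\<sigma> * h) f - f - (\<sigma> * h) *\<^sub>R dx f) \<le> h\<^sup>2 * norm (dx (dx f))"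
proof (rule norm_le_of_sq_integral)
  let ?G = "\<lambda>z x. \<sigma> * (ev (dx f) (x + \<sigma> * z) - ev (dx f) x)"
  have k: "integrable lborel (indicator {0..h} :: real \<Rightarrow> real)" by (rule integrable_real_indicator) (auto simp: emeasure_lborel_Icc_eq)
  have G: "integrable lborel (\<lambda>x. (?G z x)\<^sup>2) \<and> (LINT x|lborel. (?G z x)\<^sup>2) \<le> (h * norm (dx (dx f)))\<^sup>2"
    if "indicator {0..h} z \<noteq> (0::real)" for z
  proof -
    have e: "?G z x = ev (\<sigma> *\<^sub>R (tr (\<sigma> * z) (dx f) - dx f)) x" for x by simp
    have "norm (\<sigma> *\<^sub>R (tr (\<sigma> * z) (dx f) - dx f)) \<le> \<bar>\<sigma> * z\<bar> * norm (dx (dx f))"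
      using norm_tr_diff[of "\<sigma> * z" "dx f"] s by simp
    also have "\<dots> \<le> h * norm (dx (dx f))"
      using that s by (intro mult_right_mono) (auto simp: abs_mult indicator_def split: if_splits)
    finally have "(norm (\<sigma> *\<^sub>R (tr (\<sigma> * z) (dx f) - dx f)))\<^sup>2 \<le> (h * norm (dx (dx f)))\<^sup>2"
      by (rule power_mono) simp
    then show ?thesis unfolding e norm_hinf_sq by (simp only: ev_sq_integrable simp_thms)
  qed
  have "ev (tr (\<sigma> * h) f - f - (\<sigma> * h) *\<^sub>R dx f) x = (LINT z|lborel. indicator {0..h} z * ?G z x)" for x
  proof -
    have "(LINT z|lborel. indicator {0..h} z *\<^sub>R ?G z x) = (ev f (x + \<sigma> * h) - \<sigma> * h * ev (dx f) x) - (ev f (x + \<sigma> * 0) - \<sigma> * 0 * ev (dx f) x)"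
    proof (rule integral_FTC_Icc[OF h])
      fix z
      have "((\<lambda>z. ev f (x + \<sigma> * z) - \<sigma> * z * ev (dx f) x) has_real_derivative ?G z x) (at z)"
        by (rule DERIV_cong[OF DERIV_diff[OF DERIV_chain2[OF ev_DERIV] DERIV_cmult_right[OF DERIV_cmult_Id]]])
           (auto intro!: derivative_eq_intros simp: algebra_simps)
      then show "((\<lambda>z. ev f (x + \<sigma> * z) - \<sigma> * z * ev (dx f) x) has_vector_derivative ?G z x) (at z within {0..h})"
        by (simp add: has_real_derivative_iff_has_vector_derivative[symmetric] has_field_derivative_at_within)
    next
      show "continuous_on {0..h} (\<lambda>z. ?G z x)"
        by (intro continuous_at_imp_continuous_on ballI continuous_intros isCont_o2[OF _ ev_isCont])
    qed
    then show ?thesis by simp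
  qed
  then have "(LINT x|lborel. (ev (tr (\<sigma> * h) f - f - (\<sigma> * h) *\<^sub>R dx f) x)\<^sup>2) \<le> (LINT z|lborel. \<bar>indicator {0..h} z\<bar>)\<^sup>2 * (h * norm (dx (dx f)))\<^sup>2"
    using minkowski_kernel(2)[OF k _ G] by simp
  also have "(LINT z|lborel. \<bar>indicator {0..h} z :: real\<bar>) = h" using h by simp
  finally show "(LINT x|lborel. (ev (tr (\<sigma> * h) f - f - (\<sigma> * h) *\<^sub>R dx f) x)\<^sup>2) \<le> (h\<^sup>2 * norm (dx (dx f)))\<^sup>2"
    by (simp add: power_mult_distrib power2_eq_square mult_ac)
qed simp

lemma ev_tr_diff_bound:
  assumes "\<And>x. \<bar>ev (dx f) x\<bar> \<le> M" "0 \<le> h"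
  shows "\<bar>ev (tr h f - tr (-h) f) x\<bar> \<le> 2 * h * M"
  using field_differentiable_bound[of UNIV "ev f" "ev (dx f)" M "x + h" "x - h"] ev_DERIV assms by (auto simp: mult_ac)

lemma norm_tr_diff_sym:
  assumes "0 \<le> h"
  shows "norm (tr h f - tr (-h) f) \<le> 2 * h * norm (dx f)"
proof -
  have "norm (tr h f - tr (-h) f) = norm ((tr h f - f) - (tr (-h) f - f))" by simp
  also have "\<dots> \<le> norm (tr h f - f) + norm (tr (-h) f - f)" by (rule norm_triangle_ineq4)
  also have "\<dots> \<le> h * norm (dx f) + h * norm (dx f)"
    using norm_tr_diff[of h f] norm_tr_diff[of "-h" f] assms by (intro add_mono) auto
  finally show ?thesis by simp
qed

section \<open>The transport step, product estimates and completeness\<close>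

lemma convex_combination_sq:
  fixes p a b :: real
  assumes "\<bar>p\<bar> \<le> 1/2"
  shows "((1/2 - p) * a + (1/2 + p) * b)\<^sup>2 \<le> (1/2 - p) * a\<^sup>2 + (1/2 + p) * b\<^sup>2"
proof -
  have "(1/2 - p) * a\<^sup>2 + (1/2 + p) * b\<^sup>2 - ((1/2 - p) * a + (1/2 + p) * b)\<^sup>2 = (1/2 - p) * (1/2 + p) * (a - b)\<^sup>2"
    by (simp add: power2_eq_square field_simps)
  moreover have "0 \<le> (1/2 - p) * (1/2 + p) * (a - b)\<^sup>2" using assms by (intro mult_nonneg_nonneg) auto
  ultimately show ?thesis by linarith
qed

lemma convex_combination_abs:
  fixes p a b :: real
  assumes "\<bar>p\<bar> \<le> 1/2" "\<bar>a\<bar> \<le> B" "\<bar>b\<bar> \<le> B"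
  shows "\<bar>(1/2 - p) * a + (1/2 + p) * b\<bar> \<le> B"
proof -
  have "\<bar>(1/2 - p) * a + (1/2 + p) * b\<bar> \<le> (1/2 - p) * \<bar>a\<bar> + (1/2 + p) * \<bar>b\<bar>"
    using abs_triangle_ineq[of "(1/2 - p) * a" "(1/2 + p) * b"] assms(1) by (simp add: abs_mult)
  also have "\<dots> \<le> (1/2 - p) * B + (1/2 + p) * B"
    using assms by (intro add_mono mult_left_mono) auto
  finally show ?thesis by (simp add: algebra_simps)
qed

text \<open>The transport part of the Lax--Friedrichs scheme: for \<open>a \<bar>u\<bar> \<le> 1/2\<close> it is pointwise a convex
  combination of translates of \<open>v\<close>.\<close>

definition transport :: "real \<Rightarrow> real \<Rightarrow> hinf \<Rightarrow> hinf \<Rightarrow> hinf" where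
  "transport a h u v = (1/2) *\<^sub>R (tr h v + tr (-h) v) - a *\<^sub>R (u * (tr h v - tr (-h) v))"

lemma ev_transport: "ev (transport a h u v) x = (1/2 - a * ev u x) * ev v (x + h) + (1/2 + a * ev u x) * ev v (x - h)"
  by (simp add: transport_def algebra_simps)

lemma ev_transport_bound:
  assumes "\<And>x. \<bar>a * ev u x\<bar> \<le> 1/2" "\<And>x. \<bar>ev v x\<bar> \<le> B"
  shows "\<bar>ev (transport a h u v) x\<bar> \<le> B"
  unfolding ev_transport using assms by (intro convex_combination_abs) auto

text \<open>By convexity the square is at most the same convex combination of squares of translates.
  Shifting the variable moves the translations onto the coefficients, whose sum becomes
  \<open>1 + a * (ev u (x + h) - ev u (x - h))\<close>. Hence the growth depends on \<open>u\<close>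
  only through a bound for its derivative.\<close>

lemma norm_transport:
  assumes u: "\<And>x. \<bar>a * ev u x\<bar> \<le> 1/2" and M: "\<And>x. \<bar>ev (dx u) x\<bar> \<le> M" and a: "0 \<le> a" and h: "0 \<le> h"
  shows "norm (transport a h u v) \<le> (1 + 2 * a * h * M) * norm v"
proof (rule norm_le_of_sq_integral)
  have M0: "0 \<le> M" using M[of 0] by linarith
  then show B0: "0 \<le> (1 + 2 * a * h * M) * norm v" using a h by simp
  have i: "integrable lborel (\<lambda>x. (1/2 + b * ev u (x + c)) * (ev v (x + d))\<^sup>2)" for b c d
  proof -
    obtain B where B: "\<And>x. \<bar>ev u x\<bar> \<le> B" using ev_bounded by blast
    have 1: "integrable lborel (\<lambda>x. (1/2 + \<bar>b\<bar> * B) * (ev v (x + d))\<^sup>2)"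
      using ev_sq_integrable[of "tr d v"] by (intro integrable_mult_right) simp
    have "\<bar>1/2 + b * ev u y\<bar> \<le> 1/2 + \<bar>b\<bar> * B" for y
      using abs_triangle_ineq[of "1/2" "b * ev u y"] mult_left_mono[OF B[of y], of "\<bar>b\<bar>"] by (simp add: abs_mult)
    then have "\<bar>1/2 + b * ev u y\<bar> * (ev v z)\<^sup>2 \<le> (1/2 + \<bar>b\<bar> * B) * (ev v z)\<^sup>2" for y z
      by (intro mult_right_mono) auto
    then have "AE x in lborel. norm ((1/2 + b * ev u (x + c)) * (ev v (x + d))\<^sup>2) \<le> norm ((1/2 + \<bar>b\<bar> * B) * (ev v (x + d))\<^sup>2)"
      by (intro AE_I2) (simp add: abs_mult, meson abs_ge_self abs_ge_zero mult_right_mono order_trans zero_le_power2)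
    then show ?thesis by (rule Bochner_Integration.integrable_bound[OF 1, rotated]) measurable
  qed
  have s1: "(LINT x|lborel. (1/2 + (- a) * ev u (x + 0)) * (ev v (x + h))\<^sup>2) = (LINT x|lborel. (1/2 + (- a) * ev u (x + (- h))) * (ev v (x + 0))\<^sup>2)"
    by (subst lborel_integral_real_affine[where c=1 and t="-h"]) (auto simp: add.commute)
  have s2: "(LINT x|lborel. (1/2 + a * ev u (x + 0)) * (ev v (x + (- h)))\<^sup>2) = (LINT x|lborel. (1/2 + a * ev u (x + h)) * (ev v (x + 0))\<^sup>2)"
    by (subst lborel_integral_real_affine[where c=1 and t="h"]) (auto simp: add.commute)
  have "(LINT x|lborel. (ev (transport a h u v) x)\<^sup>2)
      \<le> (LINT x|lborel. (1/2 + (- a) * ev u (x + 0)) * (ev v (x + h))\<^sup>2 + (1/2 + a * ev u (x + 0)) * (ev v (x + (- h)))\<^sup>2)"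
    using convex_combination_sq[OF u]
    by (intro integral_mono ev_sq_integrable Bochner_Integration.integrable_add i) (simp add: ev_transport)
  also have "\<dots> = (LINT x|lborel. (1/2 + (- a) * ev u (x + (- h))) * (ev v (x + 0))\<^sup>2 + (1/2 + a * ev u (x + h)) * (ev v (x + 0))\<^sup>2)"
    by (subst (1 2) Bochner_Integration.integral_add[OF i i]) (simp only: s1 s2)
  also have "\<dots> \<le> (LINT x|lborel. (1 + 2 * a * h * M) * (ev v x)\<^sup>2)"
  proof (intro integral_mono Bochner_Integration.integrable_add i integrable_mult_right ev_sq_integrable)
    fix x
    have "a * (ev u (x + h) - ev u (x - h)) \<le> a * (2 * h * M)"
      using ev_tr_diff_bound[OF M h, of x] a by (intro mult_left_mono) auto
    then have "((1/2 + (- a) * ev u (x + (- h))) + (1/2 + a * ev u (x + h))) * (ev v x)\<^sup>2 \<le> (1 + 2 * a * h * M) * (ev v x)\<^sup>2"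
      by (intro mult_right_mono) (auto simp: algebra_simps)
    then show "(1/2 + (- a) * ev u (x + (- h))) * (ev v (x + 0))\<^sup>2 + (1/2 + a * ev u (x + h)) * (ev v (x + 0))\<^sup>2 \<le> (1 + 2 * a * h * M) * (ev v x)\<^sup>2"
      by (simp add: algebra_simps)
  qed
  also have "\<dots> = (1 + 2 * a * h * M) * (norm v)\<^sup>2" by (simp add: norm_hinf_sq)
  \<comment> \<open>The square root of \<open>1 + 2 * a * h * M\<close> would be the exact factor; a
    number that is at least 1 lies below its square, so the simpler factor does.\<close>
  also have "\<dots> \<le> ((1 + 2 * a * h * M) * norm v)\<^sup>2"
  proof -
    have "1 \<le> 1 + 2 * a * h * M" using a h M0 by simp
    then show ?thesis
      unfolding power_mult_distrib by (intro mult_right_mono self_le_power) auto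
  qed
  finally show "(LINT x|lborel. (ev (transport a h u v) x)\<^sup>2) \<le> ((1 + 2 * a * h * M) * norm v)\<^sup>2" .
qed

text \<open>The first factor is controlled to one order more than the second, because it is
  estimated in the sup norm, which costs one derivative by \<open>ev_le_norm\<close>.\<close>

lemma norm_dxn_mult:
  assumes "\<And>j. j \<le> Suc k \<Longrightarrow> norm ((dx ^^ j) f) \<le> A" "\<And>j. j \<le> k \<Longrightarrow> norm ((dx ^^ j) g) \<le> B"
  shows "norm ((dx ^^ k) (f * g)) \<le> 2 ^ k * (4 * A * B)"
  using assms
proof (induction k arbitrary: f g)
  case 0
  have "norm (f * g) \<le> 2 * (norm f + norm (dx f)) * norm g" by (rule norm_mult_le)
  also have "\<dots> \<le> 2 * (A + A) * B"
    using "0.prems"(1)[of 0] "0.prems"(1)[of 1] "0.prems"(2)[of 0] order_trans[OF norm_ge_zero, of f A]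
    by (intro mult_mono add_mono) auto
  finally show ?case by simp
next
  case (Suc k)
  have "(dx ^^ Suc k) (f * g) = (dx ^^ k) (dx f * g) + (dx ^^ k) (f * dx g)"
    by (simp only: dxn_dx[symmetric] dx_mult dxn_add)
  also have "norm \<dots> \<le> 2 ^ k * (4 * A * B) + 2 ^ k * (4 * A * B)"
  proof (intro order_trans[OF norm_triangle_ineq] add_mono Suc.IH)
    fix j
    show "j \<le> Suc k \<Longrightarrow> norm ((dx ^^ j) (dx f)) \<le> A" using Suc.prems(1)[of "Suc j"] by (simp only: dxn_dx)
    show "j \<le> k \<Longrightarrow> norm ((dx ^^ j) (dx g)) \<le> B" using Suc.prems(2)[of "Suc j"] by (simp only: dxn_dx)
  qed (use Suc.prems in auto)
  finally show ?case by (simp add: mult_ac)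
qed

lemma ev_uniform_Cauchy:
  fixes X :: "nat \<Rightarrow> hinf"
  assumes "Cauchy X" "Cauchy (\<lambda>n. dx (X n))" "0 < e"
  shows "\<exists>N. \<forall>m\<ge>N. \<forall>n\<ge>N. \<forall>x. \<bar>ev (X m) x - ev (X n) x\<bar> < e"
proof -
  obtain N1 where N1: "\<And>m n. m \<ge> N1 \<Longrightarrow> n \<ge> N1 \<Longrightarrow> norm (X m - X n) < e / 4"
    using CauchyD[OF assms(1), of "e / 4"] assms(3) by auto
  obtain N2 where N2: "\<And>m n. m \<ge> N2 \<Longrightarrow> n \<ge> N2 \<Longrightarrow> norm (dx (X m) - dx (X n)) < e / 4"
    using CauchyD[OF assms(2), of "e / 4"] assms(3) by auto
  show ?thesis
  proof (intro exI[of _ "max N1 N2"] allI impI)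
    fix m n x assume mn: "m \<ge> max N1 N2" "n \<ge> max N1 N2"
    have "\<bar>ev (X m - X n) x\<bar> \<le> 2 * (norm (X m - X n) + norm (dx (X m - X n)))" by (rule ev_le_norm)
    also have "\<dots> < e" using N1[of m n] N2[of m n] mn by simp
    finally show "\<bar>ev (X m) x - ev (X n) x\<bar> < e" by simp
  qed
qed

text \<open>By the Sobolev embedding all derivatives converge uniformly, so the limits
  \<open>G k\<close> form a chain of derivatives. Fatou's lemma then supplies square integrability
  and convergence in norm.\<close>

theorem hinf_complete:
  fixes X :: "nat \<Rightarrow> hinf"
  assumes C: "\<And>k. Cauchy (\<lambda>n. (dx ^^ k) (X n))"
  obtains L where "\<And>k. (\<lambda>n. (dx ^^ k) (X n)) \<longlonglongrightarrow> (dx ^^ k) L"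
proof -
  let ?f = "\<lambda>k n. evd k (X n)"
  have unif: "\<exists>N. \<forall>m\<ge>N. \<forall>n\<ge>N. \<forall>x. \<bar>?f k m x - ?f k n x\<bar> < e" if "0 < e" for k e
    using ev_uniform_Cauchy[OF C[of k] _ that] C[of "Suc k"] by simp
  define G where "G k x = lim (\<lambda>n. ?f k n x)" for k x
  have G: "(\<lambda>n. ?f k n x) \<longlonglongrightarrow> G k x" for k x
  proof -
    have "Cauchy (\<lambda>n. ?f k n x)"
      unfolding Cauchy_def dist_real_def using unif[of _ k] by meson
    then show ?thesis unfolding G_def by (simp add: Cauchy_convergent_iff convergent_LIMSEQ_iff)
  qed
  have Gunif: "\<exists>N. \<forall>n\<ge>N. \<forall>x. \<bar>?f k n x - G k x\<bar> \<le> e" if "0 < e" for k e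
  proof -
    obtain N where N: "\<And>m n x. m \<ge> N \<Longrightarrow> n \<ge> N \<Longrightarrow> \<bar>?f k m x - ?f k n x\<bar> < e" using unif[OF \<open>0 < e\<close>] by blast
    have "\<bar>?f k n x - G k x\<bar> \<le> e" if "n \<ge> N" for n x
    proof (rule tendsto_upperbound)
      show "(\<lambda>m. \<bar>?f k n x - ?f k m x\<bar>) \<longlonglongrightarrow> \<bar>?f k n x - G k x\<bar>" by (intro tendsto_intros G)
      show "eventually (\<lambda>m. \<bar>?f k n x - ?f k m x\<bar> \<le> e) sequentially"
        using N that by (intro eventually_sequentiallyI[of N]) (auto intro: less_imp_le)
    qed simp
    then show ?thesis by blast
  qed
  have GD: "(G k has_real_derivative G (Suc k) x) (at x)" for k x
  proof -
    have "\<exists>g. \<forall>x\<in>UNIV. (\<lambda>n. ?f k n x) \<longlonglongrightarrow> g x \<and> (g has_derivative (\<lambda>h. G (Suc k) x * h)) (at x within UNIV)"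
    proof (rule has_derivative_sequence)
      show "(?f k n has_derivative (\<lambda>h. ?f (Suc k) n x * h)) (at x within UNIV)" for n x
        using evd_DERIV[of k "X n" x] by (simp add: has_field_derivative_def)
      show "eventually (\<lambda>n. \<forall>x\<in>UNIV. \<forall>h. norm (?f (Suc k) n x * h - G (Suc k) x * h) \<le> e * norm h) sequentially" if "0 < e" for e
      proof -
        obtain N where "\<And>n x. n \<ge> N \<Longrightarrow> \<bar>?f (Suc k) n x - G (Suc k) x\<bar> \<le> e" using Gunif[OF \<open>0 < e\<close>] by blast
        then show ?thesis
          by (intro eventually_sequentiallyI[of N]) (auto simp: abs_mult simp flip: left_diff_distrib intro!: mult_right_mono)
      qed
    qed (use G[of k 0] in auto)
    then obtain g where g: "\<And>x. (\<lambda>n. ?f k n x) \<longlonglongrightarrow> g x" "\<And>x. (g has_derivative (\<lambda>h. G (Suc k) x * h)) (at x)" by auto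
    have "g = G k" using LIMSEQ_unique[OF g(1) G] by blast
    then show ?thesis using g(2)[of x] by (simp add: has_field_derivative_def)
  qed
  have [measurable]: "G k \<in> borel_measurable borel" for k
    using GD DERIV_isCont by (intro borel_measurable_continuous_onI) (blast intro: continuous_at_imp_continuous_on)
  \<comment> \<open>Used twice: with \<open>Y = 0\<close> to see that \<open>G k\<close> is square
    integrable, and with \<open>Y = X n\<close> to get convergence.\<close>
  have fatou: "(\<integral>\<^sup>+ x. ennreal ((evd k Y x - G k x)\<^sup>2) \<partial>lborel) \<le> ennreal (e\<^sup>2)"
    if "0 \<le> e" "\<And>n. n \<ge> N \<Longrightarrow> norm ((dx ^^ k) (Y - X n)) \<le> e" for k Y e N
  proof -
    have "(\<integral>\<^sup>+ x. ennreal ((evd k Y x - G k x)\<^sup>2) \<partial>lborel) = (\<integral>\<^sup>+ x. liminf (\<lambda>n. ennreal ((evd k Y x - ?f k n x)\<^sup>2)) \<partial>lborel)"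
    proof (intro nn_integral_cong lim_imp_Liminf[symmetric])
      fix x show "(\<lambda>n. ennreal ((evd k Y x - ?f k n x)\<^sup>2)) \<longlonglongrightarrow> ennreal ((evd k Y x - G k x)\<^sup>2)"
        by (intro tendsto_intros G)
    qed auto
    also have "\<dots> \<le> liminf (\<lambda>n. \<integral>\<^sup>+ x. ennreal ((evd k Y x - ?f k n x)\<^sup>2) \<partial>lborel)"
      by (intro nn_integral_liminf) auto
    also have "\<dots> \<le> ennreal (e\<^sup>2)"
    proof (rule Liminf_le)
      show "eventually (\<lambda>n. (\<integral>\<^sup>+ x. ennreal ((evd k Y x - ?f k n x)\<^sup>2) \<partial>lborel) \<le> ennreal (e\<^sup>2)) sequentially"
      proof (rule eventually_sequentiallyI[of N])
        fix n assume "N \<le> n"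
        have "(\<integral>\<^sup>+ x. ennreal ((evd k Y x - ?f k n x)\<^sup>2) \<partial>lborel) = ennreal ((norm ((dx ^^ k) (Y - X n)))\<^sup>2)"
          using ev_sq_integrable[of "(dx ^^ k) (Y - X n)"]
          by (subst nn_integral_eq_integral) (auto simp: norm_hinf_sq dxn_diff)
        also have "\<dots> \<le> ennreal (e\<^sup>2)" using that(2)[OF \<open>N \<le> n\<close>] by (intro ennreal_leI power_mono) auto
        finally show "(\<integral>\<^sup>+ x. ennreal ((evd k Y x - ?f k n x)\<^sup>2) \<partial>lborel) \<le> ennreal (e\<^sup>2)" .
      qed
    qed simp
    finally show ?thesis .
  qed
  have Gsq: "integrable lborel (\<lambda>x. (G k x)\<^sup>2)" for k
  proof -
    obtain B where B: "\<And>n. norm ((dx ^^ k) (X n)) \<le> B"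
      using Cauchy_Bseq[OF C[of k]] by (auto simp: Bseq_def)
    then have "norm ((dx ^^ k) (0 - X n)) \<le> B" for n by (simp add: dxn_diff dxn_minus)
    then have "(\<integral>\<^sup>+ x. ennreal ((evd k 0 x - G k x)\<^sup>2) \<partial>lborel) \<le> ennreal (B\<^sup>2)"
      by (intro fatou[of B 0]) (use order_trans[OF norm_ge_zero B[of 0]] in auto)
    then show ?thesis unfolding integrable_iff_bounded by (auto simp: le_less_trans)
  qed
  note L = Hinf_by_derivs[where F=G, OF GD Gsq]
  define L where "L = Hinf (G 0)"
  have "(\<lambda>n. (dx ^^ k) (X n)) \<longlonglongrightarrow> (dx ^^ k) L" for k
  proof (rule LIMSEQ_I)
    fix r :: real assume "0 < r"
    then obtain N where N: "\<And>m n. m \<ge> N \<Longrightarrow> n \<ge> N \<Longrightarrow> norm ((dx ^^ k) (X m) - (dx ^^ k) (X n)) < r / 2"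
      using CauchyD[OF C[of k], of "r / 2"] by auto
    have "norm ((dx ^^ k) (X n) - (dx ^^ k) L) < r" if "n \<ge> N" for n
    proof -
      have "(\<integral>\<^sup>+ x. ennreal ((evd k (X n) x - G k x)\<^sup>2) \<partial>lborel) \<le> ennreal ((r / 2)\<^sup>2)"
        using N[OF that] \<open>0 < r\<close> by (intro fatou[of _ N]) (auto simp: dxn_diff intro: less_imp_le)
      moreover have "evd k (X n) x - G k x = ev ((dx ^^ k) (X n) - (dx ^^ k) L) x" for x
        by (simp add: L_def L(2))
      ultimately have "ennreal ((norm ((dx ^^ k) (X n) - (dx ^^ k) L))\<^sup>2) \<le> ennreal ((r / 2)\<^sup>2)"
        unfolding norm_hinf_sq by (subst nn_integral_eq_integral[OF ev_sq_integrable, symmetric]) auto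
      then have "norm ((dx ^^ k) (X n) - (dx ^^ k) L) \<le> r / 2"
        using \<open>0 < r\<close> by (simp add: ennreal_le_iff power2_le_iff_abs_le)
      then show ?thesis using \<open>0 < r\<close> by linarith
    qed
    then show "\<exists>no. \<forall>n\<ge>no. norm ((dx ^^ k) (X n) - (dx ^^ k) L) < r" by blast
  qed
  then show ?thesis by (rule that)
qed

subsection \<open>Local existence by the Lax--Friedrichs scheme\<close>

text \<open>The equation is \<open>u\<^sub>t = vf K' u\<close>.\<close>

definition vf :: "(real \<Rightarrow> real) \<Rightarrow> hinf \<Rightarrow> hinf" where
  "vf k u = - (u * dx u) - conv k u"

lemma one_plus_power_le_exp:
  fixes C \<tau> :: real
  assumes "0 \<le> C" "0 \<le> \<tau>"
  shows "(1 + C * \<tau>) ^ n \<le> exp (C * (real n * \<tau>))"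
proof -
  have "(1 + C * \<tau>) ^ n \<le> exp (C * \<tau>) ^ n" using assms by (intro power_mono) auto
  also have "\<dots> = exp (C * (real n * \<tau>))" by (simp add: exp_of_nat_mult[symmetric] mult_ac)
  finally show ?thesis .
qed

lemma sum_choose_bound:
  fixes g :: "nat \<Rightarrow> hinf"
  assumes "\<And>j. 1 \<le> j \<Longrightarrow> j \<le> k \<Longrightarrow> norm (g j) \<le> B" "0 \<le> B"
  shows "norm (\<Sum>j=1..k. real (k choose j) *\<^sub>R g j) \<le> 2 ^ k * B"
proof -
  have "norm (\<Sum>j=1..k. real (k choose j) *\<^sub>R g j) \<le> (\<Sum>j=1..k. real (k choose j) * B)"
    by (rule order_trans[OF norm_sum sum_mono]) (use assms in \<open>auto intro!: mult_left_mono\<close>)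
  also have "\<dots> \<le> (\<Sum>j\<le>k. real (k choose j) * B)" using assms(2) by (intro sum_mono2) auto
  also have "\<dots> = 2 ^ k * B"
    by (simp add: sum_distrib_right[symmetric] choose_row_sum flip: of_nat_sum)
  finally show ?thesis .
qed

text \<open>The space step is \<open>c \<tau>\<close> for a time step \<open>\<tau>\<close>. The bound \<open>c\<close> on \<open>\<bar>u\<bar>\<close> is the Courant condition, and \<open>\<delta>\<close> is so small
  that the bound \<open>M\<close> on \<open>\<bar>u\<^sub>x\<bar>\<close> at most doubles up to time \<open>\<delta>\<close>.\<close>

locale lax_friedrichs =
  fixes k :: "real \<Rightarrow> real" and u1 :: hinf and c M \<delta> :: real
  assumes k: "integrable lborel k" and c: "0 < c" and M: "0 < M" and \<delta>: "0 < \<delta>"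
    and u1: "\<And>x. \<bar>ev u1 x\<bar> \<le> c * exp (- (L1 k * \<delta>))"
    and u1': "\<And>x. \<bar>ev (dx u1) x\<bar> \<le> M"
    and \<delta>M: "exp ((2 * M + L1 k) * \<delta>) \<le> 2"
begin

abbreviation \<kappa> where "\<kappa> \<equiv> L1 k"
abbreviation \<Delta> where "\<Delta> \<tau> f \<equiv> tr (c * \<tau>) f - tr (- (c * \<tau>)) f"

text \<open>With space step \<open>c * \<tau>\<close> the central difference carries the weight
  \<open>\<tau> / (2 * (c * \<tau>)) = 1 / (2 * c)\<close>, the same for all time steps. Thus
  convexity of the transport part means just \<open>\<bar>u\<bar> \<le> c\<close>.\<close>

definition step :: "real \<Rightarrow> hinf \<Rightarrow> hinf" where
  "step \<tau> u = transport (1 / (2 * c)) (c * \<tau>) u u - \<tau> *\<^sub>R conv k u"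

definition X :: "real \<Rightarrow> nat \<Rightarrow> hinf" where "X \<tau> n = (step \<tau> ^^ n) u1"

definition good :: "hinf \<Rightarrow> bool" where
  "good u \<longleftrightarrow> (\<forall>x. \<bar>ev u x\<bar> \<le> c) \<and> (\<forall>x. \<bar>ev (dx u) x\<bar> \<le> 2 * M)"

definition adm :: "real \<Rightarrow> nat \<Rightarrow> bool" where "adm \<tau> n \<longleftrightarrow> 0 < \<tau> \<and> real n * \<tau> \<le> \<delta>"

section \<open>Bounds for the scheme, uniform in the time step\<close>

lemma \<kappa>0: "0 \<le> \<kappa>" by (rule L1_nonneg)

lemma X_0 [simp]: "X \<tau> 0 = u1" and X_Suc [simp]: "X \<tau> (Suc n) = step \<tau> (X \<tau> n)"
  by (simp_all add: X_def)

lemma adm_mono: "adm \<tau> n \<Longrightarrow> m \<le> n \<Longrightarrow> adm \<tau> m"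
  unfolding adm_def by (meson mult_right_mono of_nat_mono order_trans less_imp_le)

lemma courant: "(\<And>x. \<bar>ev u x\<bar> \<le> c) \<Longrightarrow> \<bar>1 / (2 * c) * ev u x\<bar> \<le> 1 / 2"
  using c by (simp add: abs_mult field_simps)

text \<open>In Leibniz' rule the term \<open>j = 0\<close> joins the average to form the same
  transport, now acting on the n-th derivative, so \<open>norm_transport\<close> applies at every
  order; the other terms are perturbations of size \<tau>.\<close>

lemma dxn_step:
  "(dx ^^ n) (step \<tau> u) = transport (1 / (2 * c)) (c * \<tau>) u ((dx ^^ n) u)
     - (1 / (2 * c)) *\<^sub>R (\<Sum>j=1..n. real (n choose j) *\<^sub>R ((dx ^^ j) u * \<Delta> \<tau> ((dx ^^ (n - j)) u)))
     - \<tau> *\<^sub>R conv k ((dx ^^ n) u)"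
proof -
  have "(dx ^^ n) (u * \<Delta> \<tau> u) = (\<Sum>j\<le>n. real (n choose j) *\<^sub>R ((dx ^^ j) u * \<Delta> \<tau> ((dx ^^ (n - j)) u)))"
    by (simp add: dxn_mult dxn_diff)
  also have "\<dots> = u * \<Delta> \<tau> ((dx ^^ n) u) + (\<Sum>j=1..n. real (n choose j) *\<^sub>R ((dx ^^ j) u * \<Delta> \<tau> ((dx ^^ (n - j)) u)))"
    unfolding atMost_atLeast0 by (subst sum.atLeast_Suc_atMost) auto
  finally have *: "(dx ^^ n) (u * \<Delta> \<tau> u) = u * \<Delta> \<tau> ((dx ^^ n) u) + (\<Sum>j=1..n. real (n choose j) *\<^sub>R ((dx ^^ j) u * \<Delta> \<tau> ((dx ^^ (n - j)) u)))" .
  show ?thesis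
    unfolding step_def transport_def dxn_diff dxn_add dxn_scaleR dxn_conv[OF k] dxn_tr *
    by (simp add: scaleR_add_right)
qed

lemma step_sup:
  assumes "\<And>x. \<bar>ev u x\<bar> \<le> B" "B \<le> c" "0 \<le> \<tau>"
  shows "\<bar>ev (step \<tau> u) x\<bar> \<le> (1 + \<kappa> * \<tau>) * B"
proof -
  have 1: "\<bar>ev u x\<bar> \<le> c" for x using assms(1,2) order_trans by blast
  have "\<bar>ev (step \<tau> u) x\<bar> \<le> \<bar>ev (transport (1 / (2 * c)) (c * \<tau>) u u) x\<bar> + \<bar>\<tau> * ev (conv k u) x\<bar>"
    unfolding step_def ev_diff ev_scaleR by (rule abs_triangle_ineq4)
  also have "\<dots> \<le> B + \<tau> * (\<kappa> * B)"
    using ev_transport_bound[OF courant[OF 1] assms(1), of "c * \<tau>" x] ev_conv_bound[OF k assms(1), of x] assms(3)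
    by (intro add_mono) (auto simp: abs_mult intro!: mult_left_mono)
  finally show ?thesis by (simp add: algebra_simps)
qed

text \<open>The quadratic term \<open>u\<^sub>x\<^sup>2\<close> contributes at most
  \<open>\<tau> * m * m\<close>; the a priori bound \<open>m \<le> 2 * M\<close> makes this linear
  in \<open>m\<close>, with growth rate \<open>2 * M\<close>.\<close>

lemma step_sup_dx:
  assumes "\<And>x. \<bar>ev u x\<bar> \<le> c" "\<And>x. \<bar>ev (dx u) x\<bar> \<le> m" "m \<le> 2 * M" "0 \<le> \<tau>"
  shows "\<bar>ev (dx (step \<tau> u)) x\<bar> \<le> (1 + (2 * M + \<kappa>) * \<tau>) * m"
proof -
  have m0: "0 \<le> m" using assms(2)[of x] by linarith
  have D: "\<bar>ev (\<Delta> \<tau> u) x\<bar> \<le> 2 * (c * \<tau>) * m"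
    using ev_tr_diff_bound[OF assms(2), of "c * \<tau>" x] assms(4) c by simp
  have e: "dx (step \<tau> u) = transport (1 / (2 * c)) (c * \<tau>) u (dx u) - (1 / (2 * c)) *\<^sub>R (dx u * \<Delta> \<tau> u) - \<tau> *\<^sub>R conv k (dx u)"
    using dxn_step[of 1 \<tau> u] by simp
  have "\<bar>ev (dx (step \<tau> u)) x\<bar> \<le> \<bar>ev (transport (1 / (2 * c)) (c * \<tau>) u (dx u)) x\<bar>
      + \<bar>1 / (2 * c) * (ev (dx u) x * ev (\<Delta> \<tau> u) x)\<bar> + \<bar>\<tau> * ev (conv k (dx u)) x\<bar>"
    unfolding e ev_diff[of _ "\<tau> *\<^sub>R _"] ev_diff[of "transport _ _ _ _"] ev_scaleR ev_mult by linarith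
  also have "\<bar>ev (transport (1 / (2 * c)) (c * \<tau>) u (dx u)) x\<bar> \<le> m"
    by (rule ev_transport_bound[OF courant[OF assms(1)] assms(2)])
  also have "\<bar>1 / (2 * c) * (ev (dx u) x * ev (\<Delta> \<tau> u) x)\<bar> \<le> 1 / (2 * c) * (m * (2 * (c * \<tau>) * m))"
    unfolding abs_mult using c m0 by (intro mult_mono D assms(2)) auto
  also have "\<bar>\<tau> * ev (conv k (dx u)) x\<bar> \<le> \<tau> * (\<kappa> * m)"
    unfolding abs_mult using assms(4) by (intro mult_mono ev_conv_bound[OF k assms(2)]) auto
  also have "1 / (2 * c) * (m * (2 * (c * \<tau>) * m)) = \<tau> * m * m" using c by (simp add: field_simps)
  also have "\<dots> \<le> \<tau> * m * (2 * M)" using assms(3,4) m0 by (intro mult_left_mono) auto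
  finally show ?thesis by (simp add: algebra_simps)
qed

text \<open>A bootstrap: each step estimate needs the bounds \<open>c\<close> and
  \<open>2 * M\<close> at the current time, and these follow from the growth so far. The factor
  \<open>exp (- (\<kappa> * \<delta>))\<close> in the hypothesis on \<open>u1\<close> leaves room
  for the growth of \<bar>u\<bar>, and the doubling of the derivative bound is paid for by the
  choice of \<open>\<delta>\<close>.\<close>

lemma traj_good: "adm \<tau> n \<Longrightarrow> good (X \<tau> n)"
proof -
  let ?P = "\<lambda>n. (\<forall>x. \<bar>ev (X \<tau> n) x\<bar> \<le> c * exp (- (\<kappa> * \<delta>)) * (1 + \<kappa> * \<tau>) ^ n)
     \<and> (\<forall>x. \<bar>ev (dx (X \<tau> n)) x\<bar> \<le> M * (1 + (2 * M + \<kappa>) * \<tau>) ^ n)"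
  have good: "c * exp (- (\<kappa> * \<delta>)) * (1 + \<kappa> * \<tau>) ^ n \<le> c \<and> M * (1 + (2 * M + \<kappa>) * \<tau>) ^ n \<le> 2 * M"
    if "adm \<tau> n" for n
  proof
    have \<tau>: "0 \<le> \<tau>" "real n * \<tau> \<le> \<delta>" using that by (auto simp: adm_def)
    have "(1 + \<kappa> * \<tau>) ^ n \<le> exp (\<kappa> * \<delta>)"
      by (rule order_trans[OF one_plus_power_le_exp[OF \<kappa>0 \<tau>(1)]]) (use \<tau>(2) \<kappa>0 in \<open>auto intro!: mult_left_mono\<close>)
    then have "c * exp (- (\<kappa> * \<delta>)) * (1 + \<kappa> * \<tau>) ^ n \<le> c * exp (- (\<kappa> * \<delta>)) * exp (\<kappa> * \<delta>)"
      using c by (intro mult_left_mono) auto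
    then show "c * exp (- (\<kappa> * \<delta>)) * (1 + \<kappa> * \<tau>) ^ n \<le> c" by (simp add: mult.assoc flip: exp_add)
    have "(1 + (2 * M + \<kappa>) * \<tau>) ^ n \<le> exp ((2 * M + \<kappa>) * (real n * \<tau>))"
      using M \<kappa>0 \<tau> by (intro one_plus_power_le_exp) auto
    also have "\<dots> \<le> exp ((2 * M + \<kappa>) * \<delta>)" using M \<kappa>0 \<tau> by (auto intro!: mult_left_mono)
    finally show "M * (1 + (2 * M + \<kappa>) * \<tau>) ^ n \<le> 2 * M" using \<delta>M M by (subst mult.commute) (intro mult_right_mono, auto)
  qed
  have P: "adm \<tau> n \<Longrightarrow> ?P n" for n
  proof (induction n)
    case 0
    then show ?case using u1 u1' by simp
  next
    case (Suc n)
    have a: "adm \<tau> n" and \<tau>: "0 \<le> \<tau>" using adm_mono[OF Suc.prems, of n] by (auto simp: adm_def)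
    note IH = Suc.IH[OF a]
    have "\<bar>ev (X \<tau> n) x\<bar> \<le> c" for x using IH good[OF a] order_trans by blast
    from step_sup_dx[OF this, of "M * (1 + (2 * M + \<kappa>) * \<tau>) ^ n"]
      step_sup[of "X \<tau> n" "c * exp (- (\<kappa> * \<delta>)) * (1 + \<kappa> * \<tau>) ^ n"]
    show ?case using IH good[OF a] \<tau> by (simp add: mult_ac)
  qed
  assume "adm \<tau> n"
  from P[OF this] good[OF this] show ?thesis unfolding good_def by (meson order_trans)
qed

lemma norm_\<Delta>: "0 \<le> \<tau> \<Longrightarrow> norm (\<Delta> \<tau> f) \<le> 2 * (c * \<tau>) * norm (dx f)"
  using norm_tr_diff_sym[of "c * \<tau>" f] c by simp

lemma norm_transport_good:
  assumes "good u" "0 \<le> \<tau>"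
  shows "norm (transport (1 / (2 * c)) (c * \<tau>) u v) \<le> (1 + 2 * M * \<tau>) * norm v"
proof -
  have "norm (transport (1 / (2 * c)) (c * \<tau>) u v) \<le> (1 + 2 * (1 / (2 * c)) * (c * \<tau>) * (2 * M)) * norm v"
    by (rule norm_transport) (use assms c courant[of u] in \<open>auto simp: good_def\<close>)
  then show ?thesis using c by (simp add: mult_ac)
qed

text \<open>The growth must be at most linear in the top norm \<open>N\<close>, or the time of
  existence would shrink with the order. In the Leibniz terms \<open>j = 1\<close> and
  \<open>j = n\<close> the other factor is a first derivative or first difference of
  \<open>u\<close>, bounded pointwise through \<open>2 * M\<close>. For \<open>2 \<le> j < n\<close>
  the difference involves only orders below \<open>n\<close>, and the sup norm of the j-th
  derivative brings in \<open>N\<close> at most once.\<close>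

lemma dxn_step_bound:
  assumes u: "good u" and L: "\<And>j. j < n \<Longrightarrow> norm ((dx ^^ j) u) \<le> L" "0 \<le> L" and \<tau>: "0 \<le> \<tau>"
  defines "N \<equiv> norm ((dx ^^ n) u)"
  shows "norm ((dx ^^ n) (step \<tau> u)) \<le> N + (2 * M + \<kappa> + 2 ^ n * (2 * M + 4 * L * L + 2 * L)) * \<tau> * (1 + N)"
proof -
  let ?E = "2 * M + 4 * L * L + 2 * L"
  have N0: "0 \<le> N" unfolding N_def by simp
  have E0: "0 \<le> ?E" using M L(2) by simp
  let ?T = "\<lambda>j. (dx ^^ j) u * \<Delta> \<tau> ((dx ^^ (n - j)) u)"
  have T: "norm (?T j) \<le> 2 * c * (\<tau> * ?E * (1 + N))" if j: "1 \<le> j" "j \<le> n" for j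
  proof -
    have D: "norm (\<Delta> \<tau> ((dx ^^ (n - j)) u)) \<le> 2 * (c * \<tau>) * norm ((dx ^^ Suc (n - j)) u)"
      using norm_\<Delta>[OF \<tau>, of "(dx ^^ (n - j)) u"] by simp
    consider "j = 1" | "j = n" | "2 \<le> j" "j < n" using j by linarith
    then have "norm (?T j) \<le> 2 * c * (\<tau> * (2 * M * N + (2 * L + N) * (2 * L)))"
    proof cases
      case 1
      have "norm (?T j) \<le> 2 * M * norm (\<Delta> \<tau> ((dx ^^ (n - j)) u))"
        using u 1 by (intro norm_mult_bounded) (auto simp: good_def)
      also have "\<dots> \<le> 2 * M * (2 * (c * \<tau>) * N)"
        using D 1 j M unfolding N_def by (intro mult_left_mono) (auto simp: Suc_diff_le)
      also have "\<dots> \<le> 2 * c * (\<tau> * (2 * M * N + (2 * L + N) * (2 * L)))"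
        using L(2) N0 c \<tau> by (simp add: algebra_simps)
      finally show ?thesis .
    next
      case 2
      have "\<bar>ev (\<Delta> \<tau> u) x\<bar> \<le> 2 * (c * \<tau>) * (2 * M)" for x
        using ev_tr_diff_bound[of u "2 * M" "c * \<tau>" x] u \<tau> c by (auto simp: good_def)
      from norm_mult_bounded[OF this, of "(dx ^^ n) u"]
      have "norm (?T j) \<le> 2 * (c * \<tau>) * (2 * M) * N" using 2 by (simp add: N_def mult.commute)
      also have "\<dots> \<le> 2 * c * (\<tau> * (2 * M * N + (2 * L + N) * (2 * L)))"
        using L(2) N0 c \<tau> by (simp add: algebra_simps)
      finally show ?thesis .
    next
      case 3
      have j1: "norm ((dx ^^ Suc j) u) \<le> L + N"
        using L(1)[of "Suc j"] 3 L(2) unfolding N_def by (cases "Suc j = n") (auto intro: add_increasing2)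
      have "norm (?T j) \<le> 2 * (norm ((dx ^^ j) u) + norm ((dx ^^ Suc j) u)) * norm (\<Delta> \<tau> ((dx ^^ (n - j)) u))"
        using norm_mult_le[of "(dx ^^ j) u"] by simp
      also have "\<dots> \<le> 2 * (L + (L + N)) * (2 * (c * \<tau>) * L)"
      proof (intro mult_mono add_mono)
        show "norm (\<Delta> \<tau> ((dx ^^ (n - j)) u)) \<le> 2 * (c * \<tau>) * L"
          by (rule order_trans[OF D], intro mult_left_mono L) (use 3 c \<tau> in auto)
      qed (use j1 L 3 N0 in auto)
      also have "\<dots> \<le> 2 * c * (\<tau> * (2 * M * N + (2 * L + N) * (2 * L)))"
        using L(2) N0 c \<tau> M by (simp add: algebra_simps)
      finally show ?thesis .
    qed
    also have "\<dots> \<le> 2 * c * (\<tau> * ?E * (1 + N))"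
    proof -
      have "2 * M * N + (2 * L + N) * (2 * L) \<le> ?E * (1 + N)"
        using M N0 L(2) by (simp add: algebra_simps)
      then have "\<tau> * (2 * M * N + (2 * L + N) * (2 * L)) \<le> \<tau> * (?E * (1 + N))"
        using \<tau> by (rule mult_left_mono)
      then show ?thesis using c by (simp add: mult.assoc)
    qed
    finally show ?thesis .
  qed
  have S: "norm (\<Sum>j=1..n. real (n choose j) *\<^sub>R ?T j) \<le> 2 ^ n * (2 * c * (\<tau> * ?E * (1 + N)))"
    using T c \<tau> E0 N0 by (intro sum_choose_bound) auto
  have "norm ((dx ^^ n) (step \<tau> u)) \<le> norm (transport (1 / (2 * c)) (c * \<tau>) u ((dx ^^ n) u))
     + norm ((1 / (2 * c)) *\<^sub>R (\<Sum>j=1..n. real (n choose j) *\<^sub>R ?T j)) + norm (\<tau> *\<^sub>R conv k ((dx ^^ n) u))"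
    unfolding dxn_step by (meson norm_triangle_ineq4 add_mono order_trans order_refl)
  also have "\<dots> \<le> (1 + 2 * M * \<tau>) * N + 2 ^ n * (\<tau> * ?E * (1 + N)) + \<tau> * (\<kappa> * N)"
  proof (intro add_mono)
    show "norm (transport (1 / (2 * c)) (c * \<tau>) u ((dx ^^ n) u)) \<le> (1 + 2 * M * \<tau>) * N"
      unfolding N_def by (rule norm_transport_good[OF u \<tau>])
    have "norm ((1 / (2 * c)) *\<^sub>R (\<Sum>j=1..n. real (n choose j) *\<^sub>R ?T j)) \<le> (1 / (2 * c)) * (2 ^ n * (2 * c * (\<tau> * ?E * (1 + N))))"
      unfolding norm_scaleR using c by (intro mult_mono S) auto
    then show "norm ((1 / (2 * c)) *\<^sub>R (\<Sum>j=1..n. real (n choose j) *\<^sub>R ?T j)) \<le> 2 ^ n * (\<tau> * ?E * (1 + N))"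
      using c by (simp add: field_simps)
    show "norm (\<tau> *\<^sub>R conv k ((dx ^^ n) u)) \<le> \<tau> * (\<kappa> * N)"
      unfolding norm_scaleR N_def using \<tau> norm_conv[OF k] by (intro mult_mono) auto
  qed
  also have "\<dots> \<le> N + (2 * M + \<kappa> + 2 ^ n * ?E) * \<tau> * (1 + N)"
  proof -
    have "N + (2 * M + \<kappa> + 2 ^ n * ?E) * \<tau> * (1 + N)
      = (1 + 2 * M * \<tau>) * N + 2 ^ n * (\<tau> * ?E * (1 + N)) + \<tau> * (\<kappa> * N) + (2 * M + \<kappa>) * \<tau>"
      by algebra
    then show ?thesis using M \<kappa>0 \<tau> by simp
  qed
  finally show ?thesis .
qed

text \<open>Induction on the order: the lower orders supply the constant \<open>L\<close> of
  \<open>dxn_step_bound\<close>, and a discrete Gronwall argument for \<open>1 + N\<close> covers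
  the whole time interval of length \<open>\<delta>\<close>.\<close>

lemma traj_bound_less: "\<exists>A\<ge>0. \<forall>j<m. \<forall>\<tau> n. adm \<tau> n \<longrightarrow> norm ((dx ^^ j) (X \<tau> n)) \<le> A"
proof (induction m)
  case 0
  then show ?case by auto
next
  case (Suc m)
  then obtain L where L0: "0 \<le> L" and L: "\<And>j \<tau> n. j < m \<Longrightarrow> adm \<tau> n \<Longrightarrow> norm ((dx ^^ j) (X \<tau> n)) \<le> L" by blast
  define C where "C = 2 * M + \<kappa> + 2 ^ m * (2 * M + 4 * L * L + 2 * L)"
  have C0: "0 \<le> C" unfolding C_def using M \<kappa>0 L0 by simp
  let ?A = "(1 + norm ((dx ^^ m) u1)) * exp (C * \<delta>)"
  have "1 + norm ((dx ^^ m) (X \<tau> n)) \<le> (1 + norm ((dx ^^ m) u1)) * (1 + C * \<tau>) ^ n" if "adm \<tau> n" for \<tau> n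
    using that
  proof (induction n)
    case (Suc n)
    have a: "adm \<tau> n" and \<tau>: "0 \<le> \<tau>" using adm_mono[OF Suc.prems, of n] by (auto simp: adm_def)
    have "1 + norm ((dx ^^ m) (X \<tau> (Suc n))) \<le> (1 + C * \<tau>) * (1 + norm ((dx ^^ m) (X \<tau> n)))"
      using dxn_step_bound[OF traj_good[OF a] L[OF _ a] L0 \<tau>, of m] unfolding C_def[symmetric] by (simp add: algebra_simps)
    also have "\<dots> \<le> (1 + C * \<tau>) * ((1 + norm ((dx ^^ m) u1)) * (1 + C * \<tau>) ^ n)"
      using C0 \<tau> Suc.IH[OF a] by (intro mult_left_mono) auto
    finally show ?case by (simp add: mult_ac)
  qed simp
  moreover have "(1 + norm ((dx ^^ m) u1)) * (1 + C * \<tau>) ^ n \<le> ?A" if "adm \<tau> n" for \<tau> n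
  proof (intro mult_left_mono)
    have \<tau>: "0 \<le> \<tau>" "real n * \<tau> \<le> \<delta>" using that by (auto simp: adm_def)
    show "(1 + C * \<tau>) ^ n \<le> exp (C * \<delta>)"
      by (rule order_trans[OF one_plus_power_le_exp[OF C0 \<tau>(1)]]) (use \<tau>(2) C0 in \<open>auto intro!: mult_left_mono\<close>)
  qed simp
  ultimately have "norm ((dx ^^ m) (X \<tau> n)) \<le> ?A" if "adm \<tau> n" for \<tau> n
    using that by (smt (verit))
  then have "\<forall>j<Suc m. \<forall>\<tau> n. adm \<tau> n \<longrightarrow> norm ((dx ^^ j) (X \<tau> n)) \<le> max L ?A"
    using L by (auto simp: less_Suc_eq le_max_iff_disj)
  moreover have "0 \<le> max L ?A" using L0 by simp
  ultimately show ?case by blast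
qed

lemma traj_bound: obtains A where "0 \<le> A" "\<And>j \<tau> n. j \<le> m \<Longrightarrow> adm \<tau> n \<Longrightarrow> norm ((dx ^^ j) (X \<tau> n)) \<le> A"
  using traj_bound_less[of "Suc m"] by (auto simp: less_Suc_eq_le)

lemma step_increment: obtains C where "0 \<le> C"
    "\<And>\<tau> n. adm \<tau> n \<Longrightarrow> norm ((dx ^^ j) (step \<tau> (X \<tau> n) - X \<tau> n)) \<le> C * \<tau>"
proof -
  obtain A where A0: "0 \<le> A" and A: "\<And>i \<tau> n. i \<le> Suc j \<Longrightarrow> adm \<tau> n \<Longrightarrow> norm ((dx ^^ i) (X \<tau> n)) \<le> A"
    using traj_bound[of "Suc j"] by blast
  let ?C = "c * A + 2 ^ j * (4 * A * A) + \<kappa> * A"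
  have "norm ((dx ^^ j) (step \<tau> (X \<tau> n) - X \<tau> n)) \<le> ?C * \<tau>" if a: "adm \<tau> n" for \<tau> n
  proof -
    have \<tau>: "0 \<le> \<tau>" using a by (simp add: adm_def)
    let ?u = "X \<tau> n" and ?v = "(dx ^^ j) (X \<tau> n)" and ?h = "c * \<tau>"
    have h: "0 \<le> ?h" using c \<tau> by simp
    have v: "norm (dx ?v) \<le> A" "norm ?v \<le> A" using A[OF _ a, of "Suc j"] A[OF _ a, of j] by auto
    have "(1/2) *\<^sub>R ((tr ?h ?u - ?u) + (tr (-?h) ?u - ?u)) = (1/2) *\<^sub>R (tr ?h ?u + tr (-?h) ?u) - ?u"
      by (rule hinf_eqI) (simp add: field_simps)
    then have "step \<tau> ?u - ?u = (1/2) *\<^sub>R ((tr ?h ?u - ?u) + (tr (-?h) ?u - ?u)) - (1 / (2 * c)) *\<^sub>R (?u * \<Delta> \<tau> ?u) - \<tau> *\<^sub>R conv k ?u"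
      by (simp add: step_def transport_def)
    then have e: "(dx ^^ j) (step \<tau> ?u - ?u) = (1/2) *\<^sub>R ((tr ?h ?v - ?v) + (tr (-?h) ?v - ?v)) - (1 / (2 * c)) *\<^sub>R ((dx ^^ j) (?u * \<Delta> \<tau> ?u)) - \<tau> *\<^sub>R conv k ?v"
      by (simp add: dxn_diff dxn_add dxn_scaleR dxn_conv[OF k])
    have 1: "norm ((1/2) *\<^sub>R ((tr ?h ?v - ?v) + (tr (-?h) ?v - ?v))) \<le> ?h * A"
    proof -
      have "norm ((tr ?h ?v - ?v) + (tr (-?h) ?v - ?v)) \<le> \<bar>?h\<bar> * norm (dx ?v) + \<bar>- ?h\<bar> * norm (dx ?v)"
        by (intro order_trans[OF norm_triangle_ineq] add_mono norm_tr_diff)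
      also have "\<dots> \<le> \<bar>?h\<bar> * A + \<bar>- ?h\<bar> * A" by (intro add_mono mult_left_mono v) auto
      finally show ?thesis using h by (simp add: mult_ac)
    qed
    have 2: "norm ((1 / (2 * c)) *\<^sub>R ((dx ^^ j) (?u * \<Delta> \<tau> ?u))) \<le> \<tau> * (2 ^ j * (4 * A * A))"
    proof -
      have "norm ((dx ^^ j) (?u * \<Delta> \<tau> ?u)) \<le> 2 ^ j * (4 * A * (2 * ?h * A))"
      proof (rule norm_dxn_mult)
        fix i assume "i \<le> j"
        have "norm ((dx ^^ i) (\<Delta> \<tau> ?u)) \<le> 2 * ?h * norm ((dx ^^ Suc i) ?u)"
          using norm_\<Delta>[OF \<tau>, of "(dx ^^ i) ?u"] by (simp add: dxn_diff)
        also have "\<dots> \<le> 2 * ?h * A" using A[OF _ a, of "Suc i"] \<open>i \<le> j\<close> h by (intro mult_left_mono) auto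
        finally show "norm ((dx ^^ i) (\<Delta> \<tau> ?u)) \<le> 2 * ?h * A" .
      qed (use A a in auto)
      then have "norm ((1 / (2 * c)) *\<^sub>R ((dx ^^ j) (?u * \<Delta> \<tau> ?u))) \<le> (1 / (2 * c)) * (2 ^ j * (4 * A * (2 * ?h * A)))"
        unfolding norm_scaleR using c by (intro mult_mono) auto
      also have "\<dots> = \<tau> * (2 ^ j * (4 * A * A))" using c by (simp add: field_simps)
      finally show ?thesis .
    qed
    have 3: "norm (\<tau> *\<^sub>R conv k ?v) \<le> \<tau> * (\<kappa> * A)"
      unfolding norm_scaleR using \<tau> v \<kappa>0 by (intro mult_mono order_trans[OF norm_conv[OF k]] mult_left_mono) auto
    have "norm ((dx ^^ j) (step \<tau> ?u - ?u)) \<le> ?h * A + \<tau> * (2 ^ j * (4 * A * A)) + \<tau> * (\<kappa> * A)"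
      unfolding e by (intro order_trans[OF norm_triangle_ineq4] add_mono 1 2 3)
    then show ?thesis by (simp add: algebra_simps)
  qed
  moreover have "0 \<le> ?C" using c A0 \<kappa>0 by simp
  ultimately show ?thesis using that by blast
qed

lemma traj_increment: obtains C where "0 \<le> C"
    "\<And>\<tau> n m. adm \<tau> (n + m) \<Longrightarrow> norm ((dx ^^ j) (X \<tau> (n + m) - X \<tau> n)) \<le> C * (real m * \<tau>)"
proof -
  obtain C where C0: "0 \<le> C" and C: "\<And>\<tau> n. adm \<tau> n \<Longrightarrow> norm ((dx ^^ j) (step \<tau> (X \<tau> n) - X \<tau> n)) \<le> C * \<tau>"
    using step_increment by blast
  have "norm ((dx ^^ j) (X \<tau> (n + m) - X \<tau> n)) \<le> C * (real m * \<tau>)" if "adm \<tau> (n + m)" for \<tau> n m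
    using that
  proof (induction m)
    case (Suc m)
    have a: "adm \<tau> (n + m)" using Suc.prems by (rule adm_mono) simp
    have "(dx ^^ j) (X \<tau> (n + Suc m) - X \<tau> n) = (dx ^^ j) (step \<tau> (X \<tau> (n + m)) - X \<tau> (n + m)) + (dx ^^ j) (X \<tau> (n + m) - X \<tau> n)"
      by (simp add: dxn_diff)
    also have "norm \<dots> \<le> C * \<tau> + C * (real m * \<tau>)"
      by (intro order_trans[OF norm_triangle_ineq] add_mono C Suc.IH a)
    finally show ?case by (simp add: algebra_simps)
  qed simp
  with C0 that show ?thesis by blast
qed

section \<open>Consistency, stability and rate of convergence\<close>

lemma vf_lipschitz:
  assumes "good u" "good v"
  shows "norm (vf k u - vf k v) \<le> (2 * M + \<kappa>) * norm (u - v) + c * norm (dx (u - v))"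
proof -
  have "vf k u - vf k v = - (dx u * (u - v)) - v * dx (u - v) - conv k (u - v)"
    by (simp add: vf_def conv_diff[OF k] algebra_simps)
  also have "norm \<dots> \<le> 2 * M * norm (u - v) + c * norm (dx (u - v)) + \<kappa> * norm (u - v)"
  proof (intro order_trans[OF norm_triangle_ineq4] add_mono norm_conv[OF k])
    show "norm (- (dx u * (u - v))) \<le> 2 * M * norm (u - v)"
      unfolding norm_minus_cancel using assms by (intro norm_mult_bounded) (auto simp: good_def)
    show "norm (v * dx (u - v)) \<le> c * norm (dx (u - v))"
      using assms by (intro norm_mult_bounded) (auto simp: good_def)
  qed
  finally show ?thesis by (simp add: algebra_simps)
qed

text \<open>Second order Taylor expansion of both translations. The step size
  \<open>\<sigma>\<close> is independent of the mesh \<open>\<tau>\<close> of the trajectory,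
  because a full step is later taken from a point that was computed with half steps.\<close>

lemma step_consistent: obtains C where "0 \<le> C"
    "\<And>\<tau> \<sigma> n. adm \<tau> n \<Longrightarrow> 0 \<le> \<sigma> \<Longrightarrow> norm (step \<sigma> (X \<tau> n) - X \<tau> n - \<sigma> *\<^sub>R vf k (X \<tau> n)) \<le> C * \<sigma>\<^sup>2"
proof -
  obtain A where A0: "0 \<le> A" and A: "\<And>i \<tau> n. i \<le> 2 \<Longrightarrow> adm \<tau> n \<Longrightarrow> norm ((dx ^^ i) (X \<tau> n)) \<le> A"
    using traj_bound[of 2] by blast
  have "norm (step \<sigma> (X \<tau> n) - X \<tau> n - \<sigma> *\<^sub>R vf k (X \<tau> n)) \<le> (2 * c\<^sup>2 * A) * \<sigma>\<^sup>2"
    if a: "adm \<tau> n" and \<sigma>: "0 \<le> \<sigma>" for \<tau> \<sigma> n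
  proof -
    let ?u = "X \<tau> n" and ?h = "c * \<sigma>"
    let ?P = "tr ?h ?u - ?u - ?h *\<^sub>R dx ?u" and ?Q = "tr (- ?h) ?u - ?u - (- ?h) *\<^sub>R dx ?u"
    have h: "0 \<le> ?h" using c \<sigma> by simp
    have d2: "norm (dx (dx ?u)) \<le> A" using A[OF _ a, of 2] by (simp add: numeral_2_eq_2)
    have P: "norm ?P \<le> ?h\<^sup>2 * A"
      using norm_tr_diff2[OF h, of 1 ?u] mult_left_mono[OF d2, of "?h\<^sup>2"] by simp
    have Q: "norm ?Q \<le> ?h\<^sup>2 * A"
      using norm_tr_diff2[OF h, of "-1" ?u] mult_left_mono[OF d2, of "?h\<^sup>2"] by simp
    have e: "step \<sigma> ?u - ?u - \<sigma> *\<^sub>R vf k ?u = (1/2) *\<^sub>R (?P + ?Q) - (1 / (2 * c)) *\<^sub>R (?u * (?P - ?Q))"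
      using c by (intro hinf_eqI) (simp add: step_def transport_def vf_def field_simps)
    have "norm (step \<sigma> ?u - ?u - \<sigma> *\<^sub>R vf k ?u) \<le> (1/2) * (?h\<^sup>2 * A + ?h\<^sup>2 * A) + (1 / (2 * c)) * (c * (?h\<^sup>2 * A + ?h\<^sup>2 * A))"
      unfolding e
    proof (intro order_trans[OF norm_triangle_ineq4] add_mono)
      show "norm ((1/2) *\<^sub>R (?P + ?Q)) \<le> (1/2) * (?h\<^sup>2 * A + ?h\<^sup>2 * A)"
        using order_trans[OF norm_triangle_ineq add_mono[OF P Q]] by simp
      have "norm (?u * (?P - ?Q)) \<le> c * norm (?P - ?Q)"
        using traj_good[OF a] by (intro norm_mult_bounded) (auto simp: good_def)
      also have "\<dots> \<le> c * (?h\<^sup>2 * A + ?h\<^sup>2 * A)"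
        using c by (intro mult_left_mono order_trans[OF norm_triangle_ineq4 add_mono[OF P Q]]) auto
      finally show "norm ((1 / (2 * c)) *\<^sub>R (?u * (?P - ?Q))) \<le> (1 / (2 * c)) * (c * (?h\<^sup>2 * A + ?h\<^sup>2 * A))"
        unfolding norm_scaleR using c by (intro mult_mono) auto
    qed
    also have "\<dots> = (2 * c\<^sup>2 * A) * \<sigma>\<^sup>2" using c by (simp add: field_simps power2_eq_square)
    finally show ?thesis .
  qed
  moreover have "0 \<le> 2 * c\<^sup>2 * A" using A0 by simp
  ultimately show ?thesis using that by blast
qed

text \<open>Over \<open>m\<close> steps the trajectory is compared with a single Euler step of
  length \<open>m * \<tau>\<close>, with a constant independent of \<open>m\<close>. The same
  estimate controls two half steps and, in the limit, the time derivative of the solution.\<close>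

lemma traj_consistent: obtains C where "0 \<le> C"
    "\<And>\<tau> n m. adm \<tau> (n + m) \<Longrightarrow> norm (X \<tau> (n + m) - X \<tau> n - (real m * \<tau>) *\<^sub>R vf k (X \<tau> n)) \<le> C * (real m * \<tau>)\<^sup>2"
proof -
  obtain C1 where C1: "0 \<le> C1" "\<And>\<tau> \<sigma> n. adm \<tau> n \<Longrightarrow> 0 \<le> \<sigma> \<Longrightarrow> norm (step \<sigma> (X \<tau> n) - X \<tau> n - \<sigma> *\<^sub>R vf k (X \<tau> n)) \<le> C1 * \<sigma>\<^sup>2"
    using step_consistent by blast
  obtain Ca where Ca: "0 \<le> Ca" "\<And>\<tau> n m. adm \<tau> (n + m) \<Longrightarrow> norm ((dx ^^ 0) (X \<tau> (n + m) - X \<tau> n)) \<le> Ca * (real m * \<tau>)"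
    using traj_increment[of 0] by blast
  obtain Cb where Cb: "0 \<le> Cb" "\<And>\<tau> n m. adm \<tau> (n + m) \<Longrightarrow> norm ((dx ^^ 1) (X \<tau> (n + m) - X \<tau> n)) \<le> Cb * (real m * \<tau>)"
    using traj_increment[of 1] by blast
  define C where "C = C1 + ((2 * M + \<kappa>) * Ca + c * Cb)"
  have C2: "0 \<le> (2 * M + \<kappa>) * Ca + c * Cb" using M \<kappa>0 Ca(1) c Cb(1) by simp
  have "norm (X \<tau> (n + m) - X \<tau> n - (real m * \<tau>) *\<^sub>R vf k (X \<tau> n)) \<le> C * (real m * \<tau>)\<^sup>2" if "adm \<tau> (n + m)" for \<tau> n m
    using that
  proof (induction m)
    case (Suc m)
    have a: "adm \<tau> (n + m)" using Suc.prems by (rule adm_mono) simp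
    have a0: "adm \<tau> n" using a by (rule adm_mono) simp
    have \<tau>: "0 \<le> \<tau>" using a by (simp add: adm_def)
    let ?v = "X \<tau> (n + m)" and ?u = "X \<tau> n"
    have "norm (vf k ?v - vf k ?u) \<le> (2 * M + \<kappa>) * norm (?v - ?u) + c * norm (dx (?v - ?u))"
      by (rule vf_lipschitz[OF traj_good[OF a] traj_good[OF a0]])
    also have "\<dots> \<le> (2 * M + \<kappa>) * (Ca * (real m * \<tau>)) + c * (Cb * (real m * \<tau>))"
      using Ca(2)[OF a] Cb(2)[OF a] M \<kappa>0 c by (intro add_mono mult_left_mono) auto
    finally have L: "norm (\<tau> *\<^sub>R (vf k ?v - vf k ?u)) \<le> \<tau> * (((2 * M + \<kappa>) * Ca + c * Cb) * (real m * \<tau>))"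
      unfolding norm_scaleR using \<tau> by (intro mult_mono) (auto simp: algebra_simps)
    have e: "X \<tau> (n + Suc m) - ?u - (real (Suc m) * \<tau>) *\<^sub>R vf k ?u
       = (?v - ?u - (real m * \<tau>) *\<^sub>R vf k ?u) + (step \<tau> ?v - ?v - \<tau> *\<^sub>R vf k ?v) + \<tau> *\<^sub>R (vf k ?v - vf k ?u)"
      by (simp add: algebra_simps)
    have "norm (X \<tau> (n + Suc m) - ?u - (real (Suc m) * \<tau>) *\<^sub>R vf k ?u)
       \<le> C * (real m * \<tau>)\<^sup>2 + C1 * \<tau>\<^sup>2 + \<tau> * (((2 * M + \<kappa>) * Ca + c * Cb) * (real m * \<tau>))"
      unfolding e by (intro order_trans[OF norm_triangle_ineq] add_mono Suc.IH a C1(2) \<tau> L)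
    also have "\<dots> \<le> C * (real m * \<tau>)\<^sup>2 + C * \<tau>\<^sup>2 + \<tau> * (C * (real m * \<tau>))"
    proof -
      have "C1 \<le> C" "(2 * M + \<kappa>) * Ca + c * Cb \<le> C" using C1(1) C2 by (auto simp: C_def)
      then show ?thesis using \<tau> by (intro add_mono[OF add_mono] order_refl mult_left_mono mult_right_mono) auto
    qed
    \<comment> \<open>Doubling the mixed term completes the square:
      \<open>m\<^sup>2 + 2 * m + 1 = (m + 1)\<^sup>2\<close>.\<close>
    also have "\<dots> \<le> C * (real m * \<tau>)\<^sup>2 + C * \<tau>\<^sup>2 + 2 * (\<tau> * (C * (real m * \<tau>)))"
      using C1(1) C2 \<tau> unfolding C_def by simp
    also have "\<dots> = C * (real (Suc m) * \<tau>)\<^sup>2" by (simp add: power2_eq_square algebra_simps)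
    finally show ?case .
  qed simp
  moreover have "0 \<le> C" using C1(1) C2 by (simp add: C_def)
  ultimately show ?thesis using that by blast
qed

text \<open>The difference is transported by \<open>u\<close>; the remaining term pairs
  \<open>u - v\<close> with a first difference of \<open>v\<close>, which is bounded pointwise by a
  multiple of \<open>M * \<tau>\<close>. So no derivative of \<open>u - v\<close> occurs.\<close>

lemma step_stable:
  assumes "good u" "good v" "0 \<le> \<tau>"
  shows "norm (step \<tau> u - step \<tau> v) \<le> (1 + (4 * M + \<kappa>) * \<tau>) * norm (u - v)"
proof -
  have "step \<tau> u - step \<tau> v = transport (1 / (2 * c)) (c * \<tau>) u (u - v) - (1 / (2 * c)) *\<^sub>R (\<Delta> \<tau> v * (u - v)) - \<tau> *\<^sub>R conv k (u - v)"
    by (intro hinf_eqI) (simp add: step_def transport_def conv_diff[OF k] algebra_simps)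
  also have "norm \<dots> \<le> (1 + 2 * M * \<tau>) * norm (u - v) + (1 / (2 * c)) * ((2 * (c * \<tau>) * (2 * M)) * norm (u - v)) + \<tau> * (\<kappa> * norm (u - v))"
  proof (intro order_trans[OF norm_triangle_ineq4] add_mono norm_transport_good assms)
    have "\<bar>ev (\<Delta> \<tau> v) x\<bar> \<le> 2 * (c * \<tau>) * (2 * M)" for x
      using ev_tr_diff_bound[of v "2 * M" "c * \<tau>" x] assms c by (auto simp: good_def)
    from norm_mult_bounded[OF this]
    show "norm ((1 / (2 * c)) *\<^sub>R (\<Delta> \<tau> v * (u - v))) \<le> (1 / (2 * c)) * ((2 * (c * \<tau>) * (2 * M)) * norm (u - v))"
      unfolding norm_scaleR using c by (intro mult_mono) auto
    show "norm (\<tau> *\<^sub>R conv k (u - v)) \<le> \<tau> * (\<kappa> * norm (u - v))"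
      unfolding norm_scaleR using assms(3) by (intro mult_mono norm_conv[OF k]) auto
  qed
  also have "\<dots> = (1 + (4 * M + \<kappa>) * \<tau>) * norm (u - v)" using c by (simp add: field_simps)
  finally show ?thesis .
qed

text \<open>Consistency and stability give convergence: each step of length \<tau> adds an error of
  order \<tau>^2, errors are amplified by at most a fixed exponential, and there are at most
  \<open>\<delta> / \<tau>\<close> steps.\<close>

lemma refinement: obtains C where "0 \<le> C"
    "\<And>\<tau> n. adm \<tau> n \<Longrightarrow> norm (X \<tau> n - X (\<tau> / 2) (2 * n)) \<le> C * \<tau>"
proof -
  obtain C1 where C1: "0 \<le> C1" "\<And>\<tau> \<sigma> n. adm \<tau> n \<Longrightarrow> 0 \<le> \<sigma> \<Longrightarrow> norm (step \<sigma> (X \<tau> n) - X \<tau> n - \<sigma> *\<^sub>R vf k (X \<tau> n)) \<le> C1 * \<sigma>\<^sup>2"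
    using step_consistent by blast
  obtain C2 where C2: "0 \<le> C2" "\<And>\<tau> n m. adm \<tau> (n + m) \<Longrightarrow> norm (X \<tau> (n + m) - X \<tau> n - (real m * \<tau>) *\<^sub>R vf k (X \<tau> n)) \<le> C2 * (real m * \<tau>)\<^sup>2"
    using traj_consistent by blast
  define B where "B = 4 * M + \<kappa>"
  have B0: "0 \<le> B" using M \<kappa>0 by (simp add: B_def)
  have "norm (X \<tau> n - X (\<tau> / 2) (2 * n)) \<le> (C1 + C2) * \<tau>\<^sup>2 * real n * (1 + B * \<tau>) ^ n" if "adm \<tau> n" for \<tau> n
    using that
  proof (induction n)
    case (Suc n)
    have a: "adm \<tau> n" and \<tau>: "0 < \<tau>" using adm_mono[OF Suc.prems, of n] by (auto simp: adm_def)
    have a2: "adm (\<tau> / 2) (2 * n + 2)" using Suc.prems by (auto simp: adm_def field_simps)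
    have a2': "adm (\<tau> / 2) (2 * n)" using a2 by (rule adm_mono) simp
    let ?w = "X (\<tau> / 2) (2 * n)" and ?e = "(C1 + C2) * \<tau>\<^sup>2"
    have e0: "0 \<le> ?e" using C1(1) C2(1) by simp
    have X2: "X (\<tau> / 2) (2 * Suc n) = X (\<tau> / 2) (2 * n + 2)" by (simp del: X_Suc)
    \<comment> \<open>Stability compares one step from the two different points; the rest compares
      one full step and two half steps from the same point \<open>?w\<close>, each with the Euler
      step \<open>\<tau> *\<^sub>R vf k ?w\<close>.\<close>
    have e: "X \<tau> (Suc n) - X (\<tau> / 2) (2 * Suc n) = (step \<tau> (X \<tau> n) - step \<tau> ?w) + (step \<tau> ?w - ?w - \<tau> *\<^sub>R vf k ?w)
        - (X (\<tau> / 2) (2 * n + 2) - ?w - (real 2 * (\<tau> / 2)) *\<^sub>R vf k ?w)"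
      unfolding X2 by (simp del: X_Suc add: X_Suc[of \<tau> n])
    have b1: "norm (step \<tau> (X \<tau> n) - step \<tau> ?w) \<le> (1 + B * \<tau>) * norm (X \<tau> n - ?w)"
      using \<tau> step_stable[OF traj_good[OF a] traj_good[OF a2'], of \<tau>] by (simp add: B_def)
    have b2: "norm (step \<tau> ?w - ?w - \<tau> *\<^sub>R vf k ?w) \<le> C1 * \<tau>\<^sup>2"
      by (rule C1(2)[OF a2']) (use \<tau> in simp)
    have b3: "norm (X (\<tau> / 2) (2 * n + 2) - ?w - (real 2 * (\<tau> / 2)) *\<^sub>R vf k ?w) \<le> C2 * (real 2 * (\<tau> / 2))\<^sup>2"
      by (rule C2(2)[OF a2])
    have "norm (X \<tau> (Suc n) - X (\<tau> / 2) (2 * Suc n)) \<le> (1 + B * \<tau>) * norm (X \<tau> n - ?w) + C1 * \<tau>\<^sup>2 + C2 * (real 2 * (\<tau> / 2))\<^sup>2"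
      unfolding e by (rule order_trans[OF norm_triangle_ineq4 add_mono[OF order_trans[OF norm_triangle_ineq add_mono[OF b1 b2]] b3]])
    also have "\<dots> = (1 + B * \<tau>) * norm (X \<tau> n - ?w) + ?e" by (simp add: algebra_simps)
    also have "\<dots> \<le> (1 + B * \<tau>) * (?e * real n * (1 + B * \<tau>) ^ n) + ?e * (1 + B * \<tau>) ^ Suc n"
    proof (intro add_mono mult_left_mono Suc.IH a)
      have "1 \<le> (1 + B * \<tau>) ^ Suc n" using B0 \<tau> by (intro one_le_power) auto
      then show "?e \<le> ?e * (1 + B * \<tau>) ^ Suc n" using mult_left_mono[OF _ e0] by fastforce
    qed (use B0 \<tau> in auto)
    also have "\<dots> = ?e * real (Suc n) * (1 + B * \<tau>) ^ Suc n" by (simp add: algebra_simps)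
    finally show ?case .
  qed simp
  moreover have "(C1 + C2) * \<tau>\<^sup>2 * real n * (1 + B * \<tau>) ^ n \<le> ((C1 + C2) * \<delta> * exp (B * \<delta>)) * \<tau>" if "adm \<tau> n" for \<tau> n
  proof -
    have \<tau>: "0 \<le> \<tau>" "real n * \<tau> \<le> \<delta>" using that by (auto simp: adm_def)
    have "(1 + B * \<tau>) ^ n \<le> exp (B * \<delta>)"
      by (rule order_trans[OF one_plus_power_le_exp[OF B0 \<tau>(1)]]) (use \<tau>(2) B0 in \<open>auto intro!: mult_left_mono\<close>)
    then have "(real n * \<tau>) * (1 + B * \<tau>) ^ n \<le> \<delta> * exp (B * \<delta>)"
      using \<tau> \<delta> B0 by (intro mult_mono) auto
    then have "((C1 + C2) * \<tau>) * ((real n * \<tau>) * (1 + B * \<tau>) ^ n) \<le> ((C1 + C2) * \<tau>) * (\<delta> * exp (B * \<delta>))"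
      using C1(1) C2(1) \<tau> by (intro mult_left_mono) auto
    then show ?thesis by (simp add: power2_eq_square mult_ac)
  qed
  ultimately have "norm (X \<tau> n - X (\<tau> / 2) (2 * n)) \<le> ((C1 + C2) * \<delta> * exp (B * \<delta>)) * \<tau>" if "adm \<tau> n" for \<tau> n
    using that order_trans by blast
  moreover have "0 \<le> (C1 + C2) * \<delta> * exp (B * \<delta>)" using C1(1) C2(1) \<delta> by simp
  ultimately show ?thesis using that by blast
qed

end

section \<open>Convergence and differentiability in all H^s\<close>

definition tends :: "('a \<Rightarrow> hinf) \<Rightarrow> hinf \<Rightarrow> 'a filter \<Rightarrow> bool" where
  "tends f a F \<longleftrightarrow> (\<forall>k. ((\<lambda>t. (dx ^^ k) (f t)) \<longlongrightarrow> (dx ^^ k) a) F)"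

definition HD :: "real set \<Rightarrow> (real \<Rightarrow> hinf) \<Rightarrow> real \<Rightarrow> hinf \<Rightarrow> bool" where
  "HD I u t v \<longleftrightarrow> tends (\<lambda>\<tau>. (1 / (\<tau> - t)) *\<^sub>R (u \<tau> - u t)) v (at t within I)"

lemma tendsD: "tends f a F \<Longrightarrow> ((\<lambda>t. (dx ^^ k) (f t)) \<longlongrightarrow> (dx ^^ k) a) F"
  by (simp add: tends_def)

lemma tends_tendsto: "tends f a F \<Longrightarrow> (f \<longlongrightarrow> a) F"
  using tendsD[of f a F 0] by simp

text \<open>Multiplication is not continuous in the L2 topology. Convergence of the derivative of
  one factor makes that factor converge uniformly, and this repairs it.\<close>

lemma tendsto_hinf_mult:
  fixes f g :: "'a \<Rightarrow> hinf"
  assumes "(f \<longlongrightarrow> a) F" "((\<lambda>t. dx (f t)) \<longlongrightarrow> dx a) F" "(g \<longlongrightarrow> b) F"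
  shows "((\<lambda>t. f t * g t) \<longlongrightarrow> a * b) F"
proof (rule Lim_null_comparison[THEN Lim_null[THEN iffD2]])
  let ?B = "\<lambda>t. 2 * (norm (f t - a) + norm (dx (f t) - dx a)) * norm (g t) + 2 * (norm a + norm (dx a)) * norm (g t - b)"
  have "f t * g t - a * b = (f t - a) * g t + a * (g t - b)" for t by (simp add: algebra_simps)
  moreover have "norm ((f t - a) * g t + a * (g t - b)) \<le> ?B t" for t
    using norm_mult_le[of "f t - a" "g t"] norm_mult_le[of a "g t - b"]
    by (intro order_trans[OF norm_triangle_ineq] add_mono) auto
  ultimately show "eventually (\<lambda>t. norm (f t * g t - a * b) \<le> ?B t) F" by simp
  have "(?B \<longlongrightarrow> 2 * (0 + 0) * norm b + 2 * (norm a + norm (dx a)) * 0) F"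
    by (intro tendsto_intros assms tendsto_norm_zero assms[THEN Lim_null[THEN iffD1]])
  then show "(?B \<longlongrightarrow> 0) F" by simp
qed

lemma tends_dx: "tends f a F \<Longrightarrow> tends (\<lambda>t. dx (f t)) (dx a) F"
  unfolding tends_def dxn_dx by blast

lemma tends_add: "tends f a F \<Longrightarrow> tends g b F \<Longrightarrow> tends (\<lambda>t. f t + g t) (a + b) F"
  unfolding tends_def dxn_add by (auto intro!: tendsto_add)

lemma tends_diff: "tends f a F \<Longrightarrow> tends g b F \<Longrightarrow> tends (\<lambda>t. f t - g t) (a - b) F"
  unfolding tends_def dxn_diff by (auto intro!: tendsto_diff)

lemma tends_minus: "tends f a F \<Longrightarrow> tends (\<lambda>t. - f t) (- a) F"
  unfolding tends_def dxn_minus by (auto intro!: tendsto_minus)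

lemma tends_scaleR: "tends f a F \<Longrightarrow> (c \<longlongrightarrow> r) F \<Longrightarrow> tends (\<lambda>t. c t *\<^sub>R f t) (r *\<^sub>R a) F"
  unfolding tends_def dxn_scaleR by (auto intro!: tendsto_scaleR)

lemma tends_const: "tends (\<lambda>_. a) a F" by (simp add: tends_def)

lemma tends_sum: "(\<And>i. i \<in> A \<Longrightarrow> tends (f i) (a i) F) \<Longrightarrow> tends (\<lambda>t. \<Sum>i\<in>A. f i t) (\<Sum>i\<in>A. a i) F"
  unfolding tends_def dxn_sum by (auto intro!: tendsto_sum)

lemma tends_mult:
  assumes "tends f a F" "tends g b F"
  shows "tends (\<lambda>t. f t * g t) (a * b) F"
  unfolding tends_def
proof
  fix k
  show "((\<lambda>t. (dx ^^ k) (f t * g t)) \<longlongrightarrow> (dx ^^ k) (a * b)) F"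
    using assms
  proof (induction k arbitrary: f g a b)
    case 0
    then show ?case
      using tendsto_hinf_mult[OF tends_tendsto[OF "0.prems"(1)] tends_tendsto[OF tends_dx[OF "0.prems"(1)]] tends_tendsto[OF "0.prems"(2)]] by simp
  next
    case (Suc k)
    have "((\<lambda>t. (dx ^^ k) (dx (f t) * g t) + (dx ^^ k) (f t * dx (g t))) \<longlongrightarrow> (dx ^^ k) (dx a * b) + (dx ^^ k) (a * dx b)) F"
      by (intro tendsto_add Suc.IH tends_dx Suc.prems)
    then show ?case by (simp only: dxn_dx[symmetric] dx_mult dxn_add)
  qed
qed

lemma tends_conv:
  assumes k: "integrable lborel k" and f: "tends f a F"
  shows "tends (\<lambda>t. conv k (f t)) (conv k a) F"
  unfolding tends_def
proof
  fix n
  show "((\<lambda>t. (dx ^^ n) (conv k (f t))) \<longlongrightarrow> (dx ^^ n) (conv k a)) F"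
    unfolding dxn_conv[OF k]
  proof (rule Lim_null_comparison[THEN Lim_null[THEN iffD2]])
    show "eventually (\<lambda>t. norm (conv k ((dx ^^ n) (f t)) - conv k ((dx ^^ n) a)) \<le> L1 k * norm ((dx ^^ n) (f t) - (dx ^^ n) a)) F"
      using norm_conv[OF k] by (auto simp: conv_diff[OF k, symmetric])
    have "((\<lambda>t. L1 k * norm ((dx ^^ n) (f t) - (dx ^^ n) a)) \<longlongrightarrow> L1 k * 0) F"
      by (intro tendsto_mult_left tendsto_norm_zero tendsD[OF f, THEN Lim_null[THEN iffD1]])
    then show "((\<lambda>t. L1 k * norm ((dx ^^ n) (f t) - (dx ^^ n) a)) \<longlongrightarrow> 0) F" by simp
  qed
qed

lemma tends_vf:
  assumes "integrable lborel k" "tends f a F"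
  shows "tends (\<lambda>t. vf k (f t)) (vf k a) F"
  unfolding vf_def by (intro tends_diff tends_minus tends_mult tends_dx tends_conv assms)

lemma tends_cong: "eventually (\<lambda>t. f t = g t) F \<Longrightarrow> tends f a F \<longleftrightarrow> tends g a F"
  unfolding tends_def by (intro iff_allI tendsto_cong) (auto elim: eventually_mono)

text \<open>By interpolation, the order \<open>Suc k\<close> is controlled by the order
  \<open>k\<close>, which tends to 0, times the order \<open>Suc (Suc k)\<close>, which is
  eventually bounded.\<close>

lemma tends_zeroI:
  assumes q0: "(q \<longlongrightarrow> 0) F" and B: "\<And>k. eventually (\<lambda>t. norm ((dx ^^ k) (q t)) \<le> B k) F"
  shows "tends q 0 F"
  unfolding tends_def
proof
  fix k show "((\<lambda>t. (dx ^^ k) (q t)) \<longlongrightarrow> (dx ^^ k) 0) F"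
  proof (induction k)
    case (Suc k)
    have n: "((\<lambda>t. norm ((dx ^^ k) (q t))) \<longlongrightarrow> 0) F" using Suc by (auto intro: tendsto_norm_zero)
    have "((\<lambda>t. (norm ((dx ^^ Suc k) (q t)))\<^sup>2) \<longlongrightarrow> 0) F"
    proof (rule tendsto_sandwich[OF _ _ tendsto_const])
      show "eventually (\<lambda>t. (norm ((dx ^^ Suc k) (q t)))\<^sup>2 \<le> norm ((dx ^^ k) (q t)) * B (Suc (Suc k))) F"
        using B[of "Suc (Suc k)"]
      proof eventually_elim
        case (elim t)
        show ?case
          using norm_dx_interpolation[of "(dx ^^ k) (q t)"] mult_left_mono[OF elim norm_ge_zero[of "(dx ^^ k) (q t)"]] by simp
      qed
      show "((\<lambda>t. norm ((dx ^^ k) (q t)) * B (Suc (Suc k))) \<longlongrightarrow> 0) F"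
        using tendsto_mult_right[OF n, of "B (Suc (Suc k))"] by simp
    qed auto
    from tendsto_real_sqrt[OF this] have "((\<lambda>t. norm ((dx ^^ Suc k) (q t))) \<longlongrightarrow> 0) F" by simp
    then show ?case unfolding dxn_zero by (rule tendsto_norm_zero_cancel)
  qed (use q0 in simp)
qed

lemma Cauchy_geometric:
  fixes a :: "nat \<Rightarrow> 'a::real_normed_vector"
  assumes a: "\<And>j. norm (a (Suc j) - a j) \<le> K * (1/2) ^ j"
  shows "Cauchy a"
proof -
  have K: "0 \<le> K" using order_trans[OF norm_ge_zero a[of 0]] by simp
  have 1: "norm (a (j + m) - a j) \<le> 2 * K * ((1/2) ^ j - (1/2) ^ (j + m))" for j m
  proof (induction m)
    case (Suc m)
    have "norm (a (j + Suc m) - a j) \<le> norm (a (Suc (j + m)) - a (j + m)) + norm (a (j + m) - a j)"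
      using norm_triangle_ineq[of "a (Suc (j + m)) - a (j + m)" "a (j + m) - a j"] by simp
    also have "\<dots> \<le> K * (1/2) ^ (j + m) + 2 * K * ((1/2) ^ j - (1/2) ^ (j + m))" by (intro add_mono a Suc)
    finally show ?case by (simp add: algebra_simps)
  qed simp
  have 2: "norm (a n - a j) \<le> 2 * K * (1/2) ^ j" if "j \<le> n" for j n
  proof -
    have "norm (a n - a j) \<le> 2 * K * ((1/2) ^ j - (1/2) ^ n)" using 1[of j "n - j"] that by simp
    also have "\<dots> \<le> 2 * K * (1/2) ^ j" using K by (intro mult_left_mono) auto
    finally show ?thesis .
  qed
  have lim: "(\<lambda>j. 2 * K * (1/2) ^ j) \<longlonglongrightarrow> 0"
    using tendsto_mult_right_zero[OF LIMSEQ_power_zero[of "1/2 :: real"], of "2 * K"] by simp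
  show ?thesis
  proof (rule CauchyI')
    fix e :: real assume "0 < e"
    then obtain N where N: "\<And>j. j \<ge> N \<Longrightarrow> 2 * K * (1/2) ^ j < e"
      using order_tendstoD(2)[OF lim] by (auto simp: eventually_sequentially)
    show "\<exists>M. \<forall>m\<ge>M. \<forall>n>m. dist (a m) (a n) < e"
    proof (intro exI[of _ N] allI impI)
      fix m n :: nat assume "N \<le> m" "m < n"
      then show "dist (a m) (a n) < e"
        using N[of m] 2[of m n] by (simp add: dist_norm norm_minus_commute)
    qed
  qed
qed

section \<open>Passage to the limit in the scheme\<close>

context lax_friedrichs
begin

text \<open>Dyadic meshes, since \<open>refinement\<close> compares a step size only with its half,
  and since the resulting errors then form a geometric series.\<close>

definition mesh :: "nat \<Rightarrow> real" where "mesh j = \<delta> / 2 ^ j"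
definition idx :: "nat \<Rightarrow> real \<Rightarrow> nat" where "idx j t = nat \<lfloor>t / mesh j\<rfloor>"
definition U :: "nat \<Rightarrow> real \<Rightarrow> hinf" where "U j t = X (mesh j) (idx j t)"

lemma mesh_pos: "0 < mesh j" using \<delta> by (simp add: mesh_def)
lemma mesh_Suc: "mesh (Suc j) = mesh j / 2" by (simp add: mesh_def)

lemma idx_bounds:
  assumes "0 \<le> t"
  shows "real (idx j t) * mesh j \<le> t" "t < (real (idx j t) + 1) * mesh j"
proof -
  have "0 \<le> \<lfloor>t / mesh j\<rfloor>" using assms mesh_pos[of j] by simp
  then have "real (idx j t) = of_int \<lfloor>t / mesh j\<rfloor>" unfolding idx_def by simp
  then have "real (idx j t) \<le> t / mesh j" "t / mesh j < real (idx j t) + 1"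
    using floor_correct[of "t / mesh j"] by simp_all
  then show "real (idx j t) * mesh j \<le> t" "t < (real (idx j t) + 1) * mesh j"
    by (simp_all only: pos_le_divide_eq[OF mesh_pos] pos_divide_less_eq[OF mesh_pos])
qed

lemma adm_idx: "0 \<le> t \<Longrightarrow> t \<le> \<delta> \<Longrightarrow> adm (mesh j) (idx j t)"
  using idx_bounds(1)[of t j] mesh_pos[of j] by (simp add: adm_def)

lemma idx_mono: "s \<le> t \<Longrightarrow> idx j s \<le> idx j t"
  unfolding idx_def using mesh_pos[of j] by (intro nat_mono floor_mono divide_right_mono) auto

lemma idx_Suc: "idx (Suc j) t = 2 * idx j t \<or> idx (Suc j) t = 2 * idx j t + 1" if "0 \<le> t"
proof -
  let ?n = "real (idx j t)" and ?m = "real (idx (Suc j) t)" and ?h = "mesh j"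
  note b = idx_bounds[OF that, of j] idx_bounds[OF that, of "Suc j"]
  have "(2 * ?n) * ?h < (?m + 1) * ?h" "?m * ?h < (2 * ?n + 2) * ?h"
    using b unfolding mesh_Suc by (simp_all add: field_simps)
  then have "2 * ?n < ?m + 1" "?m < 2 * ?n + 2" using mesh_pos[of j] by (simp_all only: mult_less_cancel_right_pos)
  then show ?thesis by linarith
qed

lemma mesh_tendsto: "mesh \<longlonglongrightarrow> 0"
proof -
  have "(\<lambda>j. \<delta> * (1/2) ^ j) \<longlonglongrightarrow> 0"
    using tendsto_mult_right_zero[OF LIMSEQ_power_zero[of "1/2 :: real"], of \<delta>] by simp
  then show ?thesis by (simp add: mesh_def[abs_def] power_divide)
qed

lemma idx_tendsto:
  assumes "0 \<le> t"
  shows "(\<lambda>j. real (idx j t) * mesh j) \<longlonglongrightarrow> t"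
proof (rule Lim_null_comparison[THEN Lim_null[THEN iffD2]])
  show "eventually (\<lambda>j. norm (real (idx j t) * mesh j - t) \<le> mesh j) sequentially"
    using idx_bounds[OF assms] by (auto simp: algebra_simps abs_le_iff intro!: always_eventually less_imp_le)
qed (rule mesh_tendsto)

text \<open>In L2, passing from mesh \<open>j\<close> to \<open>Suc j\<close> costs the refinement
  error and at most one further half step, both of order \<open>mesh j\<close>, which is summable.
  Each higher order is interpolated between the preceding order and the uniform bound of the
  following one.\<close>

lemma U_Cauchy:
  assumes t: "0 \<le> t" "t \<le> \<delta>"
  shows "Cauchy (\<lambda>j. (dx ^^ n) (U j t))"
proof (induction n)
  case 0
  obtain C where C: "0 \<le> C" "\<And>\<tau> n. adm \<tau> n \<Longrightarrow> norm (X \<tau> n - X (\<tau> / 2) (2 * n)) \<le> C * \<tau>"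
    using refinement by blast
  obtain D where D: "0 \<le> D" "\<And>\<tau> n m. adm \<tau> (n + m) \<Longrightarrow> norm ((dx ^^ 0) (X \<tau> (n + m) - X \<tau> n)) \<le> D * (real m * \<tau>)"
    using traj_increment[of 0] by blast
  have "norm (U (Suc j) t - U j t) \<le> ((C + D) * \<delta>) * (1/2) ^ j" for j
  proof -
    let ?h = "mesh j" and ?n = "idx j t"
    have h: "0 < ?h" by (rule mesh_pos)
    have 1: "norm (X (?h / 2) (2 * ?n) - U j t) \<le> C * ?h"
      unfolding U_def using C(2)[OF adm_idx[OF t]] by (simp add: norm_minus_commute)
    have 2: "norm (U (Suc j) t - X (?h / 2) (2 * ?n)) \<le> D * ?h"
    proof -
      consider "idx (Suc j) t = 2 * ?n" | "idx (Suc j) t = 2 * ?n + 1" using idx_Suc[OF t(1)] by blast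
      then show ?thesis
      proof cases
        case 1
        then show ?thesis using D(1) h by (simp add: U_def mesh_Suc)
      next
        case 2
        have "norm ((dx ^^ 0) (X (?h / 2) (2 * ?n + 1) - X (?h / 2) (2 * ?n))) \<le> D * (real 1 * (?h / 2))"
          using adm_idx[OF t, of "Suc j"] unfolding 2 mesh_Suc by (rule D(2))
        also have "\<dots> \<le> D * ?h" using D(1) h by (intro mult_left_mono) auto
        finally show ?thesis unfolding U_def 2 mesh_Suc by (simp del: X_Suc)
      qed
    qed
    have "norm (U (Suc j) t - U j t) \<le> D * ?h + C * ?h"
      using norm_triangle_ineq[of "U (Suc j) t - X (?h / 2) (2 * ?n)" "X (?h / 2) (2 * ?n) - U j t"] 1 2 by simp
    then show ?thesis by (simp add: mesh_def power_divide algebra_simps add_divide_distrib)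
  qed
  from Cauchy_geometric[of "\<lambda>j. U j t", OF this] show ?case by simp
next
  case (Suc n)
  obtain A where A: "0 \<le> A" "\<And>i \<tau> m. i \<le> Suc (Suc n) \<Longrightarrow> adm \<tau> m \<Longrightarrow> norm ((dx ^^ i) (X \<tau> m)) \<le> A"
    using traj_bound[of "Suc (Suc n)"] by blast
  show ?case
  proof (rule CauchyI)
    fix e :: real assume e: "0 < e"
    then obtain N where N: "\<And>i j. i \<ge> N \<Longrightarrow> j \<ge> N \<Longrightarrow> norm ((dx ^^ n) (U i t) - (dx ^^ n) (U j t)) < e\<^sup>2 / (2 * A + 1)"
      using CauchyD[OF Suc, of "e\<^sup>2 / (2 * A + 1)"] A(1) by auto
    have "norm ((dx ^^ Suc n) (U i t) - (dx ^^ Suc n) (U j t)) < e" if ij: "i \<ge> N" "j \<ge> N" for i j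
    proof -
      let ?d = "(dx ^^ n) (U i t - U j t)"
      have A2: "norm (dx (dx ?d)) \<le> 2 * A"
      proof -
        have "norm (dx (dx ?d)) = norm ((dx ^^ Suc (Suc n)) (U i t) - (dx ^^ Suc (Suc n)) (U j t))" by (simp add: dxn_diff)
        also have "\<dots> \<le> A + A"
          unfolding U_def by (intro order_trans[OF norm_triangle_ineq4] add_mono A(2) adm_idx t) auto
        finally show ?thesis by simp
      qed
      have "(norm (dx ?d))\<^sup>2 \<le> norm ?d * norm (dx (dx ?d))" by (rule norm_dx_interpolation)
      also have "\<dots> \<le> norm ?d * (2 * A + 1)" using A2 by (intro mult_left_mono) auto
      also have "\<dots> < e\<^sup>2" using N[OF ij] A(1) by (simp add: dxn_diff field_simps)
      finally have "norm (dx ?d) < e" using e by (simp add: power2_less_imp_less)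
      then show ?thesis by (simp add: dxn_diff)
    qed
    then show "\<exists>M. \<forall>m\<ge>M. \<forall>na\<ge>M. norm ((dx ^^ Suc n) (U m t) - (dx ^^ Suc n) (U na t)) < e" by blast
  qed
qed

definition sol :: "real \<Rightarrow> hinf" where
  "sol t = (SOME L. tends (\<lambda>j. U j t) L sequentially)"

lemma U_tends: "0 \<le> t \<Longrightarrow> t \<le> \<delta> \<Longrightarrow> tends (\<lambda>j. U j t) (sol t) sequentially"
  unfolding sol_def
proof (rule someI_ex)
  assume t: "0 \<le> t" "t \<le> \<delta>"
  obtain L where "\<And>k. (\<lambda>j. (dx ^^ k) (U j t)) \<longlonglongrightarrow> (dx ^^ k) L"
    using hinf_complete[of "\<lambda>j. U j t", OF U_Cauchy[OF t]] by blast
  then show "\<exists>L. tends (\<lambda>j. U j t) L sequentially" unfolding tends_def by blast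
qed

lemma sol_0: "sol 0 = u1"
proof (rule LIMSEQ_unique)
  show "(\<lambda>j. U j 0) \<longlonglongrightarrow> sol 0" using U_tends[of 0] \<delta> by (intro tends_tendsto) auto
  show "(\<lambda>j. U j 0) \<longlonglongrightarrow> u1" by (simp add: U_def idx_def)
qed

lemma sol_lipschitz: obtains C where "0 \<le> C"
  "\<And>s t. 0 \<le> s \<Longrightarrow> s \<le> \<delta> \<Longrightarrow> 0 \<le> t \<Longrightarrow> t \<le> \<delta> \<Longrightarrow> norm ((dx ^^ n) (sol t - sol s)) \<le> C * \<bar>t - s\<bar>"
proof -
  obtain C where C: "0 \<le> C" "\<And>\<tau> i m. adm \<tau> (i + m) \<Longrightarrow> norm ((dx ^^ n) (X \<tau> (i + m) - X \<tau> i)) \<le> C * (real m * \<tau>)"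
    using traj_increment[of n] by blast
  have le: "norm ((dx ^^ n) (sol t - sol s)) \<le> C * (t - s)" if st: "0 \<le> s" "s \<le> t" "t \<le> \<delta>" for s t
  proof (rule LIMSEQ_le)
    show "(\<lambda>j. norm ((dx ^^ n) (U j t - U j s))) \<longlonglongrightarrow> norm ((dx ^^ n) (sol t - sol s))"
      unfolding dxn_diff using st by (intro tendsto_norm tendsto_diff tendsD U_tends) auto
    show "(\<lambda>j. C * (real (idx j t) * mesh j - real (idx j s) * mesh j)) \<longlonglongrightarrow> C * (t - s)"
      using st by (intro tendsto_intros idx_tendsto) auto
    have "norm ((dx ^^ n) (U j t - U j s)) \<le> C * (real (idx j t) * mesh j - real (idx j s) * mesh j)" for j
    proof -
      have i: "idx j t = idx j s + (idx j t - idx j s)" using idx_mono[OF st(2)] by simp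
      have "adm (mesh j) (idx j s + (idx j t - idx j s))" using adm_idx[of t j] st i by simp
      from C(2)[OF this] show ?thesis using idx_mono[OF st(2)] unfolding U_def
        by (simp add: of_nat_diff left_diff_distrib)
    qed
    then show "\<exists>N. \<forall>j\<ge>N. norm ((dx ^^ n) (U j t - U j s)) \<le> C * (real (idx j t) * mesh j - real (idx j s) * mesh j)" by blast
  qed
  have "norm ((dx ^^ n) (sol t - sol s)) \<le> C * \<bar>t - s\<bar>" if "0 \<le> s" "s \<le> \<delta>" "0 \<le> t" "t \<le> \<delta>" for s t
    using le[of s t] le[of t s] that by (cases "s \<le> t") (auto simp: dxn_diff norm_minus_commute)
  with C(1) that show ?thesis by blast
qed

lemma sol_consistent: obtains C where "0 \<le> C"
  "\<And>s t. 0 \<le> s \<Longrightarrow> s \<le> t \<Longrightarrow> t \<le> \<delta> \<Longrightarrow> norm (sol t - sol s - (t - s) *\<^sub>R vf k (sol s)) \<le> C * (t - s)\<^sup>2"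
proof -
  obtain C where C: "0 \<le> C" "\<And>\<tau> n m. adm \<tau> (n + m) \<Longrightarrow> norm (X \<tau> (n + m) - X \<tau> n - (real m * \<tau>) *\<^sub>R vf k (X \<tau> n)) \<le> C * (real m * \<tau>)\<^sup>2"
    using traj_consistent by blast
  have "norm (sol t - sol s - (t - s) *\<^sub>R vf k (sol s)) \<le> C * (t - s)\<^sup>2" if st: "0 \<le> s" "s \<le> t" "t \<le> \<delta>" for s t
  proof (rule LIMSEQ_le)
    let ?r = "\<lambda>j. real (idx j t) * mesh j - real (idx j s) * mesh j"
    show "(\<lambda>j. norm (U j t - U j s - ?r j *\<^sub>R vf k (U j s))) \<longlonglongrightarrow> norm (sol t - sol s - (t - s) *\<^sub>R vf k (sol s))"
      using st by (intro tendsto_intros idx_tendsto tends_tendsto[OF tends_vf[OF k]] tends_tendsto U_tends) auto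
    show "(\<lambda>j. C * (?r j)\<^sup>2) \<longlonglongrightarrow> C * (t - s)\<^sup>2"
      using st by (intro tendsto_intros idx_tendsto) auto
    have "norm (U j t - U j s - ?r j *\<^sub>R vf k (U j s)) \<le> C * (?r j)\<^sup>2" for j
    proof -
      have i: "idx j t = idx j s + (idx j t - idx j s)" using idx_mono[OF st(2)] by simp
      have "adm (mesh j) (idx j s + (idx j t - idx j s))" using adm_idx[of t j] st i by simp
      from C(2)[OF this] show ?thesis using idx_mono[OF st(2)] unfolding U_def
        by (simp add: of_nat_diff left_diff_distrib)
    qed
    then show "\<exists>N. \<forall>j\<ge>N. norm (U j t - U j s - ?r j *\<^sub>R vf k (U j s)) \<le> C * (?r j)\<^sup>2" by blast
  qed
  with C(1) that show ?thesis by blast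
qed

text \<open>Convergence of the difference quotient is shown in L2 from
  \<open>sol_consistent\<close>, then lifted by \<open>tends_zeroI\<close>: the quotients are
  bounded at each order because the solution is Lipschitz in time at each order.\<close>

theorem sol_HD:
  assumes t0: "0 \<le> t0" "t0 \<le> \<delta>"
  shows "HD {0..\<delta>} sol t0 (vf k (sol t0))"
proof -
  let ?F = "at t0 within {0..\<delta>}"
  let ?q = "\<lambda>t. (1 / (t - t0)) *\<^sub>R (sol t - sol t0) - vf k (sol t0)"
  have inF: "eventually (\<lambda>t. 0 \<le> t \<and> t \<le> \<delta> \<and> t \<noteq> t0) ?F" by (auto simp: eventually_at_filter)
  have abs0: "((\<lambda>t. \<bar>t - t0\<bar>) \<longlongrightarrow> 0) ?F"
    using tendsto_rabs_zero[OF Lim_null[THEN iffD1, OF tendsto_ident_at]] .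
  have cont: "tends sol (sol t0) ?F"
    unfolding tends_def
  proof
    fix n
    obtain C where C: "0 \<le> C" "\<And>s t. 0 \<le> s \<Longrightarrow> s \<le> \<delta> \<Longrightarrow> 0 \<le> t \<Longrightarrow> t \<le> \<delta> \<Longrightarrow> norm ((dx ^^ n) (sol t - sol s)) \<le> C * \<bar>t - s\<bar>"
      using sol_lipschitz by blast
    show "((\<lambda>t. (dx ^^ n) (sol t)) \<longlongrightarrow> (dx ^^ n) (sol t0)) ?F"
    proof (rule Lim_null_comparison[THEN Lim_null[THEN iffD2]])
      show "eventually (\<lambda>t. norm ((dx ^^ n) (sol t) - (dx ^^ n) (sol t0)) \<le> C * \<bar>t - t0\<bar>) ?F"
        using inF by eventually_elim (use C(2)[OF t0] in \<open>auto simp: dxn_diff\<close>)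
      show "((\<lambda>t. C * \<bar>t - t0\<bar>) \<longlongrightarrow> 0) ?F" using tendsto_mult_right_zero[OF abs0] .
    qed
  qed
  have "tends ?q 0 ?F"
  proof (rule tends_zeroI)
    obtain C where C: "0 \<le> C" "\<And>s t. 0 \<le> s \<Longrightarrow> s \<le> t \<Longrightarrow> t \<le> \<delta> \<Longrightarrow> norm (sol t - sol s - (t - s) *\<^sub>R vf k (sol s)) \<le> C * (t - s)\<^sup>2"
      using sol_consistent by blast
    let ?B = "\<lambda>t. C * \<bar>t - t0\<bar> + norm (vf k (sol t) - vf k (sol t0))"
    show "(?q \<longlongrightarrow> 0) ?F"
    proof (rule Lim_null_comparison)
      show "eventually (\<lambda>t. norm (?q t) \<le> ?B t) ?F"
        using inF
      proof eventually_elim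
        case (elim t)
        let ?Q = "sol t - sol t0 - (t - t0) *\<^sub>R vf k (sol t0)"
        have q: "?q t = (1 / (t - t0)) *\<^sub>R ?Q" using elim by (simp add: scaleR_diff_right)
        have "norm ?Q \<le> \<bar>t - t0\<bar> * ?B t"
        proof (cases "t0 \<le> t")
          case True
          then have "norm ?Q \<le> \<bar>t - t0\<bar> * (C * \<bar>t - t0\<bar>)" using C(2)[of t0 t] t0 elim by (simp add: power2_eq_square mult_ac)
          also have "\<dots> \<le> \<bar>t - t0\<bar> * ?B t" by (intro mult_left_mono) auto
          finally show ?thesis .
        next
          \<comment> \<open>To the left of \<open>t0\<close> the expansion is based at
            \<open>t\<close>; continuity of the vector field along the solution exchanges
            \<open>vf k (sol t)\<close> for \<open>vf k (sol t0)\<close>.\<close>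
          case False
          have e: "?Q = - (sol t0 - sol t - (t0 - t) *\<^sub>R vf k (sol t)) + (t - t0) *\<^sub>R (vf k (sol t) - vf k (sol t0))"
            by (simp add: algebra_simps)
          have "norm ?Q \<le> norm (sol t0 - sol t - (t0 - t) *\<^sub>R vf k (sol t)) + \<bar>t - t0\<bar> * norm (vf k (sol t) - vf k (sol t0))"
            unfolding e by (rule order_trans[OF norm_triangle_ineq]) (simp add: norm_minus_commute)
          also have "norm (sol t0 - sol t - (t0 - t) *\<^sub>R vf k (sol t)) \<le> C * (t0 - t)\<^sup>2"
            using C(2)[of t t0] False elim t0 by simp
          also have "C * (t0 - t)\<^sup>2 = \<bar>t - t0\<bar> * (C * \<bar>t - t0\<bar>)" using False by (simp add: power2_eq_square mult_ac)
          finally show ?thesis by (simp add: algebra_simps)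
        qed
        then have "norm ((1 / (t - t0)) *\<^sub>R ?Q) \<le> (1 / \<bar>t - t0\<bar>) * (\<bar>t - t0\<bar> * ?B t)"
          unfolding norm_scaleR by (intro mult_mono) auto
        also have "\<dots> = ?B t" using elim by simp
        finally show ?case unfolding q .
      qed
      have "(?B \<longlongrightarrow> C * 0 + norm (vf k (sol t0) - vf k (sol t0))) ?F"
        by (intro tendsto_intros abs0 tends_tendsto[OF tends_vf[OF k cont]])
      then show "(?B \<longlongrightarrow> 0) ?F" by simp
    qed
    \<comment> \<open>\<open>tends_zeroI\<close> wants the bounds as one function of the order, so
      \<open>SOME\<close> selects a Lipschitz constant for each \<open>n\<close>.\<close>
    show "eventually (\<lambda>t. norm ((dx ^^ n) (?q t)) \<le> (SOME C. \<forall>t. 0 \<le> t \<and> t \<le> \<delta> \<longrightarrow> norm ((dx ^^ n) (sol t - sol t0)) \<le> C * \<bar>t - t0\<bar>) + norm ((dx ^^ n) (vf k (sol t0)))) ?F" for n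
    proof -
      let ?C = "SOME C. \<forall>t. 0 \<le> t \<and> t \<le> \<delta> \<longrightarrow> norm ((dx ^^ n) (sol t - sol t0)) \<le> C * \<bar>t - t0\<bar>"
      have "\<exists>C. \<forall>t. 0 \<le> t \<and> t \<le> \<delta> \<longrightarrow> norm ((dx ^^ n) (sol t - sol t0)) \<le> C * \<bar>t - t0\<bar>"
        using sol_lipschitz[of n] t0 by metis
      from someI_ex[OF this] have C: "norm ((dx ^^ n) (sol t - sol t0)) \<le> ?C * \<bar>t - t0\<bar>" if "0 \<le> t" "t \<le> \<delta>" for t
        using that by blast
      show ?thesis
        using inF
      proof eventually_elim
        case (elim t)
        have e: "(dx ^^ n) (?q t) = (1 / (t - t0)) *\<^sub>R (dx ^^ n) (sol t - sol t0) - (dx ^^ n) (vf k (sol t0))"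
          by (simp add: dxn_diff dxn_scaleR)
        have "norm ((1 / (t - t0)) *\<^sub>R (dx ^^ n) (sol t - sol t0)) \<le> (1 / \<bar>t - t0\<bar>) * (?C * \<bar>t - t0\<bar>)"
          unfolding norm_scaleR using C[of t] elim by (intro mult_mono) auto
        also have "\<dots> = ?C" using elim by simp
        finally show ?case unfolding e by (intro order_trans[OF norm_triangle_ineq4] add_mono) auto
      qed
    qed
  qed
  from tends_add[OF this tends_const[of "vf k (sol t0)"]] show ?thesis unfolding HD_def by simp
qed

end

text \<open>The time \<open>\<delta>\<close> is fixed before \<open>u1\<close>: it solves
  \<open>exp ((2 * M + L1 k) * \<delta>) = 2\<close> and ignores the size of \<open>u1\<close>
  itself, which only enters the Courant constant, that is, the ratio of space and time steps.
  Continuation depends on this uniformity.\<close>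

theorem local_existence:
  assumes k: "integrable lborel k" and M: "0 < M"
  obtains \<delta> where "0 < \<delta>" "\<And>u1. (\<And>x. \<bar>ev (dx u1) x\<bar> \<le> M) \<Longrightarrow>
    \<exists>u. u 0 = u1 \<and> (\<forall>t\<in>{0..\<delta>}. HD {0..\<delta>} u t (vf k (u t)))"
proof -
  define \<delta> where "\<delta> = ln 2 / (2 * M + L1 k)"
  have pos: "0 < 2 * M + L1 k" using M L1_nonneg[of k] by linarith
  then have \<delta>: "0 < \<delta>" by (simp add: \<delta>_def)
  have "\<exists>u. u 0 = u1 \<and> (\<forall>t\<in>{0..\<delta>}. HD {0..\<delta>} u t (vf k (u t)))" if u1: "\<And>x. \<bar>ev (dx u1) x\<bar> \<le> M" for u1
  proof -
    obtain B where B: "\<And>x. \<bar>ev u1 x\<bar> \<le> B" "0 \<le> B" using ev_bounded by blast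
    \<comment> \<open>The exponential compensates the factor demanded of \<open>u1\<close>; adding 1
      keeps the constant positive when \<open>B = 0\<close>.\<close>
    interpret lax_friedrichs k u1 "(B + 1) * exp (L1 k * \<delta>)" M \<delta>
    proof
      show "0 < (B + 1) * exp (L1 k * \<delta>)" using B(2) by (intro mult_pos_pos) auto
      show "\<bar>ev u1 x\<bar> \<le> (B + 1) * exp (L1 k * \<delta>) * exp (- (L1 k * \<delta>))" for x
        using B(1)[of x] by (simp add: mult.assoc flip: exp_add)
      show "exp ((2 * M + L1 k) * \<delta>) \<le> 2" using pos by (simp add: \<delta>_def)
    qed (use k M \<delta> u1 in auto)
    from sol_0 sol_HD show ?thesis by (intro exI[of _ sol]) auto
  qed
  with \<delta> that show ?thesis by blast
qed

subsection \<open>Differentiable curves in \<open>H\<^sup>\<infinity>\<close>, uniqueness and continuation\<close>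

lemma H_infty_ev: "ev g \<in> H_infty"
  by (rule sobolev_norm_sq_smooth(1)[OF sq_smooth_ev])

lemma sobolev_norm_lower: "norm ((dx ^^ n) g) \<le> sobolev_norm (real n) (ev g)"
proof -
  have "norm ((dx ^^ n) g) = sqrt ((norm ((dx ^^ n) g))\<^sup>2)" by simp
  also have "\<dots> \<le> sqrt (2 * pi * (norm ((dx ^^ n) g))\<^sup>2)"
    using pi_gt3 by (intro real_sqrt_le_mono) (auto simp: mult_le_cancel_right1)
  also have "\<dots> \<le> sobolev_norm (real n) (ev g)"
    using sobolev_norm_sq_smooth(2)[OF sq_smooth_ev, of n g] by (simp add: norm_hinf_sq ev_dx_funpow)
  finally show ?thesis .
qed

lemma sobolev_norm_nonneg: "0 \<le> sobolev_norm s f"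
  unfolding sobolev_norm_def by (intro real_sqrt_ge_zero integral_nonneg_AE) auto

lemma sobolev_norm_upper:
  assumes "s \<le> real n"
  shows "sobolev_norm s (ev g) \<le> sqrt (2 ^ n * (2 * pi * (norm g)\<^sup>2 + 2 * pi * (norm ((dx ^^ n) g))\<^sup>2))"
  using sobolev_norm_sq_smooth(3)[OF sq_smooth_ev assms, of g] by (simp add: norm_hinf_sq ev_dx_funpow)

lemma tends_zero_iff_sobolev:
  "tends q 0 F \<longleftrightarrow> (\<forall>s\<ge>0. ((\<lambda>\<tau>. sobolev_norm s (ev (q \<tau>))) \<longlongrightarrow> 0) F)"
proof
  assume q: "tends q 0 F"
  have n: "((\<lambda>\<tau>. norm ((dx ^^ n) (q \<tau>))) \<longlongrightarrow> 0) F" for n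
    using tendsto_norm_zero[of "\<lambda>\<tau>. (dx ^^ n) (q \<tau>)"] tendsD[OF q, of n] by simp
  show "\<forall>s\<ge>0. ((\<lambda>\<tau>. sobolev_norm s (ev (q \<tau>))) \<longlongrightarrow> 0) F"
  proof (intro allI impI)
    fix s :: real
    obtain m :: nat where m: "s \<le> real m" using real_arch_simple by blast
    let ?B = "\<lambda>\<tau>. sqrt (2 ^ m * (2 * pi * (norm (q \<tau>))\<^sup>2 + 2 * pi * (norm ((dx ^^ m) (q \<tau>)))\<^sup>2))"
    show "((\<lambda>\<tau>. sobolev_norm s (ev (q \<tau>))) \<longlongrightarrow> 0) F"
    proof (rule Lim_null_comparison[where g="?B"])
      have "(?B \<longlongrightarrow> sqrt (2 ^ m * (2 * pi * 0\<^sup>2 + 2 * pi * 0\<^sup>2))) F"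
        by (intro tendsto_intros n n[of 0, simplified])
      then show "(?B \<longlongrightarrow> 0) F" by simp
      show "eventually (\<lambda>\<tau>. norm (sobolev_norm s (ev (q \<tau>))) \<le> ?B \<tau>) F"
        using sobolev_norm_upper[OF m] by (auto simp: sobolev_norm_nonneg intro!: always_eventually)
    qed
  qed
next
  assume s: "\<forall>s\<ge>0. ((\<lambda>\<tau>. sobolev_norm s (ev (q \<tau>))) \<longlongrightarrow> 0) F"
  show "tends q 0 F" unfolding tends_def
  proof
    fix n
    have "((\<lambda>\<tau>. (dx ^^ n) (q \<tau>)) \<longlongrightarrow> 0) F"
      by (rule Lim_null_comparison[where g="\<lambda>\<tau>. sobolev_norm (real n) (ev (q \<tau>))"])
         (use s sobolev_norm_lower in auto)
    then show "((\<lambda>\<tau>. (dx ^^ n) (q \<tau>)) \<longlongrightarrow> (dx ^^ n) 0) F" by simp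
  qed
qed

lemma HD_sobolev:
  "HD I V t v \<longleftrightarrow> (\<forall>s\<ge>0. ((\<lambda>\<tau>. sobolev_norm s (ev ((1 / (\<tau> - t)) *\<^sub>R (V \<tau> - V t) - v))) \<longlongrightarrow> 0) (at t within I))"
proof -
  have "HD I V t v \<longleftrightarrow> tends (\<lambda>\<tau>. (1 / (\<tau> - t)) *\<^sub>R (V \<tau> - V t) - v) 0 (at t within I)"
    unfolding HD_def
    using tends_diff[OF _ tends_const[of v], of "\<lambda>\<tau>. (1 / (\<tau> - t)) *\<^sub>R (V \<tau> - V t)" v]
      tends_add[OF _ tends_const[of v], of "\<lambda>\<tau>. (1 / (\<tau> - t)) *\<^sub>R (V \<tau> - V t) - v" 0] by auto
  then show ?thesis by (simp only: tends_zero_iff_sobolev)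
qed

lemma ev_quotient:
  "(\<lambda>x. (ev f x - ev g x) / (\<tau> - t) - ev h x) = ev ((1 / (\<tau> - t)) *\<^sub>R (f - g) - h)"
  by (rule ext) simp

lemma smooth_curve_HD:
  assumes "smooth_H_infty_curve I u"
  obtains V where "\<And>t. t \<in> I \<Longrightarrow> u t = ev (V 0 t)" "\<And>k t. t \<in> I \<Longrightarrow> HD I (V k) t (V (Suc k) t)"
proof -
  obtain v where v0: "\<forall>t\<in>I. v 0 t = u t" and vH: "\<And>k t. t \<in> I \<Longrightarrow> v k t \<in> H_infty"
    and vD: "\<And>k t s. t \<in> I \<Longrightarrow> 0 \<le> s \<Longrightarrow> ((\<lambda>\<tau>. sobolev_norm s (\<lambda>x. (v k \<tau> x - v k t x) / (\<tau> - t) - v (Suc k) t x)) \<longlongrightarrow> 0) (at t within I)"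
    using assms unfolding smooth_H_infty_curve_def by blast
  define V where "V k t = Hinf (v k t)" for k t
  have V: "v k t = ev (V k t)" if "t \<in> I" for k t
    using Hinf_inverse[of "v k t"] H_infty_imp_sq_smooth[OF vH[OF that]] by (simp add: V_def)
  have "HD I (V k) t (V (Suc k) t)" if t: "t \<in> I" for k t
    unfolding HD_sobolev
  proof (intro allI impI)
    fix s :: real assume s: "0 \<le> s"
    show "((\<lambda>\<tau>. sobolev_norm s (ev ((1 / (\<tau> - t)) *\<^sub>R (V k \<tau> - V k t) - V (Suc k) t))) \<longlongrightarrow> 0) (at t within I)"
    proof (rule Lim_transform_eventually[OF vD[OF t s, of k]])
      show "eventually (\<lambda>\<tau>. sobolev_norm s (\<lambda>x. (v k \<tau> x - v k t x) / (\<tau> - t) - v (Suc k) t x)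
        = sobolev_norm s (ev ((1 / (\<tau> - t)) *\<^sub>R (V k \<tau> - V k t) - V (Suc k) t))) (at t within I)"
        unfolding eventually_at_filter by (auto intro!: always_eventually simp: V t simp flip: ev_quotient)
    qed
  qed
  with that[of V] v0 V show ?thesis by simp
qed

lemma HD_smooth_curve:
  assumes "\<And>t. t \<in> I \<Longrightarrow> u t = ev (V 0 t)" "\<And>k t. t \<in> I \<Longrightarrow> HD I (V k) t (V (Suc k) t)"
  shows "smooth_H_infty_curve I u"
  unfolding smooth_H_infty_curve_def
proof (intro exI[of _ "\<lambda>k t. ev (V k t)"] conjI allI ballI impI)
  fix k t and s :: real assume "t \<in> I" "0 \<le> s"
  then show "((\<lambda>\<tau>. sobolev_norm s (\<lambda>x. (ev (V k \<tau>) x - ev (V k t) x) / (\<tau> - t) - ev (V (Suc k) t) x)) \<longlongrightarrow> 0) (at t within I)"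
    using assms(2)[of t k] unfolding HD_sobolev ev_quotient by blast
qed (use assms H_infty_ev in auto)

section \<open>Calculus of differentiable curves\<close>

lemma HD_continuous:
  assumes "HD I V t v" shows "tends V (V t) (at t within I)"
proof -
  have "((\<lambda>\<tau>. \<tau> - t) \<longlongrightarrow> 0) (at t within I)"
    using Lim_null[THEN iffD1, OF tendsto_ident_at[of t I]] .
  from tends_add[OF tends_scaleR[OF assms[unfolded HD_def] this] tends_const[of "V t"]]
  have "tends (\<lambda>\<tau>. (\<tau> - t) *\<^sub>R ((1 / (\<tau> - t)) *\<^sub>R (V \<tau> - V t)) + V t) (V t) (at t within I)" by simp
  then show ?thesis
    by (rule tends_cong[THEN iffD1, rotated]) (auto simp: eventually_at_filter)
qed

lemma HD_diff: "HD I f t a \<Longrightarrow> HD I g t b \<Longrightarrow> HD I (\<lambda>\<tau>. f \<tau> - g \<tau>) t (a - b)"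
  unfolding HD_def by (drule (1) tends_diff) (simp add: algebra_simps)

lemma HD_scaleR: "HD I f t a \<Longrightarrow> HD I (\<lambda>\<tau>. c *\<^sub>R f \<tau>) t (c *\<^sub>R a)"
  unfolding HD_def by (drule tends_scaleR[OF _ tendsto_const[of c]]) (simp add: algebra_simps)

lemma HD_minus: "HD I f t a \<Longrightarrow> HD I (\<lambda>\<tau>. - f \<tau>) t (- a)"
  using HD_scaleR[of I f t a "-1"] by simp

lemma HD_dx: "HD I f t a \<Longrightarrow> HD I (\<lambda>\<tau>. dx (f \<tau>)) t (dx a)"
  unfolding HD_def by (drule tends_dx) simp

lemma HD_conv: "integrable lborel k \<Longrightarrow> HD I f t a \<Longrightarrow> HD I (\<lambda>\<tau>. conv k (f \<tau>)) t (conv k a)"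
  unfolding HD_def using tends_conv[of k "\<lambda>\<tau>. (1 / (\<tau> - t)) *\<^sub>R (f \<tau> - f t)" a]
  by (simp add: conv_scaleR conv_diff)

lemma HD_sum: "(\<And>i. i \<in> A \<Longrightarrow> HD I (f i) t (a i)) \<Longrightarrow> HD I (\<lambda>\<tau>. \<Sum>i\<in>A. f i \<tau>) t (\<Sum>i\<in>A. a i)"
  unfolding HD_def
  by (drule tends_sum) (simp add: scaleR_sum_right[symmetric] sum_subtractf)

lemma HD_mult:
  assumes f: "HD I f t a" and g: "HD I g t b"
  shows "HD I (\<lambda>\<tau>. f \<tau> * g \<tau>) t (a * g t + f t * b)"
proof -
  have "tends (\<lambda>\<tau>. ((1 / (\<tau> - t)) *\<^sub>R (f \<tau> - f t)) * g \<tau> + f t * ((1 / (\<tau> - t)) *\<^sub>R (g \<tau> - g t))) (a * g t + f t * b) (at t within I)"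
    using f g by (intro tends_add tends_mult tends_const HD_continuous[OF g]) (auto simp: HD_def)
  then show ?thesis unfolding HD_def by (simp add: algebra_simps)
qed

lemma tends_sup:
  assumes "tends q a F" "0 < e"
  shows "eventually (\<lambda>\<tau>. \<forall>x. \<bar>ev (q \<tau>) x - ev a x\<bar> < e) F"
proof -
  have n: "((\<lambda>\<tau>. norm ((dx ^^ n) (q \<tau>) - (dx ^^ n) a)) \<longlongrightarrow> 0) F" for n
    using tendsto_norm_zero[OF Lim_null[THEN iffD1, OF tendsD[OF assms(1), of n]]] .
  have "((\<lambda>\<tau>. 2 * (norm (q \<tau> - a) + norm (dx (q \<tau> - a)))) \<longlongrightarrow> 2 * (0 + 0)) F"
    using n[of 0] n[of 1] by (intro tendsto_intros) auto
  then have "eventually (\<lambda>\<tau>. 2 * (norm (q \<tau> - a) + norm (dx (q \<tau> - a))) < e) F"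
    using assms(2) by (auto dest: order_tendstoD(2))
  then show ?thesis
  proof eventually_elim
    case (elim \<tau>)
    then show ?case using ev_le_norm[of "q \<tau> - a"] by (auto intro: le_less_trans)
  qed
qed

lemma HD_ev:
  assumes "HD I V t v"
  shows "((\<lambda>\<tau>. ev (V \<tau>) x) has_real_derivative ev v x) (at t within I)"
proof -
  have "((\<lambda>\<tau>. ev ((1 / (\<tau> - t)) *\<^sub>R (V \<tau> - V t)) x) \<longlongrightarrow> ev v x) (at t within I)"
  proof (rule tendstoI)
    fix e :: real assume "0 < e"
    from tends_sup[OF assms[unfolded HD_def] this]
    show "eventually (\<lambda>\<tau>. dist (ev ((1 / (\<tau> - t)) *\<^sub>R (V \<tau> - V t)) x) (ev v x) < e) (at t within I)"
      by (rule eventually_mono) (simp only: dist_real_def)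
  qed
  then show ?thesis by (simp add: has_field_derivative_iff)
qed

lemma HD_local:
  assumes u: "HD I u t v" and S: "open S" "t \<in> S" "I \<inter> S = J \<inter> S" and w: "\<And>\<tau>. \<tau> \<in> J \<Longrightarrow> \<tau> \<in> S \<Longrightarrow> w \<tau> = u \<tau>" and t: "t \<in> J"
  shows "HD J w t v"
proof -
  have F: "at t within I = at t within J" by (rule at_within_nhd[OF S(2,1)]) (use S(3) in auto)
  have "eventually (\<lambda>\<tau>. \<tau> \<in> S) (at t within J)"
    using eventually_nhds_in_open[OF S(1,2)] by (auto simp: eventually_at_filter elim: eventually_mono)
  moreover have "eventually (\<lambda>\<tau>. \<tau> \<in> J) (at t within J)" by (auto simp: eventually_at_filter)
  ultimately have "eventually (\<lambda>\<tau>. (1 / (\<tau> - t)) *\<^sub>R (u \<tau> - u t) = (1 / (\<tau> - t)) *\<^sub>R (w \<tau> - w t)) (at t within J)"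
    by eventually_elim (use w t S(2) in simp)
  from tends_cong[OF this] u show ?thesis unfolding HD_def F by blast
qed

lemma HD_shift:
  assumes u: "HD I u (t - a) v" and J: "\<And>\<tau>. \<tau> \<in> J \<Longrightarrow> \<tau> - a \<in> I"
  shows "HD J (\<lambda>\<tau>. u (\<tau> - a)) t v"
proof -
  have f: "filterlim (\<lambda>\<tau>. \<tau> - a) (at (t - a) within I) (at t within J)"
    unfolding filterlim_at using J by (auto simp: eventually_at_filter intro!: tendsto_intros)
  show ?thesis
    unfolding HD_def tends_def
  proof
    fix n
    from filterlim_compose[OF tendsD[OF u[unfolded HD_def], of n] f]
    show "((\<lambda>\<tau>. (dx ^^ n) ((1 / (\<tau> - t)) *\<^sub>R (u (\<tau> - a) - u (t - a)))) \<longlongrightarrow> (dx ^^ n) v) (at t within J)" by simp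
  qed
qed

lemma HD_mono: "HD I u t v \<Longrightarrow> J \<subseteq> I \<Longrightarrow> HD J u t v"
  unfolding HD_def tends_def using tendsto_within_subset by blast

text \<open>The time derivatives that the equation dictates: Leibniz' rule applied to
  \<open>vf k w\<close>. They turn a curve known to be differentiable once into a witness for
  \<open>smooth_H_infty_curve\<close>.\<close>

fun time_derivs :: "(real \<Rightarrow> real) \<Rightarrow> (real \<Rightarrow> hinf) \<Rightarrow> nat \<Rightarrow> real \<Rightarrow> hinf" where
  "time_derivs k w 0 t = w t"
| "time_derivs k w (Suc n) t = - (\<Sum>i\<le>n. real (n choose i) *\<^sub>R (time_derivs k w i t * dx (time_derivs k w (n - i) t))) - conv k (time_derivs k w n t)"

lemma HD_time_derivs:
  assumes k: "integrable lborel k" and w: "\<And>t. t \<in> I \<Longrightarrow> HD I w t (vf k (w t))" and t: "t \<in> I"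
  shows "HD I (time_derivs k w n) t (time_derivs k w (Suc n) t)"
proof (induction n rule: less_induct)
  case (less n)
  let ?V = "time_derivs k w"
  show ?case
  proof (cases n)
    case 0
    have "?V (Suc 0) t = vf k (w t)" by (simp add: vf_def)
    then show ?thesis using w[OF t] 0 by (simp add: HD_def del: time_derivs.simps(2))
  next
    case (Suc m)
    have IH: "HD I (?V i) t (?V (Suc i) t)" if "i \<le> m" for i using less.IH[of i] that Suc by simp
    have "HD I (\<lambda>t. - (\<Sum>i\<le>m. real (m choose i) *\<^sub>R (?V i t * dx (?V (m - i) t))) - conv k (?V m t)) t
      (- (\<Sum>i\<le>m. real (m choose i) *\<^sub>R (?V (Suc i) t * dx (?V (m - i) t) + ?V i t * dx (?V (Suc (m - i)) t))) - conv k (?V (Suc m) t))"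
      by (intro HD_diff HD_minus HD_sum HD_scaleR HD_mult HD_dx HD_conv k IH) auto
    also have "(\<Sum>i\<le>m. real (m choose i) *\<^sub>R (?V (Suc i) t * dx (?V (m - i) t) + ?V i t * dx (?V (Suc (m - i)) t)))
      = (\<Sum>i\<le>Suc m. real (Suc m choose i) *\<^sub>R (?V i t * dx (?V (Suc m - i) t)))"
      by (rule leibniz_sum)
    finally show ?thesis unfolding Suc time_derivs.simps(2) .
  qed
qed

lemma HD_vf_smooth_curve:
  assumes "integrable lborel k" "\<And>t. t \<in> I \<Longrightarrow> HD I w t (vf k (w t))" "\<And>t. t \<in> I \<Longrightarrow> u t = ev (w t)"
  shows "smooth_H_infty_curve I u"
  by (rule HD_smooth_curve[where V="time_derivs k w"]) (use assms HD_time_derivs[OF assms(1,2)] in auto)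

lemma HD_norm_sq:
  assumes "HD I z t z'"
  shows "((\<lambda>\<tau>. (norm (z \<tau>))\<^sup>2) has_real_derivative 2 * inner z' (z t)) (at t within I)"
proof -
  have "((\<lambda>\<tau>. inner ((1 / (\<tau> - t)) *\<^sub>R (z \<tau> - z t)) (z \<tau> + z t)) \<longlongrightarrow> inner z' (z t + z t)) (at t within I)"
    by (intro tendsto_inner tendsto_add tendsto_const tends_tendsto HD_continuous[OF assms]) (use assms in \<open>simp add: HD_def\<close>)
  moreover have "inner ((1 / (\<tau> - t)) *\<^sub>R (z \<tau> - z t)) (z \<tau> + z t) = ((norm (z \<tau>))\<^sup>2 - (norm (z t))\<^sup>2) / (\<tau> - t)" for \<tau>
    by (simp add: power2_norm_eq_inner inner_add_right inner_diff_left inner_diff_right inner_commute)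
  ultimately show ?thesis by (simp add: has_field_derivative_iff inner_add_right)
qed

text \<open>Energy estimate for the difference. The term with a derivative of the difference is
  tamed by integration by parts, which moves it onto \<open>V\<close>; what remains is bounded by
  the squared norm, and an exponential factor makes the energy nonincreasing.\<close>

theorem HD_vf_unique:
  assumes k: "integrable lborel k" and ab: "a \<le> b"
    and V: "\<And>t. t \<in> {a..b} \<Longrightarrow> HD {a..b} V t (vf k (V t))" and W: "\<And>t. t \<in> {a..b} \<Longrightarrow> HD {a..b} W t (vf k (W t))"
    and eq: "V a = W a"
  shows "V b = W b"
proof -
  let ?z = "\<lambda>t. V t - W t"
  have z: "HD {a..b} ?z t (vf k (V t) - vf k (W t))" if "t \<in> {a..b}" for t by (intro HD_diff V W that)
  have c: "continuous_on {a..b} (\<lambda>t. (dx ^^ n) (V t))" "continuous_on {a..b} (\<lambda>t. (dx ^^ n) (W t))" for n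
    using tendsD[OF HD_continuous[OF V]] tendsD[OF HD_continuous[OF W]] by (auto simp: continuous_on_def)
  have "continuous_on {a..b} (\<lambda>t. 2 * (norm ((dx ^^ 1) (V t)) + norm ((dx ^^ 2) (V t))) + 2 * (norm ((dx ^^ 1) (W t)) + norm ((dx ^^ 2) (W t))))"
    by (intro continuous_intros c)
  from compact_continuous_image[OF this] obtain B where
    "\<forall>t\<in>{a..b}. \<bar>2 * (norm ((dx ^^ 1) (V t)) + norm ((dx ^^ 2) (V t))) + 2 * (norm ((dx ^^ 1) (W t)) + norm ((dx ^^ 2) (W t)))\<bar> \<le> B"
    by (auto dest!: compact_imp_bounded simp: bounded_iff)
  then have B: "2 * (norm (dx (V t)) + norm (dx (dx (V t)))) \<le> B" "2 * (norm (dx (W t)) + norm (dx (dx (W t)))) \<le> B" if "t \<in> {a..b}" for t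
  proof -
    have "2 * (norm (dx (V t)) + norm (dx (dx (V t)))) + 2 * (norm (dx (W t)) + norm (dx (dx (W t)))) \<le> B"
      using \<open>\<forall>t\<in>{a..b}. _\<close> that by (auto simp: numeral_2_eq_2 dest!: bspec[where x=t] abs_le_D1)
    moreover have "p \<le> B \<and> q \<le> B" if "p + q \<le> B" "0 \<le> p" "0 \<le> q" for p q :: real
      using add_increasing2[OF that(3) order_refl, of p] add_increasing[OF that(2) order_refl, of q] that(1)
      by (blast intro: order_trans)
    moreover have "0 \<le> 2 * (norm (dx (V t)) + norm (dx (dx (V t))))" "0 \<le> 2 * (norm (dx (W t)) + norm (dx (dx (W t))))" by simp_all
    ultimately show "2 * (norm (dx (V t)) + norm (dx (dx (V t)))) \<le> B" "2 * (norm (dx (W t)) + norm (dx (dx (W t)))) \<le> B"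
      by blast+
  qed
  \<comment> \<open>From doubling the energy identity: \<open>B\<close> from the term integrated by
    parts, \<open>2 * B\<close> from \<open>dx (W t)\<close>, and \<open>2 * L1 k\<close> from the
    convolution.\<close>
  define C where "C = 3 * B + 2 * L1 k"
  have bound: "2 * inner (vf k (V t) - vf k (W t)) (?z t) \<le> C * (norm (?z t))\<^sup>2" if t: "t \<in> {a..b}" for t
  proof -
    let ?zt = "?z t" and ?v = "V t" and ?w = "W t"
    have e: "vf k ?v - vf k ?w = - (?v * dx ?zt) - dx ?w * ?zt - conv k ?zt"
      by (simp add: vf_def conv_diff[OF k] algebra_simps)
    \<comment> \<open>Multiplication by \<open>?v\<close> is symmetric and \<open>dx\<close> skew,
      so the pairing equals its own negative up to a term in \<open>dx ?v\<close>.\<close>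
    have "inner (?v * dx ?zt) ?zt = inner (dx ?zt) (?v * ?zt)" by (rule inner_mult_left)
    also have "\<dots> = - inner ?zt (dx (?v * ?zt))" using inner_dx[of ?zt "?v * ?zt"] by simp
    also have "\<dots> = - inner (dx ?v * ?zt) ?zt - inner (?v * dx ?zt) ?zt"
      by (simp only: dx_mult inner_add_right inner_commute)
    finally have half: "2 * inner (?v * dx ?zt) ?zt = - inner (dx ?v * ?zt) ?zt" by linarith
    have cs: "\<bar>inner f ?zt\<bar> \<le> D * (norm ?zt)\<^sup>2" if "norm f \<le> D * norm ?zt" for f D
      using order_trans[OF Cauchy_Schwarz_ineq2 mult_right_mono[OF that norm_ge_zero[of ?zt]]] by (simp add: power2_eq_square mult.assoc)
    have 1: "\<bar>inner (dx ?v * ?zt) ?zt\<bar> \<le> B * (norm ?zt)\<^sup>2"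
      by (rule cs, rule norm_mult_bounded, rule order_trans[OF ev_le_norm B(1)[OF t]])
    have 2: "\<bar>inner (dx ?w * ?zt) ?zt\<bar> \<le> B * (norm ?zt)\<^sup>2"
      by (rule cs, rule norm_mult_bounded, rule order_trans[OF ev_le_norm B(2)[OF t]])
    have 3: "\<bar>inner (conv k ?zt) ?zt\<bar> \<le> L1 k * (norm ?zt)\<^sup>2" by (rule cs, rule norm_conv[OF k])
    have "2 * inner (vf k ?v - vf k ?w) ?zt = inner (dx ?v * ?zt) ?zt - 2 * inner (dx ?w * ?zt) ?zt - 2 * inner (conv k ?zt) ?zt"
    proof -
      have "2 * (- p - q - r) = s - 2 * q - 2 * r" if "2 * p = - s" for p q r s :: real
        using that by (simp add: right_diff_distrib)
      from this[OF half] show ?thesis unfolding e inner_diff_left inner_minus_left .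
    qed
    then show ?thesis using 1 2 3 unfolding C_def distrib_right by linarith
  qed
  let ?g = "\<lambda>t. (norm (?z t))\<^sup>2 * exp (- C * t)"
  have D: "(?g has_real_derivative (2 * inner (vf k (V t) - vf k (W t)) (?z t) - C * (norm (?z t))\<^sup>2) * exp (- C * t)) (at t within {a..b})"
    if "t \<in> {a..b}" for t
  proof -
    have "((\<lambda>t. exp (- C * t)) has_real_derivative exp (- C * t) * (- C)) (at t within {a..b})"
      by (auto intro!: derivative_eq_intros)
    from DERIV_mult[OF HD_norm_sq[OF z[OF that]] this] show ?thesis by (simp add: algebra_simps)
  qed
  have "?g b \<le> ?g a"
  proof (rule DERIV_nonpos_imp_decreasing_open[OF ab])
    fix x assume x: "a < x" "x < b"
    then have "at x within {a..b} = at x" by (intro at_within_interior) (simp add: interior_atLeastAtMost_real)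
    moreover have "(2 * inner (vf k (V x) - vf k (W x)) (?z x) - C * (norm (?z x))\<^sup>2) * exp (- C * x) \<le> 0"
      using bound[of x] x by (intro mult_nonpos_nonneg) auto
    ultimately show "\<exists>y. (?g has_real_derivative y) (at x) \<and> y \<le> 0" using D[of x] x by auto
  next
    show "continuous_on {a..b} ?g" using D DERIV_continuous by (fastforce simp: continuous_on_eq_continuous_within)
  qed
  then have "(norm (?z b))\<^sup>2 \<le> 0" using eq by (simp add: mult_le_0_iff)
  then show ?thesis by simp
qed

text \<open>A bound for u_x up to \<open>T\<close> gives the same existence time for every restart
  in \<open>{T0..<T}\<close>, so a restart less than this time before \<open>T\<close> reaches
  beyond \<open>T\<close>. Uniqueness lets the two pieces be glued.\<close>

theorem continuation:
  assumes k: "integrable lborel k" and T: "0 \<le> T0" "T0 < T"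
    and V: "\<And>t. t \<in> {0..<T} \<Longrightarrow> HD {0..<T} V t (vf k (V t))"
    and M: "\<And>t x. T0 \<le> t \<Longrightarrow> t < T \<Longrightarrow> \<bar>ev (dx (V t)) x\<bar> \<le> M"
  obtains T' W where "T < T'" "\<And>t. t \<in> {0..<T} \<Longrightarrow> W t = V t" "\<And>t. t \<in> {0..<T'} \<Longrightarrow> HD {0..<T'} W t (vf k (W t))"
proof -
  obtain \<delta> where \<delta>: "0 < \<delta>" and ex: "\<And>u1. (\<And>x. \<bar>ev (dx u1) x\<bar> \<le> max M 1) \<Longrightarrow>
    \<exists>u. u 0 = u1 \<and> (\<forall>t\<in>{0..\<delta>}. HD {0..\<delta>} u t (vf k (u t)))"
    by (rule local_existence[OF k, of "max M 1"], simp, blast)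
  define t1 where "t1 = max T0 (T - \<delta> / 2)"
  have t1: "0 \<le> t1" "T0 \<le> t1" "t1 < T" "T < t1 + \<delta>" using T \<delta> by (auto simp: t1_def)
  obtain u where u0: "u 0 = V t1" and u: "\<And>t. t \<in> {0..\<delta>} \<Longrightarrow> HD {0..\<delta>} u t (vf k (u t))"
    using ex[of "V t1"] M[OF t1(2,3)] by (auto simp: le_max_iff_disj)
  have agree: "V t = u (t - t1)" if t: "t1 \<le> t" "t < T" for t
  proof (rule HD_vf_unique[OF k t(1)])
    fix s assume s: "s \<in> {t1..t}"
    show "HD {t1..t} V s (vf k (V s))" by (rule HD_mono[OF V]) (use s t t1 in auto)
    show "HD {t1..t} (\<lambda>s. u (s - t1)) s (vf k (u (s - t1)))"
      by (rule HD_shift[OF u]) (use s t t1 in auto)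
  qed (simp add: u0)
  define W where "W t = (if t < T then V t else u (t - t1))" for t
  have "HD {0..<t1 + \<delta>} W t (vf k (W t))" if t: "t \<in> {0..<t1 + \<delta>}" for t
  proof (cases "t < T")
    case True
    have "HD {0..<t1 + \<delta>} W t (vf k (V t))"
      by (rule HD_local[OF V, of _ "{..<T}"]) (use True t t1 in \<open>auto simp: W_def\<close>)
    then show ?thesis using True by (simp add: W_def)
  next
    case False
    have 1: "HD {t1..<t1 + \<delta>} (\<lambda>s. u (s - t1)) t (vf k (u (t - t1)))"
      by (rule HD_shift[OF u]) (use False t t1 in auto)
    \<comment> \<open>The restarted piece is used on the open set \<open>{t1<..}\<close>, which
      extends to the left of \<open>T\<close>, where both pieces agree; so the derivative at
      \<open>T\<close> itself is two-sided.\<close>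
    have "HD {0..<t1 + \<delta>} W t (vf k (u (t - t1)))"
      by (rule HD_local[OF 1, of "{t1<..}"]) (use False t t1 agree in \<open>auto simp: W_def\<close>)
    then show ?thesis using False by (simp add: W_def)
  qed
  then show ?thesis using that[of "t1 + \<delta>" W] t1 by (auto simp: W_def)
qed

subsection \<open>Differential inequalities\<close>

text \<open>Real induction: at the infimum of the failures the property holds by closedness, and
  then it persists to the right, contradicting the infimum.\<close>

lemma interval_induct:
  fixes a b :: real
  assumes P0: "P a" and closed: "closed {t \<in> {a..b}. P t}"
    and step: "\<And>t. a \<le> t \<Longrightarrow> t < b \<Longrightarrow> P t \<Longrightarrow> \<exists>\<delta>>0. \<forall>s. t < s \<longrightarrow> s < t + \<delta> \<longrightarrow> P s"
    and t: "a \<le> t" "t \<le> b"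
  shows "P t"
proof (rule ccontr)
  assume "\<not> P t"
  define S where "S = {s \<in> {a..b}. \<not> P s}"
  have St: "t \<in> S" using t \<open>\<not> P t\<close> by (simp add: S_def)
  have bdd: "bdd_below S" by (rule bdd_belowI[of _ a]) (simp add: S_def)
  define m where "m = Inf S"
  have m: "a \<le> m" "m \<le> t" unfolding m_def using St bdd by (auto intro!: cInf_greatest cInf_lower simp: S_def)
  have below: "P s" if "a \<le> s" "s < m" for s
    using cInf_lower[OF _ bdd, of s] that m t by (fastforce simp: S_def m_def)
  have "P m"
  proof (cases "m = a")
    case False
    have "m \<in> closure {a..<m}" using False m by (subst closure_atLeastLessThan) auto
    also have "closure {a..<m} \<subseteq> {t \<in> {a..b}. P t}"
      using below m t by (intro closure_minimal closed) auto
    finally show ?thesis by simp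
  qed (use P0 in simp)
  have "m < b" using \<open>P m\<close> \<open>\<not> P t\<close> m t by (cases "m = t") auto
  then obtain \<delta> where \<delta>: "\<delta> > 0" "\<And>s. m < s \<Longrightarrow> s < m + \<delta> \<Longrightarrow> P s" using step[OF m(1) _ \<open>P m\<close>] by blast
  have "m + \<delta> \<le> Inf S"
  proof (rule cInf_greatest)
    fix s assume s: "s \<in> S"
    then have "m \<le> s" unfolding m_def by (intro cInf_lower bdd)
    then show "m + \<delta> \<le> s" using \<delta>(2)[of s] \<open>P m\<close> s by (cases "s = m") (auto simp: S_def not_less intro: ccontr)
  qed (use St in blast)
  then show False using \<delta>(1) by (simp add: m_def)
qed

text \<open>\<open>dini f t B\<close>: the upper right Dini derivative of \<open>f\<close> at \<open>t\<close> is at most \<open>B\<close>.\<close>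

definition dini :: "(real \<Rightarrow> real) \<Rightarrow> real \<Rightarrow> real \<Rightarrow> bool" where
  "dini f t B \<longleftrightarrow> (\<forall>e>0. \<forall>\<^sub>F s in at_right t. f s \<le> f t + (B + e) * (s - t))"

lemma diniD: "dini f t B \<Longrightarrow> 0 < e \<Longrightarrow> \<forall>\<^sub>F s in at_right t. f s \<le> f t + (B + e) * (s - t)"
  by (simp add: dini_def)

lemma dini_mono: "dini f t A \<Longrightarrow> A \<le> B \<Longrightarrow> dini f t B"
  unfolding dini_def
proof (intro allI impI)
  fix e :: real assume f: "\<forall>e>0. \<forall>\<^sub>F s in at_right t. f s \<le> f t + (A + e) * (s - t)" and "A \<le> B" "0 < e"
  have "\<forall>\<^sub>F s in at_right t. s > t" by (rule eventually_at_right_less)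
  with f[rule_format, OF \<open>0 < e\<close>] show "\<forall>\<^sub>F s in at_right t. f s \<le> f t + (B + e) * (s - t)"
  proof eventually_elim
    case (elim s)
    have "(A + e) * (s - t) \<le> (B + e) * (s - t)" using \<open>A \<le> B\<close> elim by (intro mult_right_mono) auto
    with elim show ?case by linarith
  qed
qed

lemma dini_add:
  assumes "dini f t A" "dini g t B"
  shows "dini (\<lambda>s. f s + g s) t (A + B)"
  unfolding dini_def
proof (intro allI impI)
  fix e :: real assume "0 < e"
  then have "0 < e / 2" by simp
  from diniD[OF assms(1) this] diniD[OF assms(2) this]
  show "\<forall>\<^sub>F s in at_right t. f s + g s \<le> f t + g t + (A + B + e) * (s - t)"
  proof eventually_elim
    case (elim s)
    have "(A + e / 2) * (s - t) + (B + e / 2) * (s - t) = (A + B + e) * (s - t)"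
      by (simp add: field_simps)
    with elim show ?case by linarith
  qed
qed

lemma dini_divide:
  assumes "dini f t B" "0 < c"
  shows "dini (\<lambda>s. f s / c) t (B / c)"
  unfolding dini_def
proof (intro allI impI)
  fix e :: real assume "0 < e"
  then have "0 < c * e" using assms(2) by simp
  from diniD[OF assms(1) this] show "\<forall>\<^sub>F s in at_right t. f s / c \<le> f t / c + (B / c + e) * (s - t)"
    by eventually_elim (use assms(2) in \<open>simp add: field_simps\<close>)
qed

lemma dini_DERIV:
  assumes "(f has_real_derivative D) (at_right t)"
  shows "dini f t D"
  unfolding dini_def
proof (intro allI impI)
  fix e :: real assume "0 < e"
  have "((\<lambda>s. (f s - f t) / (s - t)) \<longlongrightarrow> D) (at_right t)"
    using assms unfolding has_field_derivative_iff .
  then have "\<forall>\<^sub>F s in at_right t. (f s - f t) / (s - t) < D + e" using \<open>0 < e\<close> by (intro order_tendstoD) auto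
  moreover have "\<forall>\<^sub>F s in at_right t. s > t" by (rule eventually_at_right_less)
  ultimately show "\<forall>\<^sub>F s in at_right t. f s \<le> f t + (D + e) * (s - t)"
    by eventually_elim (simp add: pos_divide_less_eq)
qed

lemma dini_pos_part:
  assumes g: "dini g t B" and B: "B \<le> 0"
  shows "dini (\<lambda>s. max 0 (g s)) t (if 0 < g t then B else 0)"
  unfolding dini_def
proof (intro allI impI)
  fix e :: real assume e: "0 < e"
  have r: "\<forall>\<^sub>F s in at_right t. s > t" by (rule eventually_at_right_less)
  show "\<forall>\<^sub>F s in at_right t. max 0 (g s) \<le> max 0 (g t) + ((if 0 < g t then B else 0) + e) * (s - t)"
  proof (cases "0 < g t")
    case True
    have "((\<lambda>s. g t + (B + e) * (s - t)) \<longlongrightarrow> g t + (B + e) * (t - t)) (at_right t)" by (intro tendsto_intros)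
    then have "\<forall>\<^sub>F s in at_right t. 0 < g t + (B + e) * (s - t)" using True by (intro order_tendstoD) auto
    with diniD[OF g e] show ?thesis by eventually_elim (use True in auto)
  next
    case False
    from diniD[OF g e] r show ?thesis
    proof eventually_elim
      case (elim s)
      have "(B + e) * (s - t) \<le> e * (s - t)" "0 \<le> e * (s - t)" using B e elim by (auto intro!: mult_right_mono)
      with elim False have "g s \<le> e * (s - t)" by linarith
      with \<open>0 \<le> e * (s - t)\<close> False show ?case by simp
    qed
  qed
qed

text \<open>The Dini inequality bounds \<open>f s\<close> from above by a linear function, so
  monotonicity of \<open>G\<close> reduces the claim to the chain rule for that function.
  Monotonicity only below \<open>c\<close> suffices by continuity; for the logarithmic primitive
  below, \<open>c\<close> is -2.\<close>

lemma dini_compose: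
  assumes f: "dini f t B" and G: "(G has_real_derivative D) (at (f t))" and D: "0 < D"
    and mono: "\<And>x y. x \<le> y \<Longrightarrow> y < c \<Longrightarrow> G x \<le> G y" and c: "f t < c"
  shows "dini (\<lambda>s. G (f s)) t (D * B)"
  unfolding dini_def
proof (intro allI impI)
  fix e :: real assume e: "0 < e"
  define e' where "e' = e / (2 * D)"
  have e': "0 < e'" using e D by (simp add: e'_def)
  let ?y = "\<lambda>s. f t + (B + e') * (s - t)"
  have "((\<lambda>s. G (?y s)) has_real_derivative D * (B + e')) (at_right t)"
  proof -
    have "((\<lambda>s. ?y s) has_real_derivative (B + e')) (at_right t)" by (auto intro!: derivative_eq_intros)
    moreover have "(G has_real_derivative D) (at (?y t))" using G by simp
    ultimately show ?thesis using DERIV_chain2[of G D ?y t "B + e'" "{t<..}"] by blast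
  qed
  from diniD[OF dini_DERIV[OF this], of "e / 2"] e
  have 1: "\<forall>\<^sub>F s in at_right t. G (?y s) \<le> G (?y t) + (D * (B + e') + e / 2) * (s - t)" by simp
  have "(?y \<longlongrightarrow> f t + (B + e') * (t - t)) (at_right t)" by (intro tendsto_intros)
  then have "\<forall>\<^sub>F s in at_right t. ?y s < c" using c by (intro order_tendstoD) auto
  with 1 diniD[OF f e'] show "\<forall>\<^sub>F s in at_right t. G (f s) \<le> G (f t) + (D * B + e) * (s - t)"
  proof eventually_elim
    case (elim s)
    have "D * (B + e') + e / 2 = D * B + e" using D by (simp add: e'_def field_simps)
    with elim mono[OF elim(2,3)] show ?case by simp
  qed
qed

lemma dini_decreases: "dini f t B \<Longrightarrow> B < 0 \<Longrightarrow> \<forall>\<^sub>F s in at_right t. f s < f t"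
proof -
  assume f: "dini f t B" and B: "B < 0"
  have "\<forall>\<^sub>F s in at_right t. s > t" by (rule eventually_at_right_less)
  moreover have "\<forall>\<^sub>F s in at_right t. f s \<le> f t + (B + (- B / 2)) * (s - t)" by (rule diniD[OF f]) (use B in simp)
  ultimately show ?thesis
  proof eventually_elim
    case (elim s)
    have "(B + (- B / 2)) * (s - t) < 0" using B elim by (intro mult_neg_pos) auto
    with elim show ?case by linarith
  qed
qed

lemma dini_bound:
  assumes ab: "a \<le> b" and c: "continuous_on {a..b} f" and d: "\<And>t. a \<le> t \<Longrightarrow> t < b \<Longrightarrow> dini f t 0"
  shows "f b \<le> f a"
proof (rule field_le_epsilon)
  fix e :: real assume e: "0 < e"
  define e' where "e' = e / (b - a + 1)"
  have e': "0 < e'" using e ab by (simp add: e'_def)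
  have "f b \<le> f a + e' * (b - a)"
  proof (rule interval_induct[where P="\<lambda>t. f t \<le> f a + e' * (t - a)" and a=a and b=b])
    show "closed {t \<in> {a..b}. f t \<le> f a + e' * (t - a)}"
      by (intro continuous_on_closed_Collect_le c continuous_intros)
    fix t assume t: "a \<le> t" "t < b" "f t \<le> f a + e' * (t - a)"
    obtain u where u: "u > t" "\<And>s. t < s \<Longrightarrow> s < u \<Longrightarrow> f s \<le> f t + (0 + e') * (s - t)"
      using diniD[OF d[OF t(1,2)] e'] unfolding eventually_at_right_field by blast
    have "f s \<le> f a + e' * (s - a)" if "t < s" "s < t + (u - t)" for s
      using u(2)[of s] that t(3) by (simp add: algebra_simps)
    then show "\<exists>\<delta>>0. \<forall>s. t < s \<longrightarrow> s < t + \<delta> \<longrightarrow> f s \<le> f a + e' * (s - a)"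
      using u(1) by (intro exI[of _ "u - t"]) auto
  qed (use ab in auto)
  also have "e' * (b - a) \<le> e' * (b - a + 1)" using e' by (intro mult_left_mono) auto
  also have "\<dots> = e" using ab by (simp add: e'_def)
  finally show "f b \<le> f a + e" by simp
qed

text \<open>\<open>G\<close> is the travel time of \<open>m' = - m\<^sup>2 - 2 * m\<close>, the
  inequality for \<open>m1\<close> in the borderline case \<open>m2 = - m1\<close>; hence the
  logarithm in the bound.\<close>

lemma riccati_primitive:
  fixes m :: real
  defines "G \<equiv> \<lambda>m::real. 1 / 2 * ln (m / (2 + m))"
  assumes m: "m < -2"
  shows "(G has_real_derivative 1 / (m * (m + 2))) (at m)" "0 < G m" "\<And>x. x \<le> m \<Longrightarrow> G x \<le> G m"
proof -
  have q: "x / (2 + x) = 1 - 2 / (2 + x)" if "x < -2" for x :: real using that by (simp add: field_simps)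
  have q1: "1 < x / (2 + x)" if "x < -2" for x :: real
    unfolding q[OF that] using that by (simp add: divide_less_0_iff)
  show "0 < G m" unfolding G_def using q1[OF m] by simp
  show "G x \<le> G m" if "x \<le> m" for x
  proof -
    have "x / (2 + x) \<le> m / (2 + m)"
      using m that by (subst (1 2) q) (auto simp: field_simps)
    moreover have "0 < x / (2 + x)" by (rule less_trans[OF zero_less_one q1]) (use that m in simp)
    ultimately show ?thesis unfolding G_def by (intro mult_left_mono ln_mono) auto
  qed
  show "(G has_real_derivative 1 / (m * (m + 2))) (at m)"
    unfolding G_def using m q1[OF m]
    by (auto intro!: derivative_eq_intros simp: divide_simps) (auto simp: algebra_simps)
qed

text \<open>The functional \<open>t + G(m1) + (m1 + m2)\<^sup>+ / (2 a (a + 2))\<close> with \<open>a = m1 0\<close> does not increase along the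
  system, is bounded below by \<open>t\<close>, and equals the bound of the theorem at \<open>t = 0\<close>. It can fail to decrease strictly
  only where \<open>m1 + m2 = 0\<close>.\<close>

theorem riccati_lifespan:
  fixes m1 m2 :: "real \<Rightarrow> real"
  assumes T: "0 < T"
    and c1: "continuous_on {0..<T} m1" and c2: "continuous_on {0..<T} m2"
    and d1: "\<And>t. 0 \<le> t \<Longrightarrow> t < T \<Longrightarrow> m1 t < 0 \<Longrightarrow> dini m1 t (- (m1 t)\<^sup>2 + m2 t - m1 t)"
    and d2: "\<And>t. 0 \<le> t \<Longrightarrow> t < T \<Longrightarrow> m1 t < 0 \<Longrightarrow> dini m2 t (- (m2 t)\<^sup>2 + m2 t - m1 t)"
    and nonneg: "\<And>t. 0 \<le> t \<Longrightarrow> t < T \<Longrightarrow> 0 \<le> m2 t"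
    and a: "m1 0 < -2" and b: "m2 0 < (m1 0)\<^sup>2 + m1 0"
  shows "T < 1 / 2 * ln (m1 0 / (2 + m1 0)) + max 0 ((m1 0 + m2 0) / (2 * m1 0 * (2 + m1 0)))"
proof -
  let ?a = "m1 0"
  \<comment> \<open>The invariant region. There \<open>m2 < m1\<^sup>2 + m1\<close>, so
    \<open>m1\<close> decreases. If \<open>m2\<close> reaches \<open>max (m2 0) (- m1)\<close>,
    which exceeds 2, its rate is at most \<open>- m2\<^sup>2 + 2 * m2 < 0\<close>, so it cannot
    cross.\<close>
  let ?P = "\<lambda>t. m1 t \<le> ?a \<and> m2 t \<le> max (m2 0) (- m1 t)"
  have cont: "continuous_on {0..t} m1" "continuous_on {0..t} m2" if "t < T" for t
    using c1 c2 that by (auto elim!: continuous_on_subset)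
  have region: "m2 t < (m1 t)\<^sup>2 + m1 t" if "?P t" for t
  proof -
    have "?a\<^sup>2 + ?a \<le> (m1 t)\<^sup>2 + m1 t"
    proof -
      have "0 \<le> (?a - m1 t) * (- (?a + m1 t + 1))" using that a by (intro mult_nonneg_nonneg) auto
      then show ?thesis by (simp add: power2_eq_square algebra_simps)
    qed
    moreover have "- m1 t < (m1 t)\<^sup>2 + m1 t"
    proof -
      have "0 < (- m1 t) * (- (m1 t + 2))" using that a by (intro mult_pos_pos) auto
      then show ?thesis by (simp add: power2_eq_square algebra_simps)
    qed
    ultimately show ?thesis using that b by linarith
  qed
  have P: "?P t" if t: "0 \<le> t" "t < T" for t
  proof (rule interval_induct[where P="?P" and a=0 and b=t])
    have "{s \<in> {0..t}. ?P s} = {s \<in> {0..t}. m1 s \<le> ?a} \<inter> {s \<in> {0..t}. m2 s \<le> max (m2 0) (- m1 s)}" by auto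
    also have "closed \<dots>"
      by (intro closed_Int continuous_on_closed_Collect_le cont t continuous_intros)
    finally show "closed {s \<in> {0..t}. ?P s}" .
    fix s assume s: "0 \<le> s" "s < t" "?P s"
    have sT: "s < T" and neg: "m1 s < 0" using s t a by auto
    have 1: "\<forall>\<^sub>F r in at_right s. m1 r < m1 s"
      by (rule dini_decreases[OF d1[OF s(1) sT neg]]) (use region[OF s(3)] in linarith)
    have 2: "\<forall>\<^sub>F r in at_right s. m2 r \<le> max (m2 0) (- m1 s)"
    proof (cases "m2 s < max (m2 0) (- m1 s)")
      case True
      have "(m2 \<longlongrightarrow> m2 s) (at s within {0..t})" using cont(2)[OF t(2)] s by (auto simp: continuous_on_def)
      then have "\<forall>\<^sub>F r in at s within {0..t}. m2 r < max (m2 0) (- m1 s)" using True by (rule order_tendstoD)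
      moreover have "at_right s = at s within {s<..t}" using s by (intro at_within_nhd[of s "{..<t}"]) auto
      moreover have "at s within {s<..t} \<le> at s within {0..t}" using s by (intro at_le) auto
      ultimately show ?thesis by (auto simp: le_filter_def elim!: eventually_mono)
    next
      case False
      then have eq: "m2 s = max (m2 0) (- m1 s)" using s(3) by linarith
      have "- (m2 s)\<^sup>2 + m2 s - m1 s < 0"
      proof -
        have "2 < m2 s" "- m1 s \<le> m2 s" using eq s(3) a by linarith+
        then have "0 < m2 s * (m2 s - 2)" by (intro mult_pos_pos) auto
        then show ?thesis using \<open>- m1 s \<le> m2 s\<close> by (simp add: power2_eq_square algebra_simps)
      qed
      from dini_decreases[OF d2[OF s(1) sT neg] this] show ?thesis by eventually_elim (use eq in auto)
    qed
    from 1 2 have "\<forall>\<^sub>F r in at_right s. ?P r" by eventually_elim (use s(3) in auto)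
    then obtain u where u: "u > s" "\<And>r. s < r \<Longrightarrow> r < u \<Longrightarrow> ?P r" unfolding eventually_at_right_field by blast
    then show "\<exists>\<delta>>0. \<forall>r. s < r \<longrightarrow> r < s + \<delta> \<longrightarrow> ?P r" by (intro exI[of _ "u - s"]) auto
  qed (use t in auto)
  define c where "c = 2 * ?a * (2 + ?a)"
  have c0: "0 < c" unfolding c_def using a by (intro mult_neg_neg) auto
  define G where "G m = 1 / 2 * ln (m / (2 + m))" for m :: real
  define \<Phi> where "\<Phi> t = t + G (m1 t) + max 0 (m1 t + m2 t) / c" for t
  have small: "m1 t < -2" if "0 \<le> t" "t < T" for t using P[OF that] a by linarith
  have Gd: "dini (\<lambda>s. G (m1 s)) t (1 / (m1 t * (m1 t + 2)) * (- (m1 t)\<^sup>2 + m2 t - m1 t))" if t: "0 \<le> t" "t < T" for t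
    unfolding G_def
  proof (rule dini_compose[OF d1[OF t] riccati_primitive(1)[OF small[OF t]] _ riccati_primitive(3) small[OF t]])
    show "0 < 1 / (m1 t * (m1 t + 2))" using small[OF t] by (intro divide_pos_pos mult_neg_neg) auto
  qed (use small[OF t] in auto)
  have prod: "0 < m1 t * (m1 t + 2)" if "0 \<le> t" "t < T" for t using small[OF that] by (intro mult_neg_neg) auto
  \<comment> \<open>While \<open>m1 + m2 \<ge> 0\<close>, the second rate is at most
    \<open>- m1\<^sup>2 - 2 * m1\<close>, so the two rates add up to at most
    \<open>- 2 * m1 * (m1 + 2)\<close>, and this is at most \<open>- c\<close> because
    \<open>m1 \<le> ?a\<close>. It explains the denominator in the bound of the theorem.\<close>
  have sd: "dini (\<lambda>s. m1 s + m2 s) t (- c)" if t: "0 \<le> t" "t < T" and s: "0 \<le> m1 t + m2 t" for t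
  proof (rule dini_mono[OF dini_add[OF d1[OF t] d2[OF t]]])
    have "0 \<le> (m2 t + m1 t) * (m2 t - m1 t - 2)" using s small[OF t] by (intro mult_nonneg_nonneg) auto
    moreover have "0 \<le> (?a - m1 t) * (- (?a + m1 t + 2))" using P[OF t] a by (intro mult_nonneg_nonneg) auto
    ultimately show "- (m1 t)\<^sup>2 + m2 t - m1 t + (- (m2 t)\<^sup>2 + m2 t - m1 t) \<le> - c"
      unfolding c_def by (simp add: power2_eq_square algebra_simps)
  qed (use small[OF t] in auto)
  have \<Phi>d: "\<exists>B\<le>0. dini \<Phi> t B \<and> (m1 t + m2 t \<noteq> 0 \<longrightarrow> B < 0)" if t: "0 \<le> t" "t < T" for t
  proof -
    let ?B = "1 / (m1 t * (m1 t + 2)) * (- (m1 t)\<^sup>2 + m2 t - m1 t)"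
    have id: "dini (\<lambda>s. s) t 1" by (rule dini_DERIV) (rule DERIV_ident)
    have Bneg: "?B < 0" using prod[OF t] region[OF P[OF t]] by (intro mult_pos_neg) auto
    \<comment> \<open>The rate of \<open>t + G (m1 t)\<close> has the sign of
      \<open>m1 + m2\<close>. When that is positive, the last summand of \<open>\<Phi>\<close> falls
      at rate at least 1 and cancels the contribution of \<open>t\<close>, leaving
      \<open>?B < 0\<close>.\<close>
    have B1: "1 + ?B = (m1 t + m2 t) / (m1 t * (m1 t + 2))"
      using prod[OF t] by (simp add: field_simps power2_eq_square)
    consider "0 < m1 t + m2 t" | "m1 t + m2 t = 0" | "m1 t + m2 t < 0" by linarith
    then show ?thesis
    proof cases
      case 1
      have "dini (\<lambda>s. max 0 (m1 s + m2 s)) t (- c)"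
        using dini_pos_part[OF sd[OF t]] 1 c0 by simp
      from dini_add[OF dini_add[OF id Gd[OF t]] dini_divide[OF this c0]]
      have "dini \<Phi> t ?B" unfolding \<Phi>_def using c0 by simp
      with Bneg show ?thesis by (intro exI[of _ ?B]) auto
    next
      case 2
      have "dini (\<lambda>s. max 0 (m1 s + m2 s)) t 0"
        using dini_pos_part[OF sd[OF t]] 2 c0 by simp
      from dini_add[OF dini_add[OF id Gd[OF t]] dini_divide[OF this c0]]
      have "dini \<Phi> t 0" unfolding \<Phi>_def using B1 2 by simp
      with 2 show ?thesis by (intro exI[of _ 0]) auto
    next
      case 3
      obtain b where b: "t < b" "b < T" using t dense by blast
      have "((\<lambda>s. m1 s + m2 s) \<longlongrightarrow> m1 t + m2 t) (at t within {0..b})"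
        using cont[OF b(2)] t b by (intro tendsto_add) (auto simp: continuous_on_def)
      then have "\<forall>\<^sub>F s in at t within {0..b}. m1 s + m2 s < 0" using 3 by (rule order_tendstoD)
      moreover have "at_right t = at t within {t<..b}" using b by (intro at_within_nhd[of t "{..<b}"]) auto
      moreover have "at t within {t<..b} \<le> at t within {0..b}" using t by (intro at_le) auto
      ultimately have ev: "\<forall>\<^sub>F s in at_right t. m1 s + m2 s < 0" by (auto simp: le_filter_def)
      have "dini (\<lambda>s. max 0 (m1 s + m2 s)) t 0"
        unfolding dini_def
      proof (intro allI impI)
        fix e :: real assume "0 < e"
        have "\<forall>\<^sub>F s in at_right t. s > t" by (rule eventually_at_right_less)
        with ev show "\<forall>\<^sub>F s in at_right t. max 0 (m1 s + m2 s) \<le> max 0 (m1 t + m2 t) + (0 + e) * (s - t)"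
          by eventually_elim (use 3 \<open>0 < e\<close> in auto)
      qed
      from dini_add[OF dini_add[OF id Gd[OF t]] dini_divide[OF this c0]]
      have "dini \<Phi> t (1 + ?B)" unfolding \<Phi>_def by simp
      moreover have "1 + ?B < 0" unfolding B1 using 3 prod[OF t] by (simp add: divide_neg_pos)
      ultimately show ?thesis by (intro exI[of _ "1 + ?B"]) auto
    qed
  qed
  have \<Phi>c: "continuous_on {0..t} \<Phi>" if t: "t < T" for t
    unfolding \<Phi>_def G_def
  proof (intro continuous_intros cont t ballI)
    fix x assume "x \<in> {0..t}"
    then have "m1 x < -2" using small[of x] t by auto
    then show "2 + m1 x \<noteq> 0" "m1 x / (2 + m1 x) \<noteq> 0" by auto
  qed (use c0 in auto)
  have mono: "\<Phi> s \<le> \<Phi> r" if "0 \<le> r" "r \<le> s" "s < T" for r s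
  proof (rule dini_bound[OF that(2)])
    show "continuous_on {r..s} \<Phi>" using \<Phi>c[OF that(3)] that by (auto elim!: continuous_on_subset)
    show "dini \<Phi> t 0" if "r \<le> t" "t < s" for t
      using \<Phi>d[of t] dini_mono that \<open>0 \<le> r\<close> \<open>s < T\<close> by (meson le_less_trans less_trans order_trans)
  qed
  have lower: "t < \<Phi> t" if "0 \<le> t" "t < T" for t
  proof -
    have "0 < G (m1 t)" unfolding G_def by (rule riccati_primitive(2)[OF small[OF that]])
    moreover have "0 \<le> max 0 (m1 t + m2 t) / c" using c0 by simp
    ultimately show ?thesis unfolding \<Phi>_def by linarith
  qed
  \<comment> \<open>If \<open>m1 + m2\<close> vanishes at time 0, then by \<open>sd\<close> it
    becomes negative at once; so there is a time at which \<open>\<Phi>\<close> decreases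
    strictly.\<close>
  obtain t0 where t0: "0 \<le> t0" "t0 < T" "m1 t0 + m2 t0 \<noteq> 0"
  proof (cases "m1 0 + m2 0 = 0")
    case True
    have "dini (\<lambda>s. m1 s + m2 s) 0 (- c)" by (rule sd) (use T True in auto)
    from dini_decreases[OF this] c0 have "\<forall>\<^sub>F s in at_right 0. m1 s + m2 s < 0" using True by simp
    then obtain u where u: "u > 0" "\<And>s. 0 < s \<Longrightarrow> s < u \<Longrightarrow> m1 s + m2 s < 0" unfolding eventually_at_right_field by blast
    have "m1 (min u T / 2) + m2 (min u T / 2) < 0" using u T by (intro u(2)) auto
    moreover have "0 \<le> min u T / 2" "min u T / 2 < T" using u(1) T by (auto simp: min_def)
    ultimately show ?thesis using that[of "min u T / 2"] by simp
  qed (use T that[of 0] in auto)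
  obtain B where "dini \<Phi> t0 B" "B < 0" using \<Phi>d[OF t0(1,2)] t0(3) by blast
  from dini_decreases[OF this] obtain u where u: "u > t0" "\<And>s. t0 < s \<Longrightarrow> s < u \<Longrightarrow> \<Phi> s < \<Phi> t0"
    unfolding eventually_at_right_field by blast
  obtain t1 where t1: "t0 < t1" "t1 < u" "t1 < T" using dense[of t0 "min u T"] u(1) t0(2) by auto
  have "T \<le> \<Phi> t1"
  proof (rule ccontr)
    assume "\<not> T \<le> \<Phi> t1"
    then obtain s where s: "max (\<Phi> t1) t1 < s" "s < T" using dense[of "max (\<Phi> t1) t1" T] t1 by auto
    have "s < \<Phi> s" using s t0 t1 by (intro lower) auto
    also have "\<Phi> s \<le> \<Phi> t1" using s t0 t1 by (intro mono) auto
    finally show False using s by simp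
  qed
  also have "\<Phi> t1 < \<Phi> t0" using u(2) t1 by blast
  also have "\<Phi> t0 \<le> \<Phi> 0" using t0 by (intro mono) auto
  also have "\<Phi> 0 = 1 / 2 * ln (m1 0 / (2 + m1 0)) + max 0 ((m1 0 + m2 0) / (2 * m1 0 * (2 + m1 0)))"
    unfolding \<Phi>_def G_def c_def[symmetric] using c0 by (auto simp: max_def field_simps)
  finally show ?thesis .
qed

subsection \<open>Decreasing kernels\<close>

locale decreasing_kernel =
  fixes K :: "real \<Rightarrow> real"
  assumes K_smooth: "smooth K" and K_int: "integrable lborel K" and K_even: "\<And>x. K (- x) = K x"
    and K_anti: "antimono_on {0..} K" and K0: "K 0 = 1"
begin

abbreviation k :: "real \<Rightarrow> real" where "k \<equiv> deriv K"

lemma K_DERIV: "(K has_real_derivative k x) (at x)"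
  using smooth_DERIV[OF K_smooth, of 0 x] by simp

lemma k_isCont: "isCont k x"
  using smooth_isCont[OF K_smooth, where n=1] by simp

lemma k_measurable [measurable]: "k \<in> borel_measurable borel"
  by (intro borel_measurable_continuous_onI) (simp add: continuous_at_imp_continuous_on k_isCont)

lemma K_le: "0 \<le> x \<Longrightarrow> x \<le> y \<Longrightarrow> K y \<le> K x"
  using K_anti by (simp add: monotone_on_def)

text \<open>Monotonicity compares \<open>K\<close> on \<open>{x..z}\<close> with its end values, and
  integrability bounds the integral. The first bound forces decay at infinity, the second
  nonnegativity.\<close>

lemma K_integral_bounds:
  assumes "0 \<le> x" "x < z"
  shows "(z - x) * K z \<le> L1 K" "- L1 K \<le> (z - x) * K x"
proof -
  note [measurable] = borel_measurable_integrable[OF K_int]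
  have i: "integrable lborel (\<lambda>y. indicator {x..z} y * K y)"
    by (rule Bochner_Integration.integrable_bound[OF K_int]) (auto simp: indicator_def)
  have ic: "integrable lborel (\<lambda>y. indicator {x..z} y * C)" for C :: real
    using window_integrable[of "\<lambda>_. C" x z] by simp
  have "\<bar>LINT y|lborel. indicator {x..z} y * K y\<bar> \<le> (LINT y|lborel. \<bar>indicator {x..z} y * K y\<bar>)"
    by (rule integral_abs_bound)
  also have "\<dots> \<le> L1 K"
    unfolding L1_def by (intro integral_mono integrable_abs i K_int) (auto simp: indicator_def)
  finally have b: "\<bar>LINT y|lborel. indicator {x..z} y * K y\<bar> \<le> L1 K" .
  have c: "(LINT y|lborel. indicator {x..z} y * C) = (z - x) * C" for C using assms by simp
  have "(z - x) * K z \<le> (LINT y|lborel. indicator {x..z} y * K y)"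
    unfolding c[symmetric] by (intro integral_mono i ic) (use assms K_le in \<open>auto simp: indicator_def\<close>)
  then show "(z - x) * K z \<le> L1 K" using b by linarith
  have "(LINT y|lborel. indicator {x..z} y * K y) \<le> (z - x) * K x"
    unfolding c[symmetric] by (intro integral_mono i ic) (use assms K_le in \<open>auto simp: indicator_def\<close>)
  then show "- L1 K \<le> (z - x) * K x" using b by linarith
qed

lemma K_nonneg: "0 \<le> x \<Longrightarrow> 0 \<le> K x"
proof (rule ccontr)
  assume x: "0 \<le> x" "\<not> 0 \<le> K x"
  \<comment> \<open>Chosen so that \<open>(?z - x) * K x = - L1 K + K x\<close>, just below the
    lower bound \<open>- L1 K\<close>.\<close>
  let ?z = "x + (L1 K / (- K x) + 1)"
  have "0 \<le> L1 K / (- K x)" using x L1_nonneg[of K] by (intro divide_nonneg_pos) auto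
  then have "x < ?z" by linarith
  from K_integral_bounds(2)[OF x(1) this] have "- L1 K \<le> (?z - x) * K x" .
  also have "\<dots> = - L1 K + K x" using x by (simp add: field_simps)
  finally show False using x by simp
qed

lemma K_abs_le: "\<bar>K x\<bar> \<le> 1"
proof -
  have *: "\<bar>K y\<bar> \<le> 1" if "0 \<le> y" for y using K_nonneg[OF that] K_le[OF order_refl that] K0 by simp
  show ?thesis using *[of x] *[of "- x"] K_even[of x] by (cases "0 \<le> x") auto
qed

lemma K_tendsto: "(K \<longlongrightarrow> 0) at_top"
proof (rule tendsto_sandwich[OF _ _ tendsto_const])
  show "\<forall>\<^sub>F x in at_top. K x \<le> L1 K / x"
    using eventually_gt_at_top[of 0]
    by eventually_elim (use K_integral_bounds(1)[of 0] in \<open>simp add: pos_le_divide_eq mult.commute\<close>)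
  show "\<forall>\<^sub>F x in at_top. 0 \<le> K x" using eventually_ge_at_top[of 0] by eventually_elim (rule K_nonneg)
  show "((\<lambda>x. L1 K / x) \<longlongrightarrow> 0) at_top"
    by (rule tendsto_divide_0[OF tendsto_const filterlim_at_top_imp_at_infinity[OF filterlim_ident]])
qed

lemma k_nonpos: "0 \<le> x \<Longrightarrow> k x \<le> 0"
proof (rule ccontr)
  assume x: "0 \<le> x" "\<not> k x \<le> 0"
  then obtain d where d: "0 < d" "\<And>h. 0 < h \<Longrightarrow> h < d \<Longrightarrow> K x < K (x + h)"
    using DERIV_pos_inc_right[OF K_DERIV, of x] by auto
  show False using d(2)[of "d / 2"] d(1) K_le[of x "x + d / 2"] x by auto
qed

lemma k_odd: "k (- x) = - k x"
proof -
  have "((\<lambda>x. K (- x)) has_real_derivative k (- x) * (- 1)) (at x)"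
    by (rule DERIV_chain2[OF K_DERIV]) (auto intro!: derivative_eq_intros)
  then have "k (- x) * (- 1) = k x" using K_DERIV[of x] by (simp add: K_even DERIV_unique)
  then show ?thesis by simp
qed

lemma k_right: "has_bochner_integral lborel (\<lambda>x. indicator {0..} x * (- k x)) 1"
proof (rule has_bochner_integral_nn_integral)
  have "(\<integral>\<^sup>+ x. ennreal (- k x) * indicator {0..} x \<partial>lborel) = ennreal (0 - (- K 0))"
  proof (rule nn_integral_FTC_atLeast)
    show "((\<lambda>x. - K x) \<longlongrightarrow> 0) at_top" using tendsto_minus[OF K_tendsto] by simp
  qed (auto intro!: DERIV_minus K_DERIV simp: k_nonpos)
  moreover have "ennreal (indicator {0..} x * (- k x)) = ennreal (- k x) * indicator {0..} x" for x
    by (simp add: indicator_def)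
  ultimately show "(\<integral>\<^sup>+ x. ennreal (indicator {0..} x * (- k x)) \<partial>lborel) = ennreal 1"
    by (simp only: K0) simp
qed (auto simp: k_nonpos indicator_def)

lemma k_left: "has_bochner_integral lborel (\<lambda>x. indicator {..0} x * k x) 1"
proof -
  have e: "indicator {0..} (0 + (- 1) * x) * (- k (0 + (- 1) * x)) = indicator {..0} x * k x" for x
    by (simp add: k_odd indicator_def)
  have i: "integrable lborel (\<lambda>x. indicator {0..} x * (- k x))" and v: "(LINT x|lborel. indicator {0..} x * (- k x)) = 1"
    using k_right by (auto simp: has_bochner_integral_iff)
  show ?thesis
    using lborel_integrable_real_affine[OF i, of "-1" 0] v
      lborel_integral_real_affine[of "-1" "\<lambda>x. indicator {0..} x * (- k x)" 0]
    unfolding e has_bochner_integral_iff by simp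
qed

text \<open>Both indicators contain 0, which is harmless since the odd function \<open>k\<close>
  vanishes there.\<close>

lemma k_split: "k x = indicator {..0} x * k x - indicator {0..} x * (- k x)"
  using k_odd[of 0] by (simp add: indicator_def)

lemma k_integrable: "integrable lborel k"
proof -
  have "integrable lborel (\<lambda>x. indicator {..0} x * k x - indicator {0..} x * (- k x))"
    using k_left k_right by (intro Bochner_Integration.integrable_diff) (auto simp: has_bochner_integral_iff)
  then show ?thesis by (simp only: k_split[symmetric])
qed

text \<open>The two halves of the odd function \<open>K'\<close> have mass \<open>1\<close> each.\<close>

lemma conv_oscillation:
  assumes "\<And>x. a \<le> ev w x" "\<And>x. ev w x \<le> b"
  shows "- ev (conv k w) x \<le> b - a"
proof -
  have iL: "integrable lborel (\<lambda>z. indicator {..0} z * k z)" "(LINT z|lborel. indicator {..0} z * k z) = 1"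
    and iR: "integrable lborel (\<lambda>z. indicator {0..} z * (- k z))" "(LINT z|lborel. indicator {0..} z * (- k z)) = 1"
    using k_left k_right by (auto simp: has_bochner_integral_iff)
  have "- ev (conv k w) x = (LINT z|lborel. - (k z * ev w (x - z)))"
    by (simp add: ev_conv[OF k_integrable])
  also have "\<dots> \<le> (LINT z|lborel. b * (indicator {0..} z * (- k z)) - a * (indicator {..0} z * k z))"
  proof (intro integral_mono Bochner_Integration.integrable_diff integrable_mult_right iL iR Bochner_Integration.integrable_minus ev_conv_integrable[OF k_integrable])
    fix z :: real
    have k0: "k 0 = 0" using k_odd[of 0] by simp
    consider "z = 0" | "0 < z" | "z < 0" by linarith
    then show "- (k z * ev w (x - z)) \<le> b * (indicator {0..} z * (- k z)) - a * (indicator {..0} z * k z)"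
    proof cases
      case 2
      then have "(- k z) * ev w (x - z) \<le> (- k z) * b" using k_nonpos[of z] assms by (intro mult_left_mono) auto
      then show ?thesis using 2 by (simp add: indicator_def mult.commute)
    next
      case 3
      then have "k z * a \<le> k z * ev w (x - z)" using k_nonpos[of "- z"] k_odd[of z] assms by (intro mult_left_mono) auto
      then show ?thesis using 3 by (simp add: indicator_def mult.commute)
    qed (simp add: k0)
  qed
  also have "\<dots> = b - a" using iL iR by (simp del: mult_minus_right)
  finally show ?thesis .
qed

text \<open>Integration by parts over \<open>{- n..n}\<close>; the boundary terms vanish because
  \<open>K\<close> is bounded by 1 and \<open>f\<close> decays. This brings the equation into the
  form with \<open>vf k\<close>.\<close>

lemma conv_K_deriv: "(LINT \<xi>|lborel. K (x - \<xi>) * deriv (ev f) \<xi>) = ev (conv k f) x"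
proof -
  let ?p = "\<lambda>z. k z * ev f (x - z) - K z * ev (dx f) (x - z)"
  obtain B where B: "\<And>x. \<bar>ev (dx f) x\<bar> \<le> B" using ev_bounded by blast
  have i1: "integrable lborel (\<lambda>z. k z * ev f (x - z))" by (rule ev_conv_integrable[OF k_integrable])
  have i2: "integrable lborel (\<lambda>z. K z * ev (dx f) (x - z))" by (rule ev_conv_integrable[OF K_int])
  have i: "integrable lborel ?p" using i1 i2 by simp
  note [measurable] = borel_measurable_integrable[OF i]
  have "(LINT z|lborel. ?p z) = 0"
  proof (rule LIMSEQ_unique)
    show "(\<lambda>n. LINT z|lborel. indicator {- real n..real n} z * ?p z) \<longlonglongrightarrow> (LINT z|lborel. ?p z)"
    proof (rule integral_dominated_convergence[where w="\<lambda>z. \<bar>?p z\<bar>"])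
      show "AE z in lborel. (\<lambda>n. indicator {- real n..real n} z * ?p z) \<longlonglongrightarrow> ?p z"
      proof (intro AE_I2 tendsto_eventually)
        fix z
        obtain n0 :: nat where "\<bar>z\<bar> \<le> real n0" using real_arch_simple by blast
        then show "eventually (\<lambda>n. indicator {- real n..real n} z * ?p z = ?p z) sequentially"
          by (intro eventually_sequentiallyI[of n0]) (auto simp: indicator_def)
      qed
    qed (use i in \<open>auto simp: indicator_def\<close>)
    let ?F = "\<lambda>z. K z * ev f (x - z)"
    have "(LINT z|lborel. indicator {- real n..real n} z *\<^sub>R ?p z) = ?F (real n) - ?F (- real n)" for n
    proof (rule integral_FTC_Icc)
      fix z
      have "((\<lambda>z. ev f (x - z)) has_real_derivative ev (dx f) (x - z) * (0 - 1)) (at z)"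
        by (rule DERIV_chain2[OF ev_DERIV DERIV_diff[OF DERIV_const DERIV_ident]])
      from DERIV_mult[OF K_DERIV this] have "(?F has_real_derivative ?p z) (at z)" by (simp add: algebra_simps)
      then show "(?F has_vector_derivative ?p z) (at z within {- real n..real n})"
        by (simp add: has_real_derivative_iff_has_vector_derivative[symmetric] has_field_derivative_at_within)
    next
      have "isCont K z" for z using K_DERIV DERIV_isCont by blast
      then show "continuous_on {- real n..real n} ?p"
        by (intro continuous_at_imp_continuous_on ballI continuous_intros isCont_o2[OF _ ev_isCont] k_isCont) auto
    qed simp
    moreover have "(\<lambda>n. ?F (real n) - ?F (- real n)) \<longlonglongrightarrow> 0 - 0"
    proof (intro tendsto_diff)
      have F0: "(\<lambda>n. ?F (Y n)) \<longlonglongrightarrow> 0" if "filterlim (\<lambda>n. \<bar>x - Y n\<bar>) at_top sequentially" for Y :: "nat \<Rightarrow> real"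
      proof (rule Lim_null_comparison)
        show "(\<lambda>n. \<bar>ev f (x - Y n)\<bar>) \<longlonglongrightarrow> 0" using tendsto_rabs_zero[OF ev_decay[OF that]] .
        show "\<forall>\<^sub>F n in sequentially. norm (?F (Y n)) \<le> \<bar>ev f (x - Y n)\<bar>"
          using mult_right_mono[OF K_abs_le] by (auto simp: abs_mult intro!: always_eventually)
      qed
      have ft: "filterlim (\<lambda>n. real n - \<bar>x\<bar>) at_top sequentially"
        using filterlim_tendsto_add_at_top[OF tendsto_const[of "- \<bar>x\<bar>"] filterlim_real_sequentially] by (simp add: add.commute)
      show "(\<lambda>n. ?F (real n)) \<longlonglongrightarrow> 0"
        by (rule F0[of "\<lambda>n. real n"], rule filterlim_at_top_mono[OF ft]) (auto intro!: always_eventually)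
      show "(\<lambda>n. ?F (- real n)) \<longlonglongrightarrow> 0"
        by (rule F0[of "\<lambda>n. - real n"], rule filterlim_at_top_mono[OF ft]) (auto intro!: always_eventually)
    qed
    ultimately show "(\<lambda>n. LINT z|lborel. indicator {- real n..real n} z * ?p z) \<longlonglongrightarrow> 0" by simp
  qed
  then have "(LINT z|lborel. K z * ev (dx f) (x - z)) = (LINT z|lborel. k z * ev f (x - z))" using i1 i2 by simp
  moreover have "(LINT \<xi>|lborel. K (x - \<xi>) * ev (dx f) \<xi>) = (LINT z|lborel. K z * ev (dx f) (x - z))"
    using lborel_integral_real_affine[of "-1" "\<lambda>\<xi>. K (x - \<xi>) * ev (dx f) \<xi>" x] by simp
  ultimately show ?thesis by (simp add: ev_conv[OF k_integrable] dx.rep_eq)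
qed

end

subsection \<open>Suprema along differentiable curves and wave breaking\<close>

definition mx :: "hinf \<Rightarrow> real" where "mx f = (SUP x. ev f x)"

lemma ev_le_mx: "ev f x \<le> mx f"
proof -
  obtain B where "\<And>x. \<bar>ev f x\<bar> \<le> B" using ev_bounded by blast
  then have "bdd_above (range (ev f))" by (intro bdd_aboveI[of _ B]) (auto simp: abs_le_iff)
  then show ?thesis unfolding mx_def by (intro cSUP_upper) auto
qed

lemma mx_le: "(\<And>x. ev f x \<le> B) \<Longrightarrow> mx f \<le> B"
  unfolding mx_def by (intro cSUP_least) auto

lemma mx_nonneg: "0 \<le> mx f"
proof (rule LIMSEQ_le_const2)
  show "(\<lambda>n. ev f (real n)) \<longlonglongrightarrow> 0" by (rule ev_decay) (simp add: filterlim_real_sequentially)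
qed (use ev_le_mx in blast)

lemma INF_ev: "(INF x. ev f x) = - mx (- f)"
  by (simp add: Inf_real_def mx_def image_image)

text \<open>Elements of \<open>hinf\<close> decay, so a positive supremum is taken on a compact
  interval; a supremum equal to 0 may be approached only at infinity.\<close>

lemma mx_attained:
  assumes "0 < mx f"
  obtains \<xi> where "ev f \<xi> = mx f" "ev (dx f) \<xi> = 0"
proof -
  have "\<exists>n::nat. \<forall>x. real n \<le> \<bar>x\<bar> \<longrightarrow> ev f x \<le> mx f / 2"
  proof (rule ccontr)
    assume "\<not> ?thesis"
    then obtain X where X: "\<And>n::nat. real n \<le> \<bar>X n\<bar>" "\<And>n. mx f / 2 < ev f (X n)" by (auto simp: not_le) metis
    have "filterlim (\<lambda>n. \<bar>X n\<bar>) at_top sequentially"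
      by (rule filterlim_at_top_mono[OF filterlim_real_sequentially]) (use X(1) in auto)
    from LIMSEQ_le_const[OF ev_decay[OF this]] X(2) have "mx f / 2 \<le> 0" by (meson less_imp_le)
    then show False using assms by simp
  qed
  then obtain n :: nat where n: "\<And>x. real n \<le> \<bar>x\<bar> \<Longrightarrow> ev f x \<le> mx f / 2" by blast
  have "\<exists>\<xi>\<in>{- real n..real n}. \<forall>x\<in>{- real n..real n}. ev f x \<le> ev f \<xi>"
    by (intro continuous_attains_sup) (auto intro!: continuous_at_imp_continuous_on ev_isCont)
  then obtain \<xi> where \<xi>: "\<And>x. x \<in> {- real n..real n} \<Longrightarrow> ev f x \<le> ev f \<xi>" by blast
  have "mx f \<le> max (ev f \<xi>) (mx f / 2)"
  proof (rule mx_le)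
    fix x show "ev f x \<le> max (ev f \<xi>) (mx f / 2)"
      using \<xi>[of x] n[of x] by (cases "real n \<le> \<bar>x\<bar>") (auto simp: le_max_iff_disj abs_if split: if_splits)
  qed
  then have m: "ev f \<xi> = mx f" using ev_le_mx[of f \<xi>] assms by (auto simp: max_def split: if_splits)
  have "ev (dx f) \<xi> = 0"
    by (rule DERIV_local_max[OF ev_DERIV zero_less_one]) (use m ev_le_mx in auto)
  with m that show ?thesis by blast
qed

lemma mx_lipschitz:
  assumes "\<And>x. \<bar>ev f x - ev g x\<bar> \<le> e"
  shows "\<bar>mx f - mx g\<bar> \<le> e"
proof -
  have "mx f \<le> mx g + e" by (rule mx_le) (use assms ev_le_mx in \<open>smt (verit)\<close>)
  moreover have "mx g \<le> mx f + e" by (rule mx_le) (use assms ev_le_mx in \<open>smt (verit)\<close>)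
  ultimately show ?thesis by linarith
qed

lemma mx_continuous:
  assumes "\<And>t. t \<in> I \<Longrightarrow> tends f (f t) (at t within I)"
  shows "continuous_on I (\<lambda>t. mx (f t))"
  unfolding continuous_on_def
proof (intro ballI tendstoI)
  fix t and e :: real assume t: "t \<in> I" and e: "0 < e"
  from tends_sup[OF assms[OF t], of "e / 2"] e
  have "\<forall>\<^sub>F s in at t within I. \<forall>x. \<bar>ev (f s) x - ev (f t) x\<bar> < e / 2" by simp
  then show "\<forall>\<^sub>F s in at t within I. dist (mx (f s)) (mx (f t)) < e"
  proof eventually_elim
    case (elim s)
    then have "\<bar>mx (f s) - mx (f t)\<bar> \<le> e / 2" by (intro mx_lipschitz) (auto intro: less_imp_le)
    then show ?case using e by (simp add: dist_real_def)
  qed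
qed

lemma at_right_le_within: "a \<le> t \<Longrightarrow> t < b \<Longrightarrow> at_right t \<le> at t within {a..<b}" for t :: real
proof -
  assume t: "a \<le> t" "t < b"
  have "at_right t = at t within {t<..<b}" using t by (intro at_within_nhd[of t "{..<b}"]) auto
  then show ?thesis using t by (auto intro: at_le)
qed

text \<open>An upper bound for \<open>mx (f s)\<close> must use a maximizer at the later time
  \<open>s\<close>. By uniform convergence of \<open>f\<close> and \<open>dx f\<close> it is at time
  \<open>t\<close> a point of almost maximal value and almost vanishing slope, whence the form of
  \<open>B\<close>. If \<open>f s\<close> has supremum 0 there may be no maximizer, and
  \<open>pos\<close> makes the right-hand side nonnegative.\<close>

lemma mx_dini:
  assumes f: "HD {0..<T} f t v" and t: "0 \<le> t" "t < T"
    and B: "\<And>e. 0 < e \<Longrightarrow> \<exists>\<eta>>0. \<forall>x. mx (f t) - \<eta> \<le> ev (f t) x \<longrightarrow> \<bar>ev (dx (f t)) x\<bar> \<le> \<eta> \<longrightarrow> ev v x \<le> B + e"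
    and pos: "0 < mx (f t) \<or> 0 \<le> B"
  shows "dini (\<lambda>s. mx (f s)) t B"
  unfolding dini_def
proof (intro allI impI)
  fix e :: real assume e: "0 < e"
  have e2: "0 < e / 2" using e by simp
  obtain \<eta> where \<eta>: "\<eta> > 0" "\<And>x. mx (f t) - \<eta> \<le> ev (f t) x \<Longrightarrow> \<bar>ev (dx (f t)) x\<bar> \<le> \<eta> \<Longrightarrow> ev v x \<le> B + e / 2"
    using B[OF e2] by blast
  have \<eta>2: "0 < \<eta> / 2" using \<eta>(1) by simp
  note le = at_right_le_within[OF t, THEN filter_leD]
  note c = HD_continuous[OF f]
  have 1: "\<forall>\<^sub>F s in at_right t. \<forall>x. \<bar>ev ((1 / (s - t)) *\<^sub>R (f s - f t)) x - ev v x\<bar> < e / 2"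
    by (rule le[OF tends_sup[OF f[unfolded HD_def] e2]])
  have 2: "\<forall>\<^sub>F s in at_right t. \<forall>x. \<bar>ev (f s) x - ev (f t) x\<bar> < \<eta> / 2"
    by (rule le[OF tends_sup[OF c \<eta>2]])
  have 3: "\<forall>\<^sub>F s in at_right t. \<forall>x. \<bar>ev (dx (f s)) x - ev (dx (f t)) x\<bar> < \<eta>"
    by (rule le[OF tends_sup[OF tends_dx[OF c] \<eta>(1)]])
  have 4: "\<forall>\<^sub>F s in at_right t. s > t" by (rule eventually_at_right_less)
  have 5: "\<forall>\<^sub>F s in at_right t. 0 \<le> mx (f t) + (B + e) * (s - t)"
    using pos
  proof
    assume "0 < mx (f t)"
    have "((\<lambda>s. mx (f t) + (B + e) * (s - t)) \<longlongrightarrow> mx (f t) + (B + e) * (t - t)) (at_right t)" by (intro tendsto_intros)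
    then have "\<forall>\<^sub>F s in at_right t. 0 < mx (f t) + (B + e) * (s - t)" using \<open>0 < mx (f t)\<close> by (intro order_tendstoD) auto
    then show ?thesis by (rule eventually_mono) simp
  next
    assume "0 \<le> B"
    from 4 show ?thesis by (rule eventually_mono) (use \<open>0 \<le> B\<close> e mx_nonneg in auto)
  qed
  from 1 2 3 4 5 show "\<forall>\<^sub>F s in at_right t. mx (f s) \<le> mx (f t) + (B + e) * (s - t)"
  proof eventually_elim
    case (elim s)
    show ?case
    proof (cases "0 < mx (f s)")
      case True
      then obtain \<xi> where \<xi>: "ev (f s) \<xi> = mx (f s)" "ev (dx (f s)) \<xi> = 0" by (rule mx_attained)
      have m: "\<bar>mx (f s) - mx (f t)\<bar> \<le> \<eta> / 2" using elim(2) by (intro mx_lipschitz) (auto intro: less_imp_le)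
      have "ev v \<xi> \<le> B + e / 2"
      proof (rule \<eta>(2))
        show "mx (f t) - \<eta> \<le> ev (f t) \<xi>" using elim(2)[rule_format, of \<xi>] m \<xi>(1) unfolding abs_le_iff abs_less_iff by linarith
        show "\<bar>ev (dx (f t)) \<xi>\<bar> \<le> \<eta>" using elim(3)[rule_format, of \<xi>] \<xi>(2) by simp
      qed
      then have "ev ((1 / (s - t)) *\<^sub>R (f s - f t)) \<xi> \<le> B + e" using elim(1)[rule_format, of \<xi>] unfolding abs_less_iff by linarith
      then have "ev (f s) \<xi> - ev (f t) \<xi> \<le> (B + e) * (s - t)" using elim(4) by (simp add: pos_divide_le_eq)
      then show ?thesis using \<xi>(1) ev_le_mx[of "f t" \<xi>] by linarith
    next
      case False
      then show ?thesis using elim(5) by linarith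
    qed
  qed
qed

text \<open>An upper bound for an infimum needs only one test point, so a minimizer at time
  \<open>t\<close> may be kept fixed; no near-minima are involved, unlike in
  \<open>mx_dini\<close>.\<close>

lemma neg_mx_dini:
  assumes w: "HD {0..<T} w t v" and t: "0 \<le> t" "t < T" and \<xi>: "ev (- w t) \<xi> = mx (- w t)"
  shows "dini (\<lambda>s. - mx (- w s)) t (ev v \<xi>)"
  unfolding dini_def
proof (intro allI impI)
  fix e :: real assume e: "0 < e"
  have "((\<lambda>s. ev (w s) \<xi>) has_real_derivative ev v \<xi>) (at_right t)"
    using HD_ev[OF w] unfolding has_field_derivative_iff by (rule tendsto_mono[OF at_right_le_within[OF t]])
  from diniD[OF dini_DERIV[OF this] e]
  show "\<forall>\<^sub>F s in at_right t. - mx (- w s) \<le> - mx (- w t) + (ev v \<xi> + e) * (s - t)"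
  proof eventually_elim
    case (elim s)
    have "- mx (- w s) \<le> ev (w s) \<xi>" using ev_le_mx[of "- w s" \<xi>] by simp
    then show ?case using elim \<xi> by simp
  qed
qed

text \<open>The two additions of 1 are slack for real induction: the first makes the comparison
  function positive, so its value can serve as the \<open>e\<close> of the Dini bound; the second
  absorbs that \<open>e\<close> in the rate.\<close>

lemma dini_gronwall:
  fixes f :: "real \<Rightarrow> real"
  assumes b: "0 \<le> b" and c: "continuous_on {0..b} f" and nonneg: "0 \<le> f 0" and L: "0 \<le> L"
    and d: "\<And>t. 0 \<le> t \<Longrightarrow> t < b \<Longrightarrow> dini f t (L * f t)"
  shows "f b \<le> (f 0 + 1) * exp ((L + 1) * b)"
proof (rule interval_induct[where P="\<lambda>t. f t \<le> (f 0 + 1) * exp ((L + 1) * t)" and a=0 and b=b])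
  show "closed {t \<in> {0..b}. f t \<le> (f 0 + 1) * exp ((L + 1) * t)}"
    by (intro continuous_on_closed_Collect_le c continuous_intros)
  fix t assume t: "0 \<le> t" "t < b" "f t \<le> (f 0 + 1) * exp ((L + 1) * t)"
  let ?Y = "(f 0 + 1) * exp ((L + 1) * t)"
  have Y: "0 < ?Y" using nonneg by (intro mult_pos_pos) auto
  obtain u where u: "u > t" "\<And>s. t < s \<Longrightarrow> s < u \<Longrightarrow> f s \<le> f t + (L * f t + ?Y) * (s - t)"
    using diniD[OF d[OF t(1,2)] Y] unfolding eventually_at_right_field by blast
  have "f s \<le> (f 0 + 1) * exp ((L + 1) * s)" if s: "t < s" "s < u" for s
  proof -
    have "f s \<le> f t + (L * f t + ?Y) * (s - t)" by (rule u(2)[OF s])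
    also have "\<dots> \<le> ?Y + (L * ?Y + ?Y) * (s - t)"
      using t(3) L s by (intro add_mono mult_right_mono mult_left_mono) auto
    also have "\<dots> = ?Y * (1 + (L + 1) * (s - t))" by (simp add: algebra_simps)
    also have "\<dots> \<le> ?Y * exp ((L + 1) * (s - t))" using Y by (intro mult_left_mono) auto
    also have "\<dots> = (f 0 + 1) * exp ((L + 1) * s)" by (simp add: mult.assoc algebra_simps flip: exp_add)
    finally show ?thesis .
  qed
  then show "\<exists>\<delta>>0. \<forall>s. t < s \<longrightarrow> s < t + \<delta> \<longrightarrow> f s \<le> (f 0 + 1) * exp ((L + 1) * s)"
    using u(1) by (intro exI[of _ "u - t"]) auto
qed (use b in auto)

lemma ev_vf: "ev (vf k f) x = - (ev f x * ev (dx f) x) - ev (conv k f) x"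
  by (simp add: vf_def)

lemma ev_dx_vf:
  assumes "integrable lborel k"
  shows "ev (dx (vf k f)) x = - (ev (dx f) x)\<^sup>2 - ev f x * ev (dx (dx f)) x - ev (conv k (dx f)) x"
  by (simp add: vf_def dx_mult dx_conv[OF assms] power2_eq_square)

lemma mx_bounds: "- mx (- f) \<le> ev f x" "ev f x \<le> mx f" "\<bar>ev f x\<bar> \<le> max (mx f) (mx (- f))"
  using ev_le_mx[of "- f" x] ev_le_mx[of f x] by auto

lemma dini_max:
  assumes "dini f t B" "dini g t B"
  shows "dini (\<lambda>s. max (f s) (g s)) t B"
  unfolding dini_def
proof (intro allI impI)
  fix e :: real assume "0 < e"
  from diniD[OF assms(1) this] diniD[OF assms(2) this]
  show "\<forall>\<^sub>F s in at_right t. max (f s) (g s) \<le> max (f t) (g t) + (B + e) * (s - t)"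
    by eventually_elim auto
qed

text \<open>Where the slope is at most \<open>e / (S t + 1)\<close>, the transport term
  \<open>u * u\<^sub>x\<close> is at most \<open>e\<close>, so near extrema only the convolution
  acts, and it is bounded by \<open>L1 k * S t\<close>. Gronwall then applies to the larger of the
  two suprema.\<close>

lemma vf_sup_bound:
  assumes k: "integrable lborel k" and T: "0 < T"
    and V: "\<And>t. t \<in> {0..<T} \<Longrightarrow> HD {0..<T} V t (vf k (V t))"
  obtains C where "\<And>t x. 0 \<le> t \<Longrightarrow> t < T \<Longrightarrow> \<bar>ev (V t) x\<bar> \<le> C"
proof -
  define S where "S t = max (mx (V t)) (mx (- V t))" for t
  have S0: "0 \<le> S t" for t using mx_nonneg[of "V t"] by (simp add: S_def le_max_iff_disj)
  have S: "\<bar>ev (V t) x\<bar> \<le> S t" for t x unfolding S_def by (rule mx_bounds(3))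
  have B0: "0 \<le> L1 k * S t" for t using S0 L1_nonneg by (intro mult_nonneg_nonneg) auto
  have pt: "\<bar>ev (vf k (V t)) x\<bar> \<le> L1 k * S t + e" if "0 < e" "\<bar>ev (dx (V t)) x\<bar> \<le> e / (S t + 1)" for t x e
  proof -
    have "\<bar>ev (V t) x * ev (dx (V t)) x\<bar> \<le> S t * (e / (S t + 1))"
      unfolding abs_mult using that S S0 by (intro mult_mono) auto
    also have "\<dots> \<le> e" using S0[of t] that(1) by (simp add: field_simps)
    finally show ?thesis using ev_conv_bound[OF k S, of t x] unfolding ev_vf by linarith
  qed
  have \<eta>: "0 < e / (S t + 1)" if "0 < e" for t e using S0[of t] that by simp
  have ex: "\<exists>\<eta>>0. \<forall>x. mx (V t) - \<eta> \<le> ev (V t) x \<longrightarrow> \<bar>ev (dx (V t)) x\<bar> \<le> \<eta> \<longrightarrow> ev (vf k (V t)) x \<le> L1 k * S t + e"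
    if "0 < e" for t e
    using \<eta>[OF that, of t] abs_le_D1[OF pt[OF that]] by blast
  have ex': "\<exists>\<eta>>0. \<forall>x. mx (- V t) - \<eta> \<le> ev (- V t) x \<longrightarrow> \<bar>ev (dx (- V t)) x\<bar> \<le> \<eta> \<longrightarrow> ev (- vf k (V t)) x \<le> L1 k * S t + e"
    if "0 < e" for t e
    using \<eta>[OF that, of t] abs_le_D2[OF pt[OF that]] unfolding dx_minus ev_minus abs_minus_cancel by blast
  have d: "dini S t (L1 k * S t)" if t: "0 \<le> t" "t < T" for t
    unfolding S_def[abs_def]
  proof (rule dini_max)
    show "dini (\<lambda>s. mx (V s)) t (L1 k * max (mx (V t)) (mx (- V t)))"
      unfolding S_def[symmetric]
      by (rule mx_dini[OF V t ex]) (use t B0 in auto)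
    have "HD {0..<T} (\<lambda>s. - V s) t (- vf k (V t))" using t by (intro HD_minus V) auto
    then show "dini (\<lambda>s. mx (- V s)) t (L1 k * max (mx (V t)) (mx (- V t)))"
      unfolding S_def[symmetric]
      by (rule mx_dini[OF _ t ex']) (use t B0 in auto)
  qed
  have c: "continuous_on {0..t} S" if "t < T" for t
  proof -
    have "continuous_on {0..<T} S"
      unfolding S_def using HD_continuous[OF V]
      by (intro continuous_on_max mx_continuous tends_minus) auto
    then show ?thesis using that by (auto elim: continuous_on_subset)
  qed
  have "\<bar>ev (V t) x\<bar> \<le> (S 0 + 1) * exp ((L1 k + 1) * T)" if t: "0 \<le> t" "t < T" for t x
  proof -
    have "S t \<le> (S 0 + 1) * exp ((L1 k + 1) * t)"
      by (rule dini_gronwall[OF t(1) c[OF t(2)] S0 L1_nonneg d]) (use t in auto)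
    also have "\<dots> \<le> (S 0 + 1) * exp ((L1 k + 1) * T)"
      using S0[of 0] L1_nonneg[of k] t by (intro mult_left_mono) (auto intro!: mult_left_mono)
    finally show ?thesis using S[of t x] by linarith
  qed
  then show ?thesis by (rule that)
qed

section \<open>Solutions as differentiable curves and the bound on their lifespan\<close>

context decreasing_kernel
begin

text \<open>The equation is imposed for \<open>t > 0\<close> only; at \<open>t = 0\<close> it
  follows because both sides are continuous. A finite \<open>b\<close> replaces the possibly
  infinite \<open>T\<close>.\<close>

lemma solution_HD:
  assumes sol: "smooth_solution K u0 T u" and b: "0 < b" "ereal b \<le> T"
  obtains V where "\<And>t. t \<in> {0..<b} \<Longrightarrow> u t = ev (V t)" "\<And>t. t \<in> {0..<b} \<Longrightarrow> HD {0..<b} V t (vf k (V t))"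
proof -
  let ?I = "{t. 0 \<le> t \<and> ereal t < T}" and ?J = "{0..<b}"
  have JI: "?J \<subseteq> ?I"
  proof
    fix t assume t: "t \<in> ?J"
    then have "ereal t < ereal b" by simp
    also note b(2)
    finally show "t \<in> ?I" using t by simp
  qed
  have "smooth_H_infty_curve ?I u" using sol by (simp add: smooth_solution_def)
  then obtain V where V0: "\<And>t. t \<in> ?I \<Longrightarrow> u t = ev (V 0 t)" and VD: "\<And>n t. t \<in> ?I \<Longrightarrow> HD ?I (V n) t (V (Suc n) t)"
    by (rule smooth_curve_HD) blast
  have HD: "HD ?J (V n) t (V (Suc n) t)" if "t \<in> ?J" for n t
    using HD_mono[OF VD JI] that JI by blast
  have pos: "V 1 t = vf k (V 0 t)" if t: "t \<in> ?J" "0 < t" for t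
  proof (rule hinf_eqI)
    fix x
    have at: "at t within ?J = at t" using t by (intro at_within_nhd[of t "{0<..<b}"]) auto
    have "((\<lambda>\<tau>. ev (V 0 \<tau>) x) has_real_derivative ev (V 1 t) x) (at t)"
      using HD_ev[OF HD[OF t(1), of 0], of x] by (simp add: at)
    then have "((\<lambda>\<tau>. u \<tau> x) has_real_derivative ev (V 1 t) x) (at t)"
      by (rule has_field_derivative_transform_within_open[where S="{0<..<b}"]) (use t V0[OF subsetD[OF JI]] in auto)
    then have "deriv (\<lambda>\<tau>. u \<tau> x) t = ev (V 1 t) x" by (rule DERIV_imp_deriv)
    moreover have "0 < t \<and> ereal t < T" using subsetD[OF JI t(1)] t(2) by simp
    then have "deriv (\<lambda>\<tau>. u \<tau> x) t + u t x * deriv (u t) x + (LINT \<xi>|lborel. K (x - \<xi>) * deriv (u t) \<xi>) = 0"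
      using sol unfolding smooth_solution_def by blast
    moreover have "u t = ev (V 0 t)" by (rule V0[OF subsetD[OF JI t(1)]])
    ultimately show "ev (V 1 t) x = ev (vf k (V 0 t)) x"
      by (simp add: conv_K_deriv ev_vf dx.rep_eq)
  qed
  have "V 1 0 = vf k (V 0 0)"
  proof (rule tendsto_unique)
    have 0: "0 \<in> ?J" using b by simp
    have "{0..<b} - {0} = {0<..<b}" by auto
    then show "at 0 within ?J \<noteq> bot" using b by (simp add: at_within_eq_bot_iff)
    show "((\<lambda>t. V 1 t) \<longlongrightarrow> V 1 0) (at 0 within ?J)"
      using HD[OF 0, of 1] by (intro tends_tendsto HD_continuous)
    have "((\<lambda>t. vf k (V 0 t)) \<longlongrightarrow> vf k (V 0 0)) (at 0 within ?J)"
      using HD[OF 0, of 0] by (intro tends_tendsto tends_vf k_integrable HD_continuous)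
    then show "((\<lambda>t. V 1 t) \<longlongrightarrow> vf k (V 0 0)) (at 0 within ?J)"
      by (rule Lim_transform_eventually) (use pos in \<open>auto simp: eventually_at_filter intro!: always_eventually\<close>)
  qed
  with pos have "V 1 t = vf k (V 0 t)" if "t \<in> ?J" for t using that by (cases "t = 0") auto
  then show ?thesis using that[of "V 0"] HD[of _ 0] V0[OF subsetD[OF JI]] by auto
qed

lemma HD_solution:
  assumes T: "0 < T" and W: "\<And>t. t \<in> {0..<T} \<Longrightarrow> HD {0..<T} W t (vf k (W t))" and 0: "\<And>x. ev (W 0) x = u0 x"
  shows "smooth_solution K u0 (ereal T) (\<lambda>t. ev (W t))"
proof -
  have I: "{t. 0 \<le> t \<and> ereal t < ereal T} = {0..<T}" by auto
  have D: "((\<lambda>\<tau>. ev (W \<tau>) x) has_real_derivative ev (vf k (W t)) x) (at t)" if "0 < t" "t < T" for t x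
  proof -
    have "at t within {0..<T} = at t" using that by (intro at_within_nhd[of t "{0<..<T}"]) auto
    then show ?thesis using HD_ev[OF W, of t x] that by simp
  qed
  show ?thesis
    unfolding smooth_solution_def I
  proof (intro conjI allI impI)
    show "smooth_H_infty_curve {0..<T} (\<lambda>t. ev (W t))" by (rule HD_vf_smooth_curve[OF k_integrable W]) auto
    fix t x assume t: "0 < t \<and> ereal t < ereal T"
    then show "(\<lambda>\<tau>. ev (W \<tau>) x) field_differentiable at t" using D[of t x] by (auto simp: field_differentiable_def)
    have "deriv (\<lambda>\<tau>. ev (W \<tau>) x) t = ev (vf k (W t)) x" using t by (intro DERIV_imp_deriv D) auto
    then show "deriv (\<lambda>\<tau>. ev (W \<tau>) x) t + ev (W t) x * deriv (ev (W t)) x + (LINT \<xi>|lborel. K (x - \<xi>) * deriv (ev (W t)) \<xi>) = 0"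
      by (simp add: conv_K_deriv ev_vf dx.rep_eq)
  qed (use T 0 in auto)
qed

lemma lifespan:
  assumes T: "0 < T" and V: "\<And>t. t \<in> {0..<T} \<Longrightarrow> HD {0..<T} V t (vf k (V t))"
    and m1: "m1 = - mx (- dx (V 0))" and m2: "m2 = mx (dx (V 0))"
    and a: "m1 < -2" and b: "m2 < m1\<^sup>2 + m1"
  shows "T < 1 / 2 * ln (m1 / (2 + m1)) + max 0 ((m1 + m2) / (2 * m1 * (2 + m1)))"
proof -
  let ?w = "\<lambda>t. dx (V t)"
  let ?m1 = "\<lambda>t. - mx (- ?w t)" and ?m2 = "\<lambda>t. mx (?w t)"
  have W: "HD {0..<T} ?w t (dx (vf k (V t)))" if "0 \<le> t" "t < T" for t using that by (intro HD_dx V) auto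
  have c: "tends ?w (?w t) (at t within {0..<T})" if "t \<in> {0..<T}" for t using HD_continuous[OF W] that by auto
  have osc: "- ev (conv k (?w t)) x \<le> ?m2 t - ?m1 t" for t x by (rule conv_oscillation) (rule mx_bounds)+
  have "T < 1 / 2 * ln (?m1 0 / (2 + ?m1 0)) + max 0 ((?m1 0 + ?m2 0) / (2 * ?m1 0 * (2 + ?m1 0)))"
  proof (rule riccati_lifespan[OF T])
    show "continuous_on {0..<T} ?m1" by (intro continuous_on_minus mx_continuous tends_minus c)
    show "continuous_on {0..<T} ?m2" by (intro mx_continuous c)
    show "dini ?m1 t (- (?m1 t)\<^sup>2 + ?m2 t - ?m1 t)" if t: "0 \<le> t" "t < T" "?m1 t < 0" for t
    proof -
      \<comment> \<open>Since \<open>?m1 t < 0\<close>, the supremum of \<open>- ?w t\<close> is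
        positive and therefore attained.\<close>
      obtain \<xi> where \<xi>: "ev (- ?w t) \<xi> = mx (- ?w t)" "ev (dx (- ?w t)) \<xi> = 0" using mx_attained[of "- ?w t"] t(3) by auto
      have "ev (dx (vf k (V t))) \<xi> = - (?m1 t)\<^sup>2 - ev (conv k (?w t)) \<xi>"
        using \<xi> unfolding ev_dx_vf[OF k_integrable] by simp (metis power2_minus)
      also have "\<dots> \<le> - (?m1 t)\<^sup>2 + ?m2 t - ?m1 t" using osc[of t \<xi>] by linarith
      finally show ?thesis by (rule dini_mono[OF neg_mx_dini[OF W[OF t(1,2)] t(1,2) \<xi>(1)]])
    qed
    show "dini ?m2 t (- (?m2 t)\<^sup>2 + ?m2 t - ?m1 t)" if t: "0 \<le> t" "t < T" "?m1 t < 0" for t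
    proof (rule mx_dini[OF W[OF t(1,2)] t(1,2)])
      \<comment> \<open>If \<open>?m2 t = 0\<close>, the bound reduces to \<open>- ?m1 t\<close>,
        which is positive.\<close>
      show "0 < ?m2 t \<or> 0 \<le> - (?m2 t)\<^sup>2 + ?m2 t - ?m1 t" using mx_nonneg[of "?w t"] t(3) by (cases "?m2 t = 0") auto
      fix e :: real assume e: "0 < e"
      obtain U where U: "\<And>x. \<bar>ev (V t) x\<bar> \<le> U" "0 \<le> U" using ev_bounded by blast
      have m0: "0 \<le> ?m2 t" by (rule mx_nonneg)
      \<comment> \<open>Two errors have to fit into \<open>e\<close>:
        \<open>2 * ?m2 t * \<eta>\<close> from the square of a near-maximal value and
        \<open>U * \<eta>\<close> from the transport term.\<close>
      define \<eta> where "\<eta> = e / (2 * ?m2 t + U + 1)"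
      have den: "0 < 2 * ?m2 t + U + 1" using m0 U(2) by linarith
      have \<eta>: "0 < \<eta>" using e den by (simp add: \<eta>_def)
      have "ev (dx (vf k (V t))) x \<le> - (?m2 t)\<^sup>2 + ?m2 t - ?m1 t + e"
        if x: "?m2 t - \<eta> \<le> ev (?w t) x" "\<bar>ev (dx (?w t)) x\<bar> \<le> \<eta>" for x
      proof -
        have "\<bar>ev (V t) x * ev (dx (?w t)) x\<bar> \<le> U * \<eta>"
          unfolding abs_mult using U x(2) by (intro mult_mono) auto
        \<comment> \<open>Squaring the lower bound \<open>?m2 t - \<eta>\<close> for u_x needs it to
          be nonnegative; otherwise the left-hand side is already at most 0.\<close>
        moreover have "(?m2 t)\<^sup>2 - 2 * ?m2 t * \<eta> \<le> (ev (?w t) x)\<^sup>2"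
        proof (cases "?m2 t \<le> \<eta>")
          case True
          have "?m2 t * ?m2 t \<le> 2 * ?m2 t * \<eta>" using mult_left_mono[OF True m0] mult_nonneg_nonneg[OF m0 less_imp_le[OF \<eta>]] by linarith
          then show ?thesis using zero_le_power2[of "ev (?w t) x"] unfolding power2_eq_square by linarith
        next
          case False
          then have "(?m2 t - \<eta>)\<^sup>2 \<le> (ev (?w t) x)\<^sup>2" using x(1) by (intro power_mono) auto
          then show ?thesis using zero_le_power2[of \<eta>] unfolding power2_diff by linarith
        qed
        moreover have "2 * ?m2 t * \<eta> + U * \<eta> \<le> e"
        proof -
          have "2 * ?m2 t * \<eta> + U * \<eta> \<le> (2 * ?m2 t + U + 1) * \<eta>" using \<eta> by (simp add: algebra_simps)
          also have "\<dots> = e" using den by (simp add: \<eta>_def)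
          finally show ?thesis .
        qed
        ultimately show ?thesis using osc[of t x] unfolding ev_dx_vf[OF k_integrable] abs_le_iff by linarith
      qed
      with \<eta> show "\<exists>\<eta>>0. \<forall>x. ?m2 t - \<eta> \<le> ev (?w t) x \<longrightarrow> \<bar>ev (dx (?w t)) x\<bar> \<le> \<eta> \<longrightarrow> ev (dx (vf k (V t))) x \<le> - (?m2 t)\<^sup>2 + ?m2 t - ?m1 t + e"
        by blast
    qed
  qed (use a b in \<open>auto simp: m1 m2 mx_nonneg\<close>)
  then show ?thesis unfolding m1 m2 .
qed

end

theorem theorem1p1:
  fixes K u0 :: "real \<Rightarrow> real" and u :: "real \<Rightarrow> real \<Rightarrow> real"
    and Tmax :: ereal and m1 m2 :: real
  assumes "smooth K"
    and "integrable lborel K"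
    and "\<And>x. K (- x) = K x"
    and "antimono_on {0..} K"
    and "K 0 = 1"
    and "u0 \<in> H_infty"
    and "maximal_smooth_solution K u0 Tmax u"
    and "m1 = (INF x. deriv u0 x)"
    and "m2 = (SUP x. deriv u0 x)"
    and "(m1, m2) \<in> Omega"
  shows "wave_breaking_before K u0 u
           (1 / 2 * ln (m1 / (2 + m1)) + max 0 ((m1 + m2) / (2 * m1 * (2 + m1))))"
proof -
  interpret decreasing_kernel K by standard (use assms(1-5) in auto)
  let ?Ts = "1 / 2 * ln (m1 / (2 + m1)) + max 0 ((m1 + m2) / (2 * m1 * (2 + m1)))"
  have sol: "smooth_solution K u0 Tmax u"
    and max: "\<And>T' w. Tmax < T' \<Longrightarrow> smooth_solution K u0 T' w \<Longrightarrow> (\<And>t x. 0 \<le> t \<Longrightarrow> ereal t < Tmax \<Longrightarrow> w t x = u t x) \<Longrightarrow> False"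
    using assms(7) unfolding maximal_smooth_solution_def by blast+
  have init: "u 0 = u0" using sol by (auto simp: smooth_solution_def)
  have less: "b < ?Ts" if b: "0 < b" "ereal b \<le> Tmax" for b
  proof -
    obtain V where V: "\<And>t. t \<in> {0..<b} \<Longrightarrow> u t = ev (V t)" "\<And>t. t \<in> {0..<b} \<Longrightarrow> HD {0..<b} V t (vf k (V t))"
      using solution_HD[OF sol b] by blast
    have "u0 = ev (V 0)" using V(1)[of 0] b init by simp
    then have "deriv u0 = ev (dx (V 0))" by (simp add: dx.rep_eq)
    then have "m1 = - mx (- dx (V 0))" "m2 = mx (dx (V 0))"
      using assms(8,9) by (simp_all add: INF_ev mx_def)
    then show ?thesis using assms(10) b V(2) by (intro lifespan[of b V]) (auto simp: Omega_def)
  qed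
  have Tpos: "0 < Tmax" using sol by (simp add: smooth_solution_def)
  \<comment> \<open>If \<open>Tmax\<close> were infinite, \<open>less\<close> would apply to every
    positive real, in particular to \<open>max 1 ?Ts\<close>, which is not below
    \<open>?Ts\<close>.\<close>
  obtain T where T: "Tmax = ereal T"
  proof (cases Tmax)
    case PInf
    have "max 1 ?Ts < ?Ts" by (rule less) (auto simp: PInf less_max_iff_disj)
    then have False by linarith
    then show ?thesis ..

  qed (use Tpos in auto)
  have T0: "0 < T" and Ts: "T < ?Ts" using Tpos less[of T] by (auto simp: T)
  obtain V where Vu: "\<And>t. t \<in> {0..<T} \<Longrightarrow> u t = ev (V t)" and V: "\<And>t. t \<in> {0..<T} \<Longrightarrow> HD {0..<T} V t (vf k (V t))"
    using solution_HD[OF sol T0] T by auto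
  obtain C where C: "\<And>t x. 0 \<le> t \<Longrightarrow> t < T \<Longrightarrow> \<bar>ev (V t) x\<bar> \<le> C"
    using vf_sup_bound[OF k_integrable T0 V] by blast
  have "\<exists>\<^sub>F t in at_left T. \<exists>x. \<bar>deriv (u t) x\<bar> > M" for M
  proof (rule ccontr)
    assume "\<not> ?thesis"
    then have "\<forall>\<^sub>F t in at_left T. \<forall>x. \<bar>deriv (u t) x\<bar> \<le> M" by (simp add: frequently_def not_less)
    then obtain T1 where T1: "T1 < T" "\<And>t x. T1 < t \<Longrightarrow> t < T \<Longrightarrow> \<bar>deriv (u t) x\<bar> \<le> M"
      unfolding eventually_at_left_field by blast
    \<comment> \<open>The bound is known only for times strictly after \<open>T1\<close>, which may
      be negative; \<open>T2\<close> is an admissible starting time between \<open>T1\<close> and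
      \<open>T\<close>.\<close>
    define T2 where "T2 = max 0 ((T1 + T) / 2)"
    have T2: "0 \<le> T2" "T2 < T" "T1 < T2" using T1(1) T0 by (auto simp: T2_def less_max_iff_disj)
    have "\<bar>ev (dx (V t)) x\<bar> \<le> M" if "T2 \<le> t" "t < T" for t x
      using T1(2)[of t x] Vu[of t] that T2 by (simp add: dx.rep_eq)
    then obtain T' W where W: "T < T'" "\<And>t. t \<in> {0..<T} \<Longrightarrow> W t = V t" "\<And>t. t \<in> {0..<T'} \<Longrightarrow> HD {0..<T'} W t (vf k (W t))"
      using continuation[OF k_integrable T2(1,2) V] by blast
    have "smooth_solution K u0 (ereal T') (\<lambda>t. ev (W t))"
      using W T0 Vu[of 0] init by (intro HD_solution) auto
    then show False using W Vu by (intro max[of "ereal T'" "\<lambda>t. ev (W t)"]) (auto simp: T)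
  qed
  then show ?thesis
    unfolding wave_breaking_before_def using T0 Ts sol C Vu by (intro exI[of _ T]) (auto simp: T)
qed

end
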